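(* Let $\Bbbk$ be a perfect field and let $K$ be an $n$-dimensional topological local field over $\Bbbk$. The data $\bigl(\mathrm{E}(K), \{\mathrm{E}(K)_{i,j}\}_{i \in \{1,\ldots,n\},\, j \in \{1,2\}}\bigr)$ of local Beilinson-Tate operators is an $n$-dimensional cubically decomposed ring of operators on $K$.
   Context: **Cubically decomposed rings.** For a commutative $\Bbbk$-ring $A$, an $n$-dimensional cubically decomposed ring of operators on $A$ is data $(E,\{E_{i,j}\})$ consisting of a $\Bbbk$-subring $E\subset\operatorname{End}_{\Bbbk}(A)$ containing $A$ (acting by multiplication), and two-sided ideals $E_{i,j}\subset E$ for $i\in\{1,\ldots,n\}$, $j\in\{1,2\}$, such that: (i) $E=E_{i,1}+E_{i,2}$ for every $i$; (ii) every $\phi\in\bigcap_{i=1}^n\bigcap_{j=1}^2E_{i,j}$ is finite potent, i.e. for some positive integer $q$ the operator $\phi^q$ has finite rank over $\Bbbk$. **Semi-topological (ST) rings and modules.** $\Bbbk$ is a perfect field with the discrete topology. A $\Bbbk$-linear topology on a $\Bbbk$-module is a module topology in which $0$ has a basis of open neighborhoods consisting of $\Bbbk$-submodules. A commutative ST $\Bbbk$-ring is a commutative $\Bbbk$-ring $A$ with a $\Bbbk$-linear topology such that for every $a \in A$ the map $A \to A$, $b \mapsto ab$, is continuous; homomorphisms of ST $\Bbbk$-rings are the continuous $\Bbbk$-ring homomorphisms. A ST $A$-module is an $A$-module $M$ with a $\Bbbk$-linear topology such that for every $a \in A$ and $m \in M$ the maps $M \to M$, $m' \mapsto a m'$, and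 $A \to M$, $a' \mapsto a' m$, are continuous. The fine $A$-module topology on an $A$-module is the finest $\Bbbk$-linear topology making it a ST $A$-module (it exists). **Laurent series.** For a commutative ST $\Bbbk$-ring $A$: give $A[t]/(t^{i+1})$ the fine $A$-module topology, $A[[t]] = \lim_{\leftarrow i} A[t]/(t^{i+1})$ the inverse limit topology, and $A((t)) = A[[t]][t^{-1}]$ the fine $A[[t]]$-module topology. Recursively $A((t_1,\ldots,t_n)) := A((t_2,\ldots,t_n))((t_1))$. **Local fields.** An $n$-dimensional local field is a field $K$ with complete discrete valuation rings $\mathcal{O}_1(K),\ldots,\mathcal{O}_n(K)$ such that $K$ is the fraction field of $\mathcal{O}_1(K)$ and for $1\le i\le n-1$ the residue field of $\mathcal{O}_i(K)$ is the fraction field of $\mathcal{O}_{i+1}(K)$. Let $\boldsymbol{k}_i(K)$ be the residue field of $\mathcal{O}_i(K)$, and $\boldsymbol{k}_0(K):=K$. The ring of integers $\mathcal{O}(K) := \mathcal{O}_1(K)\times_{\boldsymbol{k}_1(K)}\mathcal{O}_2(K)\cdots\times_{\boldsymbol{k}_{n-1}(K)}\mathcal{O}_n(K)$ is a subring of $K$ ($\mathcal{O}(K)=K$ if $n=0$). For a finite field extension $\Bbbk'$ of $\Bbbk$ (discrete topology), the standard $n$-dimensional topological local field is $\Bbbk'((t_1,\ldots,t_n))$ with the iterated Laurent series topology (obtained from the discrete topology on $\Bbbk'$ by the recursion $\Bbbk'((t_1,\ldots,t_n)) = \Bbbk'((t_2,\ldots,t_n))((t_1))$, where $A((t))$ has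 the fine $A[[t]]$-module topology) and with $\mathcal{O}_i = \Bbbk'((t_{i+1},\ldots,t_n))[[t_i]]$. An $n$-dimensional topological local field (TLF) over $\Bbbk$ is an $n$-dimensional local field $K$ with a ring homomorphism $\Bbbk\to\mathcal{O}(K)$ such that $\Bbbk\to\boldsymbol{k}_n(K)$ is finite, and a topology making $K$ a ST $\Bbbk$-ring, for which there exists a $\Bbbk$-ring isomorphism $\Bbbk'((t_1,\ldots,t_n)) \to K$, $\Bbbk' := \boldsymbol{k}_n(K)$, that is a homeomorphism and respects the valuation rings (it maps $\mathcal{O}_1$ onto $\mathcal{O}_1$, the induced map on residue fields maps $\mathcal{O}_2$ onto $\mathcal{O}_2$, etc.). Each $\mathcal{O}_i(K)\subset\boldsymbol{k}_{i-1}(K)$ has the subspace topology and each $\boldsymbol{k}_i(K)$ has the quotient topology from $\mathcal{O}_i(K)$; then $\boldsymbol{k}_i(K)$ is an $(n-i)$-dimensional TLF. **Systems of liftings.** A system of liftings for $K$ is a sequence $\boldsymbol{\sigma}=(\sigma_1,\ldots,\sigma_n)$, where each $\sigma_i:\boldsymbol{k}_i(K)\to\mathcal{O}_i(K)$ is a continuous $\Bbbk$-ring homomorphism splitting the canonical surjection $\mathcal{O}_i(K)\to\boldsymbol{k}_i(K)$ (the empty sequence if $n=0$). If $n \geq 1$, $\mathrm{d}_1(\boldsymbol{\sigma}) := (\sigma_2,\ldots,\sigma_n)$, a system of liftings for $\boldsymbol{k}_1(K)$. **Lattices.** "Finite module" means finitely generated. For $n \ge 1$ and a finite $K$-module $M$,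 an $\mathcal{O}_1(K)$-lattice in $M$ is a finite $\mathcal{O}_1(K)$-submodule $L$ with $M = K\cdot L$; $\operatorname{Lat}(M)$ is the set of lattices, and $\operatorname{Lat}(M_1,M_2):=\operatorname{Lat}(M_1)\times\operatorname{Lat}(M_2)$. For lattices $L\subset L'$, $L'/L$ has finite length over $\mathcal{O}_1(K)$, and $\operatorname{rest}_{\sigma_1}(L'/L)$ denotes it as a finite $\boldsymbol{k}_1(K)$-module via $\sigma_1$. For a $\Bbbk$-linear $\phi:M_1\to M_2$ and $(L_1,L_2),(L'_1,L'_2)\in\operatorname{Lat}(M_1,M_2)$, $(L'_1,L'_2)$ is a $\phi$-refinement of $(L_1,L_2)$, written $(L'_1,L'_2)\prec_\phi(L_1,L_2)$, if $L'_1\subset L_1$, $L_2\subset L'_2$, $\phi(L'_1)\subset L_2$ and $\phi(L_1)\subset L'_2$; then there is an induced $\bar\phi:L_1/L'_1\to L'_2/L_2$. **BT operators.** For finite $K$-modules $M_1,M_2$ define $\mathrm{E}^K_{\boldsymbol{\sigma}}(M_1,M_2)\subset\operatorname{Hom}_{\Bbbk}(M_1,M_2)$ recursively. If $n=0$ it is all of $\operatorname{Hom}_{\Bbbk}(M_1,M_2)$. If $n\ge1$, $\phi$ belongs to it iff: (i) every $(L_1,L_2)\in\operatorname{Lat}(M_1,M_2)$ has some $\phi$-refinement; and (ii) for every $\phi$-refinement $(L'_1,L'_2)\prec_\phi(L_1,L_2)$ the induced $\bar\phi$ belongs to $\mathrm{E}^{\boldsymbol{k}_1(K)}_{\mathrm{d}_1(\boldsymbol{\sigma})}(\operatorname{rest}_{\sigma_1}(L_1/L'_1),\operatorname{rest}_{\sigma_1}(L'_2/L_2))$.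 For $n\ge1$, $i\in\{1,\ldots,n\}$, $j\in\{1,2\}$, the subset $\mathrm{E}^K_{\boldsymbol{\sigma}}(M_1,M_2)_{i,j}$ consists of those $\phi\in\mathrm{E}^K_{\boldsymbol{\sigma}}(M_1,M_2)$ such that: for $(i,j)=(1,1)$, $\phi(M_1)\subset L_2$ for some $L_2\in\operatorname{Lat}(M_2)$; for $(i,j)=(1,2)$, $\phi(L_1)=0$ for some $L_1\in\operatorname{Lat}(M_1)$; for $i\ge2$, for every $\phi$-refinement $(L'_1,L'_2)\prec_\phi(L_1,L_2)$ the induced $\bar\phi$ belongs to $\mathrm{E}^{\boldsymbol{k}_1(K)}_{\mathrm{d}_1(\boldsymbol{\sigma})}(\operatorname{rest}_{\sigma_1}(L_1/L'_1),\operatorname{rest}_{\sigma_1}(L'_2/L_2))_{i-1,j}$. **The ring of local Beilinson-Tate operators.** $\mathrm{E}(K):=\mathrm{E}^K_{\boldsymbol{\sigma}}(K,K)$ and $\mathrm{E}(K)_{i,j}:=\mathrm{E}^K_{\boldsymbol{\sigma}}(K,K)_{i,j}$, where $\boldsymbol{\sigma}$ is any system of liftings for $K$ (such systems exist, and these sets do not depend on the choice of $\boldsymbol{\sigma}$). *)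

theory Defs
  imports "HOL-Analysis.Analysis" "HOL-Algebra.Algebra"
begin

section \<open>Rings and modules\<close>

text \<open>Characteristic \<open>0\<close>, or characteristic \<open>p\<close> with surjective Frobenius map.\<close>

definition perfect_field :: "'k ring \<Rightarrow> bool" where
  "perfect_field k \<longleftrightarrow> field k \<and>
     (\<forall>p::nat. Factorial_Ring.prime p \<and> add_pow k p \<one>\<^bsub>k\<^esub> = \<zero>\<^bsub>k\<^esub> \<longrightarrow>
        (\<forall>x\<in>carrier k. \<exists>y\<in>carrier k. x = y [^]\<^bsub>k\<^esub> p))"

definition ring_module :: "'a ring \<Rightarrow> ('a, 'a) module" where
  "ring_module R = \<lparr>carrier = carrier R, monoid.mult = monoid.mult R, one = one R,
     ring.zero = ring.zero R, add = add R, smult = monoid.mult R\<rparr>"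

text \<open>Restriction of scalars along a map \<open>h\<close>.\<close>

definition rest :: "('c \<Rightarrow> 'a) \<Rightarrow> ('a, 'b) module \<Rightarrow> ('c, 'b) module" where
  "rest h M = \<lparr>carrier = carrier M, monoid.mult = monoid.mult M, one = one M,
     ring.zero = ring.zero M, add = add M, smult = (\<lambda>c x. h c \<odot>\<^bsub>M\<^esub> x)\<rparr>"

definition mspan :: "'a ring \<Rightarrow> ('a, 'b) module \<Rightarrow> 'b set \<Rightarrow> 'b set" where
  "mspan R M S = \<Inter>{N. submodule N R M \<and> S \<subseteq> N}"

definition finite_module :: "'a ring \<Rightarrow> ('a, 'b) module \<Rightarrow> bool" where
  "finite_module R M \<longleftrightarrow> module R M \<and>
     (\<exists>S. finite S \<and> S \<subseteq> carrier M \<and> mspan R M S = carrier M)"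

text \<open>
  Linear maps are extensional functions, i.e. they are \<open>undefined\<close> outside the carrier, so that
  equality of maps is equality on the carrier.
\<close>

definition Hom_mod :: "'k ring \<Rightarrow> ('k, 'b) module \<Rightarrow> ('k, 'c) module \<Rightarrow> ('b \<Rightarrow> 'c) set" where
  "Hom_mod k M N = {\<phi> \<in> carrier M \<rightarrow>\<^sub>E carrier N.
     (\<forall>x\<in>carrier M. \<forall>y\<in>carrier M. \<phi> (x \<oplus>\<^bsub>M\<^esub> y) = \<phi> x \<oplus>\<^bsub>N\<^esub> \<phi> y) \<and>
     (\<forall>c\<in>carrier k. \<forall>x\<in>carrier M. \<phi> (c \<odot>\<^bsub>M\<^esub> x) = c \<odot>\<^bsub>N\<^esub> \<phi> x)}"

definition End_ring :: "'k ring \<Rightarrow> ('k, 'b) module \<Rightarrow> ('b \<Rightarrow> 'b) ring" where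
  "End_ring k M = \<lparr>carrier = Hom_mod k M M,
     monoid.mult = (\<lambda>\<phi> \<psi>. compose (carrier M) \<phi> \<psi>),
     one = (\<lambda>x\<in>carrier M. x),
     ring.zero = (\<lambda>x\<in>carrier M. \<zero>\<^bsub>M\<^esub>),
     add = (\<lambda>\<phi> \<psi>. \<lambda>x\<in>carrier M. \<phi> x \<oplus>\<^bsub>M\<^esub> \<psi> x)\<rparr>"

text \<open>
  The constructions below are recursive in the dimension and pass to residue fields and to
  quotients of lattices at every step. To stay within one type, a quotient is carried by a system
  of representatives: every coset is replaced by one chosen element of it. Thus
  \<open>quot_ring R I\<close> is the isomorphic copy of \<open>R Quot I\<close> on the set of these representatives.
\<close>

definition coset_rep :: "'a set \<Rightarrow> 'a" where
  "coset_rep C = (SOME x. x \<in> C)"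

definition quot_ring :: "'a ring \<Rightarrow> 'a set \<Rightarrow> 'a ring" where
  "quot_ring R I = image_ring coset_rep (R Quot I)"

definition quot_ring_proj :: "'a ring \<Rightarrow> 'a set \<Rightarrow> 'a \<Rightarrow> 'a" where
  "quot_ring_proj R I x = coset_rep (I +>\<^bsub>R\<^esub> x)"

definition quot_module_proj :: "('a, 'b) module \<Rightarrow> 'b set \<Rightarrow> 'b \<Rightarrow> 'b" where
  "quot_module_proj M N x = coset_rep (N +>\<^bsub>M\<^esub> x)"

text \<open>The fields \<open>mult\<close> and \<open>one\<close> of a module record carry no information.\<close>

definition quot_module :: "('a, 'b) module \<Rightarrow> 'b set \<Rightarrow> ('a, 'b) module" where
  "quot_module M N = \<lparr>carrier = quot_module_proj M N ` carrier M,
     monoid.mult = monoid.mult M, one = one M, ring.zero = quot_module_proj M N \<zero>\<^bsub>M\<^esub>,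
     add = (\<lambda>x y. quot_module_proj M N (x \<oplus>\<^bsub>M\<^esub> y)),
     smult = (\<lambda>a x. quot_module_proj M N (a \<odot>\<^bsub>M\<^esub> x))\<rparr>"


section \<open>Cubically decomposed rings of operators\<close>

text \<open>
  The commutative \<open>k\<close>-ring is \<open>A\<close> with structure map \<open>\<iota>\<close>. Since \<open>E\<close> is a subring of
  \<open>End\<^sub>k(A)\<close> containing \<open>A\<close>, it contains the scalars from \<open>k\<close>, i.e. it is a \<open>k\<close>-subring.
  For \<open>n = 0\<close> the intersection in the last condition is \<open>E\<close>, as an empty intersection of
  subsets of \<open>E\<close>.
\<close>

definition finite_potent :: "'k ring \<Rightarrow> ('k, 'b) module \<Rightarrow> ('b \<Rightarrow> 'b) \<Rightarrow> bool" where
  "finite_potent k M \<phi> \<longleftrightarrow> (\<exists>q::nat. q > 0 \<and>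
     finite_module k (M\<lparr>carrier := (\<phi> [^]\<^bsub>End_ring k M\<^esub> q) ` carrier M\<rparr>))"

locale cubically_decomposed_ring =
  fixes k :: "'k ring" and A :: "'a ring" and \<iota> :: "'k \<Rightarrow> 'a" and n :: nat
    and E :: "('a \<Rightarrow> 'a) set" and I :: "nat \<Rightarrow> nat \<Rightarrow> ('a \<Rightarrow> 'a) set"
  assumes cring_A: "cring A"
    and structure_map: "\<iota> \<in> ring_hom k A"
    and subring_E: "subring E (End_ring k (rest \<iota> (ring_module A)))"
    and contains_A: "\<And>a. a \<in> carrier A \<Longrightarrow> (\<lambda>x\<in>carrier A. a \<otimes>\<^bsub>A\<^esub> x) \<in> E"
    and ideal_I: "\<And>i j. i \<in> {1..n} \<Longrightarrow> j \<in> {1, 2} \<Longrightarrow>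
          ideal (I i j) ((End_ring k (rest \<iota> (ring_module A)))\<lparr>carrier := E\<rparr>)"
    and decomposition: "\<And>i. i \<in> {1..n} \<Longrightarrow>
          E = I i 1 <+>\<^bsub>End_ring k (rest \<iota> (ring_module A))\<^esub> I i 2"
    and finite_potent_inter: "\<And>\<phi>. \<phi> \<in> E \<inter> (\<Inter>i\<in>{1..n}. \<Inter>j\<in>{1, 2}. I i j) \<Longrightarrow>
          finite_potent k (rest \<iota> (ring_module A)) \<phi>"


section \<open>Semi-topological rings and modules\<close>

text \<open>The field \<open>k\<close> is discrete.\<close>

definition linear_topology :: "'k ring \<Rightarrow> ('k, 'b) module \<Rightarrow> 'b topology \<Rightarrow> bool" where
  "linear_topology k M T \<longleftrightarrow> module k M \<and> topspace T = carrier M \<and>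
     continuous_map (prod_topology T T) T (\<lambda>(x, y). x \<oplus>\<^bsub>M\<^esub> y) \<and>
     continuous_map T T (\<lambda>x. \<ominus>\<^bsub>M\<^esub> x) \<and>
     continuous_map (prod_topology (discrete_topology (carrier k)) T) T (\<lambda>(c, x). c \<odot>\<^bsub>M\<^esub> x) \<and>
     (\<forall>U. openin T U \<and> \<zero>\<^bsub>M\<^esub> \<in> U \<longrightarrow> (\<exists>N. submodule N k M \<and> openin T N \<and> N \<subseteq> U))"

text \<open>In the sequel a commutative \<open>k\<close>-ring \<open>A\<close> is given by a structure map \<open>\<iota>\<close>.\<close>

definition st_ring :: "'k ring \<Rightarrow> ('k \<Rightarrow> 'a) \<Rightarrow> 'a ring \<Rightarrow> 'a topology \<Rightarrow> bool" where
  "st_ring k \<iota> A T \<longleftrightarrow> cring A \<and> \<iota> \<in> ring_hom k A \<and>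
     linear_topology k (rest \<iota> (ring_module A)) T \<and>
     (\<forall>a\<in>carrier A. continuous_map T T (\<lambda>b. a \<otimes>\<^bsub>A\<^esub> b))"

definition st_module ::
    "'k ring \<Rightarrow> ('k \<Rightarrow> 'a) \<Rightarrow> 'a ring \<Rightarrow> 'a topology \<Rightarrow> ('a, 'b) module \<Rightarrow> 'b topology \<Rightarrow> bool" where
  "st_module k \<iota> A TA M T \<longleftrightarrow> module A M \<and> linear_topology k (rest \<iota> M) T \<and>
     (\<forall>a\<in>carrier A. continuous_map T T (\<lambda>m. a \<odot>\<^bsub>M\<^esub> m)) \<and>
     (\<forall>m\<in>carrier M. continuous_map TA T (\<lambda>a. a \<odot>\<^bsub>M\<^esub> m))"

definition fine_topology ::
    "'k ring \<Rightarrow> ('k \<Rightarrow> 'a) \<Rightarrow> 'a ring \<Rightarrow> 'a topology \<Rightarrow> ('a, 'b) module \<Rightarrow> 'b topology" where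
  "fine_topology k \<iota> A TA M = (THE T. st_module k \<iota> A TA M T \<and>
     (\<forall>T'. st_module k \<iota> A TA M T' \<longrightarrow> (\<forall>U. openin T' U \<longrightarrow> openin T U)))"


section \<open>Laurent series\<close>

text \<open>A series is its coefficient function \<open>int \<Rightarrow> 'a\<close>.\<close>

definition laurent_ring :: "'a ring \<Rightarrow> (int \<Rightarrow> 'a) ring" where
  "laurent_ring A = \<lparr>
     carrier = {f. (\<forall>i. f i \<in> carrier A) \<and> (\<exists>N. \<forall>i<N. f i = \<zero>\<^bsub>A\<^esub>)},
     monoid.mult = (\<lambda>f g m. \<Oplus>\<^bsub>A\<^esub>i\<in>{i. f i \<noteq> \<zero>\<^bsub>A\<^esub> \<and> g (m - i) \<noteq> \<zero>\<^bsub>A\<^esub>}. f i \<otimes>\<^bsub>A\<^esub> g (m - i)),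
     one = (\<lambda>i. if i = 0 then \<one>\<^bsub>A\<^esub> else \<zero>\<^bsub>A\<^esub>),
     ring.zero = (\<lambda>i. \<zero>\<^bsub>A\<^esub>),
     add = (\<lambda>f g i. f i \<oplus>\<^bsub>A\<^esub> g i)\<rparr>"

definition laurent_const :: "'a ring \<Rightarrow> 'a \<Rightarrow> int \<Rightarrow> 'a" where
  "laurent_const A a = (\<lambda>i. if i = 0 then a else \<zero>\<^bsub>A\<^esub>)"

definition power_series_ring :: "'a ring \<Rightarrow> (int \<Rightarrow> 'a) ring" where
  "power_series_ring A =
     (laurent_ring A)\<lparr>carrier := {f \<in> carrier (laurent_ring A). \<forall>i<0. f i = \<zero>\<^bsub>A\<^esub>}\<rparr>"

definition series_trunc :: "'a ring \<Rightarrow> nat \<Rightarrow> (int \<Rightarrow> 'a) \<Rightarrow> int \<Rightarrow> 'a" where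
  "series_trunc A d f = (\<lambda>i. if i \<le> int d then f i else \<zero>\<^bsub>A\<^esub>)"

text \<open>\<open>A[t]/(t\<^sup>d\<^sup>+\<^sup>1)\<close> as an \<open>A\<close>-module, on polynomials of degree at most \<open>d\<close>.\<close>

definition trunc_module :: "'a ring \<Rightarrow> nat \<Rightarrow> ('a, int \<Rightarrow> 'a) module" where
  "trunc_module A d = \<lparr>carrier = series_trunc A d ` carrier (power_series_ring A),
     monoid.mult = (\<lambda>f g. series_trunc A d (f \<otimes>\<^bsub>laurent_ring A\<^esub> g)),
     one = \<one>\<^bsub>laurent_ring A\<^esub>,
     ring.zero = \<zero>\<^bsub>laurent_ring A\<^esub>,
     add = add (laurent_ring A),
     smult = (\<lambda>a f i. a \<otimes>\<^bsub>A\<^esub> f i)\<rparr>"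

text \<open>
  The inverse limit topology: the one induced from the product of the \<open>A[t]/(t\<^sup>d\<^sup>+\<^sup>1)\<close>.
\<close>

definition power_series_topology ::
    "'k ring \<Rightarrow> ('k \<Rightarrow> 'a) \<Rightarrow> 'a ring \<Rightarrow> 'a topology \<Rightarrow> (int \<Rightarrow> 'a) topology" where
  "power_series_topology k \<iota> A TA =
     pullback_topology (carrier (power_series_ring A)) (\<lambda>f d. series_trunc A d f)
       (product_topology (\<lambda>d. fine_topology k \<iota> A TA (trunc_module A d)) UNIV)"

definition laurent_topology ::
    "'k ring \<Rightarrow> ('k \<Rightarrow> 'a) \<Rightarrow> 'a ring \<Rightarrow> 'a topology \<Rightarrow> (int \<Rightarrow> 'a) topology" where
  "laurent_topology k \<iota> A TA =
     fine_topology k (laurent_const A \<circ> \<iota>) (power_series_ring A) (power_series_topology k \<iota> A TA)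
       (ring_module (laurent_ring A))"

text \<open>
  Iterated Laurent series \<open>F((t\<^sub>1,\<dots>,t\<^sub>n))\<close>. The type \<open>int \<Rightarrow> \<dots> \<Rightarrow> int \<Rightarrow> 'a\<close> would depend on \<open>n\<close>, so
  a series is encoded as a function of the list \<open>[i\<^sub>1,\<dots>,i\<^sub>n]\<close> of exponents of \<open>t\<^sub>1,\<dots>,t\<^sub>n\<close>;
  \<open>emb_nil\<close> and \<open>uncurry_series\<close> are the (injective) encoding maps, along which ring structure
  and topology are transported. The outermost variable is \<open>t\<^sub>1\<close>.
\<close>

definition emb_nil :: "'a \<Rightarrow> int list \<Rightarrow> 'a" where
  "emb_nil c = (\<lambda>l. if l = [] then c else undefined)"

definition uncurry_series :: "(int \<Rightarrow> int list \<Rightarrow> 'a) \<Rightarrow> int list \<Rightarrow> 'a" where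
  "uncurry_series f = (\<lambda>l. case l of [] \<Rightarrow> undefined | i # l' \<Rightarrow> f i l')"

definition transport_topology :: "('a \<Rightarrow> 'b) \<Rightarrow> 'a topology \<Rightarrow> 'b topology" where
  "transport_topology h T = pullback_topology (h ` topspace T) (inv_into (topspace T) h) T"

primrec iter_laurent_ring :: "'a ring \<Rightarrow> nat \<Rightarrow> (int list \<Rightarrow> 'a) ring" where
  "iter_laurent_ring F 0 = image_ring emb_nil F"
| "iter_laurent_ring F (Suc n) = image_ring uncurry_series (laurent_ring (iter_laurent_ring F n))"

definition iter_laurent_const :: "'a ring \<Rightarrow> nat \<Rightarrow> (int list \<Rightarrow> 'a) \<Rightarrow> int list \<Rightarrow> 'a" where
  "iter_laurent_const F n a = uncurry_series (laurent_const (iter_laurent_ring F n) a)"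

primrec iter_laurent_structure :: "'a ring \<Rightarrow> ('k \<Rightarrow> 'a) \<Rightarrow> nat \<Rightarrow> 'k \<Rightarrow> int list \<Rightarrow> 'a" where
  "iter_laurent_structure F \<iota> 0 = emb_nil \<circ> \<iota>"
| "iter_laurent_structure F \<iota> (Suc n) = iter_laurent_const F n \<circ> iter_laurent_structure F \<iota> n"

primrec iter_laurent_topology ::
    "'k ring \<Rightarrow> 'a ring \<Rightarrow> ('k \<Rightarrow> 'a) \<Rightarrow> nat \<Rightarrow> (int list \<Rightarrow> 'a) topology" where
  "iter_laurent_topology k F \<iota> 0 = discrete_topology (carrier (iter_laurent_ring F 0))"
| "iter_laurent_topology k F \<iota> (Suc n) = transport_topology uncurry_series
     (laurent_topology k (iter_laurent_structure F \<iota> n) (iter_laurent_ring F n)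
       (iter_laurent_topology k F \<iota> n))"


section \<open>Local fields\<close>

definition maximal_ideal_of :: "'a ring \<Rightarrow> 'a set" where
  "maximal_ideal_of R = (THE m. maximalideal m R)"

definition discrete_valuation_ring :: "'a ring \<Rightarrow> bool" where
  "discrete_valuation_ring R \<longleftrightarrow> principal_domain R \<and> \<not> field R \<and> (\<exists>!m. maximalideal m R)"

text \<open>Completeness: the map from \<open>R\<close> to the inverse limit of the \<open>R/m\<^sup>i\<close> is bijective.\<close>

definition complete_dvr :: "'a ring \<Rightarrow> bool" where
  "complete_dvr R \<longleftrightarrow> discrete_valuation_ring R \<and>
     (\<forall>x::nat \<Rightarrow> 'a.
        (\<forall>i. x i \<in> carrier R \<and>
             x (Suc i) \<ominus>\<^bsub>R\<^esub> x i \<in> maximal_ideal_of R [^]\<^bsub>ideals_set R\<^esub> i) \<longrightarrow>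
        (\<exists>!y. y \<in> carrier R \<and> (\<forall>i. y \<ominus>\<^bsub>R\<^esub> x i \<in> maximal_ideal_of R [^]\<^bsub>ideals_set R\<^esub> i)))"

definition is_fraction_field_of :: "'a ring \<Rightarrow> 'a set \<Rightarrow> bool" where
  "is_fraction_field_of K S \<longleftrightarrow> field K \<and> subring S K \<and>
     (\<forall>x\<in>carrier K. \<exists>a\<in>S. \<exists>b\<in>S - {\<zero>\<^bsub>K\<^esub>}. x = a \<otimes>\<^bsub>K\<^esub> inv\<^bsub>K\<^esub> b)"

abbreviation sub_ring :: "'a ring \<Rightarrow> 'a set \<Rightarrow> 'a ring" where
  "sub_ring K S \<equiv> K\<lparr>carrier := S\<rparr>"

definition residue_field :: "'a ring \<Rightarrow> 'a set \<Rightarrow> 'a ring" where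
  "residue_field K S = quot_ring (sub_ring K S) (maximal_ideal_of (sub_ring K S))"

definition residue_map :: "'a ring \<Rightarrow> 'a set \<Rightarrow> 'a \<Rightarrow> 'a" where
  "residue_map K S = quot_ring_proj (sub_ring K S) (maximal_ideal_of (sub_ring K S))"

text \<open>
  An \<open>n\<close>-dimensional local field is given by \<open>K\<close> and the list \<open>[O\<^sub>1,\<dots>,O\<^sub>n]\<close> of its valuation
  rings, where \<open>O\<^sub>i\<close> is a subring of the \<open>(i-1)\<close>-st residue field. Its first residue field is an
  \<open>(n-1)\<close>-dimensional local field with valuation rings \<open>[O\<^sub>2,\<dots>,O\<^sub>n]\<close>.
\<close>

primrec local_field :: "'a set list \<Rightarrow> 'a ring \<Rightarrow> bool" where
  "local_field [] K \<longleftrightarrow> field K"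
| "local_field (S # Os) K \<longleftrightarrow> is_fraction_field_of K S \<and> complete_dvr (sub_ring K S) \<and>
     local_field Os (residue_field K S)"

text \<open>The ring of integers \<open>O(K)\<close>, the last residue field and the map between them.\<close>

primrec ring_of_integers :: "'a set list \<Rightarrow> 'a ring \<Rightarrow> 'a set" where
  "ring_of_integers [] K = carrier K"
| "ring_of_integers (S # Os) K =
     {x \<in> S. residue_map K S x \<in> ring_of_integers Os (residue_field K S)}"

primrec last_residue_field :: "'a set list \<Rightarrow> 'a ring \<Rightarrow> 'a ring" where
  "last_residue_field [] K = K"
| "last_residue_field (S # Os) K = last_residue_field Os (residue_field K S)"

primrec last_residue_map :: "'a set list \<Rightarrow> 'a ring \<Rightarrow> 'a \<Rightarrow> 'a" where
  "last_residue_map [] K x = x"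
| "last_residue_map (S # Os) K x = last_residue_map Os (residue_field K S) (residue_map K S x)"

text \<open>
  \<open>f\<close> is a map from \<open>F((t\<^sub>1,\<dots>,t\<^sub>n))\<close>, \<open>n = length Os\<close>, to \<open>K\<close>. It must map the first valuation
  ring \<open>A[[t\<^sub>1]]\<close>, \<open>A = F((t\<^sub>2,\<dots>,t\<^sub>n))\<close>, onto \<open>O\<^sub>1(K)\<close>. The residue field of \<open>A[[t\<^sub>1]]\<close> is \<open>A\<close>, split
  by the constants, so the map induced on residue fields sends \<open>a\<close> to the residue class of the image
  of the constant series \<open>a\<close>.
\<close>

primrec respects_valuation_rings ::
    "'a ring \<Rightarrow> 'a set list \<Rightarrow> ((int list \<Rightarrow> 'a) \<Rightarrow> 'a) \<Rightarrow> 'a ring \<Rightarrow> bool" where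
  "respects_valuation_rings F [] f K \<longleftrightarrow> True"
| "respects_valuation_rings F (S # Os) f K \<longleftrightarrow>
     f ` uncurry_series ` carrier (power_series_ring (iter_laurent_ring F (length Os))) = S \<and>
     respects_valuation_rings F Os
       (\<lambda>a. residue_map K S (f (iter_laurent_const F (length Os) a))) (residue_field K S)"

definition topological_local_field ::
    "nat \<Rightarrow> 'k ring \<Rightarrow> 'a ring \<Rightarrow> ('k \<Rightarrow> 'a) \<Rightarrow> 'a set list \<Rightarrow> 'a topology \<Rightarrow> bool" where
  "topological_local_field n k K \<iota> Os T \<longleftrightarrow>
     length Os = n \<and> local_field Os K \<and>
     \<iota> \<in> ring_hom k (sub_ring K (ring_of_integers Os K)) \<and>
     finite_module k
       (rest (last_residue_map Os K \<circ> \<iota>) (ring_module (last_residue_field Os K))) \<and>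
     st_ring k \<iota> K T \<and>
     (let F = last_residue_field Os K; \<iota>F = last_residue_map Os K \<circ> \<iota> in
      \<exists>f. f \<in> ring_iso (iter_laurent_ring F n) K \<and>
          (\<forall>c\<in>carrier k. f (iter_laurent_structure F \<iota>F n c) = \<iota> c) \<and>
          homeomorphic_map (iter_laurent_topology k F \<iota>F n) T f \<and>
          respects_valuation_rings F Os f K)"


section \<open>Systems of liftings\<close>

definition quotient_topology :: "'a topology \<Rightarrow> ('a \<Rightarrow> 'b) \<Rightarrow> 'b topology" where
  "quotient_topology T p =
     topology (\<lambda>U. U \<subseteq> p ` topspace T \<and> openin T {x \<in> topspace T. p x \<in> U})"

lemma openin_quotient_topology:
  "openin (quotient_topology T p) U \<longleftrightarrow>
     U \<subseteq> p ` topspace T \<and> openin T {x \<in> topspace T. p x \<in> U}"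
proof -
  have "istopology (\<lambda>U. U \<subseteq> p ` topspace T \<and> openin T {x \<in> topspace T. p x \<in> U})"
    unfolding istopology_def
  proof (intro conjI allI impI)
    fix U V
    assume "U \<subseteq> p ` topspace T \<and> openin T {x \<in> topspace T. p x \<in> U}"
      and "V \<subseteq> p ` topspace T \<and> openin T {x \<in> topspace T. p x \<in> V}"
    moreover have "{x \<in> topspace T. p x \<in> U \<inter> V} =
        {x \<in> topspace T. p x \<in> U} \<inter> {x \<in> topspace T. p x \<in> V}" by auto
    ultimately show "U \<inter> V \<subseteq> p ` topspace T" and "openin T {x \<in> topspace T. p x \<in> U \<inter> V}"
      by (auto simp del: Int_iff)
  next
    fix \<U>
    assume U: "\<forall>U\<in>\<U>. U \<subseteq> p ` topspace T \<and> openin T {x \<in> topspace T. p x \<in> U}"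
    then show "\<Union>\<U> \<subseteq> p ` topspace T" by blast
    have "{x \<in> topspace T. p x \<in> \<Union>\<U>} = (\<Union>U\<in>\<U>. {x \<in> topspace T. p x \<in> U})" by auto
    with U show "openin T {x \<in> topspace T. p x \<in> \<Union>\<U>}" by auto
  qed
  then show ?thesis by (simp add: quotient_topology_def)
qed

definition residue_topology :: "'a ring \<Rightarrow> 'a set \<Rightarrow> 'a topology \<Rightarrow> 'a topology" where
  "residue_topology K S T = quotient_topology (subtopology T S) (residue_map K S)"

fun system_of_liftings ::
    "'k ring \<Rightarrow> 'a ring \<Rightarrow> ('k \<Rightarrow> 'a) \<Rightarrow> 'a topology \<Rightarrow> 'a set list \<Rightarrow> ('a \<Rightarrow> 'a) list \<Rightarrow> bool" where
  "system_of_liftings k K \<iota> T [] [] \<longleftrightarrow> True"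
| "system_of_liftings k K \<iota> T (S # Os) (\<sigma> # \<sigma>s) \<longleftrightarrow>
     \<sigma> \<in> ring_hom (residue_field K S) (sub_ring K S) \<and>
     (\<forall>c\<in>carrier k. \<sigma> (residue_map K S (\<iota> c)) = \<iota> c) \<and>
     continuous_map (residue_topology K S T) (subtopology T S) \<sigma> \<and>
     (\<forall>x\<in>carrier (residue_field K S). residue_map K S (\<sigma> x) = x) \<and>
     system_of_liftings k (residue_field K S) (residue_map K S \<circ> \<iota>) (residue_topology K S T) Os \<sigma>s"
| "system_of_liftings k K \<iota> T _ _ \<longleftrightarrow> False"


section \<open>Local Beilinson-Tate operators\<close>

definition Lat :: "'a ring \<Rightarrow> 'a set \<Rightarrow> ('a, 'b) module \<Rightarrow> 'b set set" where
  "Lat K S M = {L. submodule L (sub_ring K S) M \<and>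
     finite_module (sub_ring K S) (M\<lparr>carrier := L\<rparr>) \<and> mspan K M L = carrier M}"

definition refinement ::
    "('b \<Rightarrow> 'c) \<Rightarrow> 'b set \<times> 'c set \<Rightarrow> 'b set \<times> 'c set \<Rightarrow> bool" where
  "refinement \<phi> = (\<lambda>(L1', L2') (L1, L2). L1' \<subseteq> L1 \<and> L2 \<subseteq> L2' \<and> \<phi> ` L1' \<subseteq> L2 \<and> \<phi> ` L1 \<subseteq> L2')"

text \<open>\<open>rest\<^sub>\<sigma>(L/L')\<close>, a module over the residue field, for lattices \<open>L' \<subseteq> L\<close> in \<open>M\<close>.\<close>

definition lattice_quot ::
    "('a \<Rightarrow> 'a) \<Rightarrow> ('a, 'b) module \<Rightarrow> 'b set \<Rightarrow> 'b set \<Rightarrow> ('a, 'b) module" where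
  "lattice_quot \<sigma> M L L' = rest \<sigma> (quot_module (M\<lparr>carrier := L\<rparr>) L')"

text \<open>
  The induced map \<open>L1/L1' \<rightarrow> L2'/L2\<close>. Elements of \<open>L1/L1'\<close> are representatives in \<open>L1\<close>, to which
  \<open>\<phi>\<close> is applied directly.
\<close>

definition induced_map ::
    "('a, 'b) module \<Rightarrow> ('a, 'c) module \<Rightarrow> ('b \<Rightarrow> 'c) \<Rightarrow> 'b set \<times> 'c set \<Rightarrow> 'b set \<times> 'c set \<Rightarrow> 'b \<Rightarrow> 'c"
  where
  "induced_map M1 M2 \<phi> = (\<lambda>(L1', L2') (L1, L2).
     \<lambda>x\<in>carrier (quot_module (M1\<lparr>carrier := L1\<rparr>) L1').
       quot_module_proj (M2\<lparr>carrier := L2'\<rparr>) L2 (\<phi> x))"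

text \<open>
  \<open>BT k K \<iota> Os \<sigma>s M1 M2\<close> is the set of local Beilinson-Tate operators from \<open>M1\<close> to \<open>M2\<close>.
  Lists \<open>Os\<close> and \<open>\<sigma>s\<close> of different lengths are meaningless.
\<close>

fun BT :: "'k ring \<Rightarrow> 'a ring \<Rightarrow> ('k \<Rightarrow> 'a) \<Rightarrow> 'a set list \<Rightarrow> ('a \<Rightarrow> 'a) list \<Rightarrow>
    ('a, 'b) module \<Rightarrow> ('a, 'c) module \<Rightarrow> ('b \<Rightarrow> 'c) set" where
  "BT k K \<iota> [] [] M1 M2 = Hom_mod k (rest \<iota> M1) (rest \<iota> M2)"
| "BT k K \<iota> (S # Os) (\<sigma> # \<sigma>s) M1 M2 = {\<phi> \<in> Hom_mod k (rest \<iota> M1) (rest \<iota> M2).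
     (\<forall>L1\<in>Lat K S M1. \<forall>L2\<in>Lat K S M2. \<exists>L1'\<in>Lat K S M1. \<exists>L2'\<in>Lat K S M2.
        refinement \<phi> (L1', L2') (L1, L2)) \<and>
     (\<forall>L1\<in>Lat K S M1. \<forall>L2\<in>Lat K S M2. \<forall>L1'\<in>Lat K S M1. \<forall>L2'\<in>Lat K S M2.
        refinement \<phi> (L1', L2') (L1, L2) \<longrightarrow>
        induced_map M1 M2 \<phi> (L1', L2') (L1, L2) \<in>
          BT k (residue_field K S) (residue_map K S \<circ> \<iota>) Os \<sigma>s
            (lattice_quot \<sigma> M1 L1 L1') (lattice_quot \<sigma> M2 L2' L2))}"
| "BT k K \<iota> _ _ M1 M2 = {}"

text \<open>Only the indices \<open>i \<in> {1..n}\<close>, \<open>n = length Os = length \<sigma>s\<close>, and \<open>j \<in> {1, 2}\<close> are meaningful.\<close>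

fun BT_ideal :: "'k ring \<Rightarrow> 'a ring \<Rightarrow> ('k \<Rightarrow> 'a) \<Rightarrow> 'a set list \<Rightarrow> ('a \<Rightarrow> 'a) list \<Rightarrow>
    ('a, 'b) module \<Rightarrow> ('a, 'c) module \<Rightarrow> nat \<Rightarrow> nat \<Rightarrow> ('b \<Rightarrow> 'c) set" where
  "BT_ideal k K \<iota> (S # Os) (\<sigma> # \<sigma>s) M1 M2 i j = {\<phi> \<in> BT k K \<iota> (S # Os) (\<sigma> # \<sigma>s) M1 M2.
     if i = 1 \<and> j = 1 then \<exists>L2\<in>Lat K S M2. \<phi> ` carrier M1 \<subseteq> L2
     else if i = 1 \<and> j = 2 then \<exists>L1\<in>Lat K S M1. \<forall>x\<in>L1. \<phi> x = \<zero>\<^bsub>M2\<^esub>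
     else \<forall>L1\<in>Lat K S M1. \<forall>L2\<in>Lat K S M2. \<forall>L1'\<in>Lat K S M1. \<forall>L2'\<in>Lat K S M2.
        refinement \<phi> (L1', L2') (L1, L2) \<longrightarrow>
        induced_map M1 M2 \<phi> (L1', L2') (L1, L2) \<in>
          BT_ideal k (residue_field K S) (residue_map K S \<circ> \<iota>) Os \<sigma>s
            (lattice_quot \<sigma> M1 L1 L1') (lattice_quot \<sigma> M2 L2' L2) (i - 1) j}"
| "BT_ideal k K \<iota> _ _ M1 M2 i j = {}"

end

theory Submission
  imports Defs
begin

text \<open>
  Everything is proved for one fixed system of liftings by induction on the dimension, and no
  topology is needed: continuity of the liftings only matters for the independence of the choice.
  The induction hypothesis is categorical. The BT operators between finite modules contain the
  linear maps and are closed under sums and composition, and each \<open>E\<^sub>i\<^sub>,\<^sub>j\<close> is a two-sided ideal of this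
  category. An operator on \<open>K\<close>-modules is tested on its refinements, but sums and composites only
  behave well on sufficiently fine refinements. The passage back to coarser ones is possible because
  over the residue field surjections have linear sections and injections have linear retractions,
  and linear maps are BT operators.

  The identity of \<open>K\<close> splits for \<open>i = 1\<close> by a linear projection onto \<open>O\<^sub>1\<close>. For \<open>i > 1\<close> a splitting
  \<open>1 = e\<^sub>1 + e\<^sub>2\<close> on the residue field is applied to the digits \<open>a\<^sub>m\<close> of
  \<open>\<Sum> \<sigma>(a\<^sub>m) \<pi>\<^sup>m\<close>. If \<open>\<phi>\<close> lies in all the ideals, its image is contained in a lattice \<open>L\<^sub>2\<close> and it kills a
  lattice \<open>L\<^sub>1 \<subseteq> L\<^sub>2\<close>, so a power of \<open>\<phi>\<close> has finite rank as soon as a power of the induced map of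
  \<open>L\<^sub>2/L\<^sub>1\<close> does.
\<close>

section \<open>Modules and linear maps\<close>

text \<open>Membership is tested on every refinement, but a refinement of a composite says nothing
  about lattices in the middle module. This forces the detour through finer refinements, and it
  makes the induction carry all finite modules and all linear maps although the theorem is about
  \<open>K\<close> alone. For the decomposition of the ring the identity of \<open>K\<close>
  suffices, since \<phi> = e1 \<phi> + e2 \<phi> and the ideals absorb composition.

  For i > 1 the operators that split the identity are in general not linear over the valuation ring,
  because \<open>e1\<close> and \<open>e2\<close> are only \<open>k\<close>-linear on the residue
  field. Finiteness helps: on \<open>\<pi>^-n O / \<pi>^n O\<close> only 2 n digits survive, so the
  induced map is a finite sum of composites j e d, where d reads one digit and j puts it back. Both
  d and j are linear over the residue field, so the ideal property in the induction hypothesis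
  applies to each summand. Completeness is what turns the digit series into an operator on
  \<open>K\<close>.

  The recursion ends at a field that is finite over \<open>k\<close>, where every operator has
  finite rank.\<close>

lemma (in abelian_group) minus_eq_zero_iff:
  assumes "x \<in> carrier G" "y \<in> carrier G"
  shows "x \<ominus> y = \<zero> \<longleftrightarrow> x = y"
proof
  assume "x \<ominus> y = \<zero>"
  then have "x \<ominus> y \<oplus> y = y" using assms by simp
  then show "x = y" using assms by (simp add: minus_eq a_assoc l_neg)
qed (use assms in \<open>simp add: minus_eq r_neg\<close>)

lemma (in abelian_group) minus_swap:
  assumes "a \<in> carrier G" "b \<in> carrier G" "c \<in> carrier G" "d \<in> carrier G" "c \<ominus> d = a \<ominus> b"
  shows "a \<ominus> c = b \<ominus> d"
proof -
  have "a = (a \<ominus> b) \<oplus> b" using assms by (simp add: minus_eq a_assoc l_neg)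
  also have "\<dots> = (c \<ominus> d) \<oplus> b" by (simp only: assms(5))
  also have "\<dots> = (b \<ominus> d) \<oplus> c" using assms(1-4) by (simp add: minus_eq a_ac)
  finally have "a \<ominus> c = (b \<ominus> d) \<oplus> c \<ominus> c" by simp
  then show ?thesis using assms(1-4) by (simp add: minus_eq a_assoc r_neg)
qed

lemma (in abelian_group) minus_minus_cancel:
  assumes "a \<in> carrier G" "b \<in> carrier G" "c \<in> carrier G"
  shows "(a \<ominus> b) \<ominus> (a \<ominus> c) = c \<ominus> b"
proof -
  have "(a \<ominus> b) \<ominus> (a \<ominus> c) = (a \<oplus> \<ominus> a) \<oplus> (c \<ominus> b)"
    using assms by (simp add: minus_eq minus_add a_ac)
  then show ?thesis using assms by (simp add: r_neg)
qed

section \<open>Submodules and generation\<close>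

context module
begin

lemma submodule_iff:
  "submodule W R M \<longleftrightarrow> W \<subseteq> carrier M \<and> \<zero>\<^bsub>M\<^esub> \<in> W \<and> (\<forall>x\<in>W. \<forall>y\<in>W. x \<oplus>\<^bsub>M\<^esub> y \<in> W) \<and>
     (\<forall>a\<in>carrier R. \<forall>x\<in>W. a \<odot>\<^bsub>M\<^esub> x \<in> W)" (is "_ \<longleftrightarrow> ?r")
proof
  assume W: "submodule W R M"
  then have "\<zero>\<^bsub>M\<^esub> \<in> W"
    using subgroup.one_closed[OF submodule.axioms(1)[OF W]] by simp
  then show ?r using submoduleE[OF W] by blast
next
  assume W: ?r
  show "submodule W R M"
  proof (rule submoduleI)
    fix x assume x: "x \<in> W"
    then have "(\<ominus>\<^bsub>R\<^esub> \<one>\<^bsub>R\<^esub>) \<odot>\<^bsub>M\<^esub> x = \<ominus>\<^bsub>M\<^esub> x" using W by (auto simp: smult_l_minus)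
    then show "\<ominus>\<^bsub>M\<^esub> x \<in> W" using W x by (metis R.a_inv_closed R.one_closed)
  qed (use W in auto)
qed

lemma submoduleI':
  assumes "W \<subseteq> carrier M" "\<zero>\<^bsub>M\<^esub> \<in> W" "\<And>x y. x \<in> W \<Longrightarrow> y \<in> W \<Longrightarrow> x \<oplus>\<^bsub>M\<^esub> y \<in> W"
    "\<And>a x. a \<in> carrier R \<Longrightarrow> x \<in> W \<Longrightarrow> a \<odot>\<^bsub>M\<^esub> x \<in> W"
  shows "submodule W R M"
  using assms by (simp add: submodule_iff)

lemma submoduleD:
  assumes "submodule W R M"
  shows "W \<subseteq> carrier M" "\<zero>\<^bsub>M\<^esub> \<in> W" "\<And>x y. x \<in> W \<Longrightarrow> y \<in> W \<Longrightarrow> x \<oplus>\<^bsub>M\<^esub> y \<in> W"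
    "\<And>a x. a \<in> carrier R \<Longrightarrow> x \<in> W \<Longrightarrow> a \<odot>\<^bsub>M\<^esub> x \<in> W"
    "\<And>x. x \<in> W \<Longrightarrow> \<ominus>\<^bsub>M\<^esub> x \<in> W"
    "\<And>x y. x \<in> W \<Longrightarrow> y \<in> W \<Longrightarrow> x \<ominus>\<^bsub>M\<^esub> y \<in> W"
  using assms submoduleE[OF assms] by (auto simp: submodule_iff minus_eq)

end

text \<open>The induction principle behind \<open>mspan\<close>: a property that cuts out a
  submodule and holds on \<open>T\<close> holds everywhere. In this form spans never have to be
  described by linear combinations.\<close>

definition generates :: "'a ring \<Rightarrow> ('a, 'b) module \<Rightarrow> 'b set \<Rightarrow> bool" where
  "generates R M T \<longleftrightarrow> T \<subseteq> carrier M \<and> (\<forall>W. submodule W R M \<longrightarrow> T \<subseteq> W \<longrightarrow> carrier M \<subseteq> W)"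

lemma mspan_eq_carrier_iff:
  assumes "module R M" "T \<subseteq> carrier M"
  shows "mspan R M T = carrier M \<longleftrightarrow> generates R M T"
  using assms module.carrier_is_submodule[OF assms(1)]
  unfolding mspan_def generates_def by blast

lemma finite_module_iff:
  "finite_module R M \<longleftrightarrow> module R M \<and> (\<exists>T. finite T \<and> generates R M T)"
  using mspan_eq_carrier_iff unfolding finite_module_def generates_def by metis

lemma finite_module_is_module: "finite_module R M \<Longrightarrow> module R M"
  by (simp add: finite_module_def)

section \<open>Restriction of scalars and changes of the module record\<close>

lemma rest_simps [simp]:
  "carrier (rest h M) = carrier M" "add (rest h M) = add M" "ring.zero (rest h M) = ring.zero M"
  "smult (rest h M) c x = h c \<odot>\<^bsub>M\<^esub> x"
  by (simp_all add: rest_def)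

lemma ring_module_simps [simp]:
  "carrier (ring_module R) = carrier R" "add (ring_module R) = add R"
  "ring.zero (ring_module R) = ring.zero R" "smult (ring_module R) = monoid.mult R"
  by (simp_all add: ring_module_def)

text \<open>The axioms of an abelian group involve three fields of the record only, so they survive
  when \<open>rest\<close> or \<open>ring_module\<close> rebuilds the other fields.\<close>

lemma abelian_group_cong:
  assumes "abelian_group G" "carrier H = carrier G" "add H = add G" "ring.zero H = ring.zero G"
  shows "abelian_group H"
proof -
  interpret G: abelian_group G by fact
  show ?thesis
    by (rule abelian_groupI) (auto simp: assms G.a_ac intro: G.l_neg bexI[of _ "\<ominus>\<^bsub>G\<^esub> _"])
qed

lemma module_rest:
  assumes "module R M" "cring R'" "h \<in> ring_hom R' R"
  shows "module R' (rest h M)"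
proof -
  interpret M: module R M by fact
  show ?thesis
  proof (rule moduleI)
    show "abelian_group (rest h M)"
      by (rule abelian_group_cong[OF M.abelian_group_axioms]) simp_all
  qed (use assms ring_hom_closed[OF assms(3)] in \<open>auto simp: ring_hom_add ring_hom_mult ring_hom_one
        M.smult_l_distr M.smult_r_distr M.smult_assoc1\<close>)
qed

lemma module_ring_module: "cring R \<Longrightarrow> module R (ring_module R)"
proof -
  assume "cring R"
  then interpret R: cring R .
  show ?thesis
  proof (rule moduleI)
    show "abelian_group (ring_module R)"
      by (rule abelian_group_cong[OF R.abelian_group_axioms]) simp_all
  qed (use R.cring_axioms in \<open>auto simp: R.l_distr R.r_distr R.m_assoc\<close>)
qed

lemma submodule_rest:
  assumes "module R M" "cring R'" "h \<in> ring_hom R' R" "submodule W R M"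
  shows "submodule W R' (rest h M)"
  using assms ring_hom_closed[OF assms(3)]
  by (auto simp: module.submodule_iff[OF module_rest[OF assms(1-3)]] module.submodule_iff[OF assms(1)])

lemma module_subring:
  assumes "module R M" "cring R" "subring S R"
  shows "module (R\<lparr>carrier := S\<rparr>) M"
proof -
  interpret M: module R M by fact
  have S: "S \<subseteq> carrier R" using subring.axioms(1)[OF assms(3)] subgroup.subset by fastforce
  have "cring (R\<lparr>carrier := S\<rparr>)"
    using M.R.subcringI'[OF assms(3)] M.R.subcring_iff[OF S] by simp
  then show ?thesis
    by (rule moduleI)
      (use S in \<open>auto simp: M.abelian_group_axioms M.smult_l_distr M.smult_r_distr M.smult_assoc1 subset_iff\<close>)
qed

lemma module_carrier_update:
  assumes "module R M" "submodule L R M"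
  shows "module R (M\<lparr>carrier := L\<rparr>)"
  using submodule.submodule_is_module assms by blast

subsection \<open>Linear maps\<close>

lemma Hom_modI:
  assumes "\<And>x. x \<in> carrier M \<Longrightarrow> \<phi> x \<in> carrier N"
    "\<And>x y. x \<in> carrier M \<Longrightarrow> y \<in> carrier M \<Longrightarrow> \<phi> (x \<oplus>\<^bsub>M\<^esub> y) = \<phi> x \<oplus>\<^bsub>N\<^esub> \<phi> y"
    "\<And>c x. c \<in> carrier k \<Longrightarrow> x \<in> carrier M \<Longrightarrow> \<phi> (c \<odot>\<^bsub>M\<^esub> x) = c \<odot>\<^bsub>N\<^esub> \<phi> x"
    "\<phi> \<in> extensional (carrier M)"
  shows "\<phi> \<in> Hom_mod k M N"
  using assms unfolding Hom_mod_def PiE_def by auto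

lemma Hom_modD:
  assumes "\<phi> \<in> Hom_mod k M N"
  shows "\<And>x. x \<in> carrier M \<Longrightarrow> \<phi> x \<in> carrier N"
    "\<And>x y. x \<in> carrier M \<Longrightarrow> y \<in> carrier M \<Longrightarrow> \<phi> (x \<oplus>\<^bsub>M\<^esub> y) = \<phi> x \<oplus>\<^bsub>N\<^esub> \<phi> y"
    "\<And>c x. c \<in> carrier k \<Longrightarrow> x \<in> carrier M \<Longrightarrow> \<phi> (c \<odot>\<^bsub>M\<^esub> x) = c \<odot>\<^bsub>N\<^esub> \<phi> x"
    "\<phi> \<in> extensional (carrier M)"
  using assms unfolding Hom_mod_def PiE_def by auto

lemma Hom_mod_zero:
  assumes "abelian_group M" "abelian_group N" "\<phi> \<in> Hom_mod k M N"
  shows "\<phi> \<zero>\<^bsub>M\<^esub> = \<zero>\<^bsub>N\<^esub>"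
proof -
  interpret M: abelian_group M by fact
  interpret N: abelian_group N by fact
  have "\<phi> \<zero>\<^bsub>M\<^esub> \<oplus>\<^bsub>N\<^esub> \<phi> \<zero>\<^bsub>M\<^esub> = \<phi> \<zero>\<^bsub>M\<^esub>"
    using Hom_modD(2)[OF assms(3), of "\<zero>\<^bsub>M\<^esub>" "\<zero>\<^bsub>M\<^esub>"] by simp
  then show ?thesis using Hom_modD(1)[OF assms(3)] by (metis M.zero_closed N.add.r_cancel_one')
qed

lemma Hom_mod_minus:
  assumes "abelian_group M" "abelian_group N" "\<phi> \<in> Hom_mod k M N" "x \<in> carrier M"
  shows "\<phi> (\<ominus>\<^bsub>M\<^esub> x) = \<ominus>\<^bsub>N\<^esub> \<phi> x"
proof -
  interpret M: abelian_group M by fact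
  interpret N: abelian_group N by fact
  have "\<phi> (\<ominus>\<^bsub>M\<^esub> x) \<oplus>\<^bsub>N\<^esub> \<phi> x = \<zero>\<^bsub>N\<^esub>"
    using Hom_modD(2)[OF assms(3), of "\<ominus>\<^bsub>M\<^esub> x" x] assms(4) Hom_mod_zero[OF assms(1-3)]
    by (simp add: M.l_neg)
  then show ?thesis using Hom_modD(1)[OF assms(3)] assms(4) by (metis M.a_inv_closed N.minus_equality)
qed

lemma Hom_mod_diff:
  assumes "abelian_group M" "abelian_group N" "\<phi> \<in> Hom_mod k M N" "x \<in> carrier M" "y \<in> carrier M"
  shows "\<phi> (x \<ominus>\<^bsub>M\<^esub> y) = \<phi> x \<ominus>\<^bsub>N\<^esub> \<phi> y"
proof -
  interpret M: abelian_group M by fact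
  show ?thesis using assms Hom_modD(2)[OF assms(3), of x "\<ominus>\<^bsub>M\<^esub> y"] Hom_mod_minus[OF assms(1-3,5)]
    by (simp add: a_minus_def)
qed

lemma Hom_mod_compose:
  assumes "\<phi> \<in> Hom_mod k M N" "\<psi> \<in> Hom_mod k N P" "abelian_group M" "module k M"
  shows "compose (carrier M) \<psi> \<phi> \<in> Hom_mod k M P"
proof -
  interpret M: module k M by fact
  show ?thesis
    by (rule Hom_modI) (auto simp: compose_eq Hom_modD[OF assms(1)] Hom_modD[OF assms(2)] compose_def)
qed

lemma Hom_mod_add:
  assumes "\<phi> \<in> Hom_mod k M N" "\<psi> \<in> Hom_mod k M N" "module k M" "module k N"
  shows "(\<lambda>x\<in>carrier M. \<phi> x \<oplus>\<^bsub>N\<^esub> \<psi> x) \<in> Hom_mod k M N"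
proof -
  interpret M: module k M by fact
  interpret N: module k N by fact
  show ?thesis
    by (rule Hom_modI) (auto simp: Hom_modD[OF assms(1)] Hom_modD[OF assms(2)] N.a_ac N.smult_r_distr)
qed

lemma Hom_mod_zero_map:
  assumes "module k M" "module k N"
  shows "(\<lambda>x\<in>carrier M. \<zero>\<^bsub>N\<^esub>) \<in> Hom_mod k M N"
proof -
  interpret M: module k M by fact
  interpret N: module k N by fact
  show ?thesis by (rule Hom_modI) auto
qed

lemma Hom_mod_id:
  assumes "module k M"
  shows "(\<lambda>x\<in>carrier M. x) \<in> Hom_mod k M M"
proof -
  interpret M: module k M by fact
  show ?thesis by (rule Hom_modI) auto
qed

lemma Hom_mod_smult:
  assumes "module k M" "a \<in> carrier k"
  shows "(\<lambda>x\<in>carrier M. a \<odot>\<^bsub>M\<^esub> x) \<in> Hom_mod k M M"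
proof -
  interpret M: module k M by fact
  show ?thesis
    by (rule Hom_modI) (auto simp: assms M.smult_r_distr M.R.m_comm M.smult_assoc1[symmetric])
qed

lemma Hom_mod_rest:
  assumes "\<phi> \<in> Hom_mod K M N" "h \<in> ring_hom k K"
  shows "\<phi> \<in> Hom_mod k (rest h M) (rest h N)"
  by (rule Hom_modI) (use Hom_modD[OF assms(1)] ring_hom_closed[OF assms(2)] in auto)

lemma submodule_image:
  assumes "module k M" "module k N" "\<phi> \<in> Hom_mod k M N" "submodule W k M"
  shows "submodule (\<phi> ` W) k N"
proof -
  interpret M: module k M by fact
  interpret N: module k N by fact
  note W = M.submoduleD[OF assms(4)]
  note h = Hom_modD[OF assms(3)]
  show ?thesis
  proof (rule N.submoduleI')
    show "\<phi> ` W \<subseteq> carrier N" using W(1) h(1) by auto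
    show "\<zero>\<^bsub>N\<^esub> \<in> \<phi> ` W" using W(2)
        Hom_mod_zero[OF M.abelian_group_axioms N.abelian_group_axioms assms(3)] by (metis imageI)
  next
    fix x y assume "x \<in> \<phi> ` W" "y \<in> \<phi> ` W"
    then obtain u v where "u \<in> W" "v \<in> W" "x = \<phi> u" "y = \<phi> v" by auto
    then show "x \<oplus>\<^bsub>N\<^esub> y \<in> \<phi> ` W" using h(2)[of u v] W(1,3) by (metis imageI subsetD)
  next
    fix a x assume a: "a \<in> carrier k" and "x \<in> \<phi> ` W"
    then obtain u where u: "u \<in> W" "x = \<phi> u" by auto
    then have "a \<odot>\<^bsub>N\<^esub> x = \<phi> (a \<odot>\<^bsub>M\<^esub> u)" using a h(3)[of a u] W(1) by auto
    then show "a \<odot>\<^bsub>N\<^esub> x \<in> \<phi> ` W" using W(4)[OF a u(1)] by auto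
  qed
qed

lemma submodule_vimage:
  assumes "module k M" "module k N" "\<phi> \<in> Hom_mod k M N" "submodule W k N"
  shows "submodule {x \<in> carrier M. \<phi> x \<in> W} k M"
proof -
  interpret M: module k M by fact
  interpret N: module k N by fact
  show ?thesis
    using N.submoduleD[OF assms(4)] Hom_modD[OF assms(3)]
      Hom_mod_zero[OF M.abelian_group_axioms N.abelian_group_axioms assms(3)]
    by (intro M.submoduleI') auto
qed

lemma generates_image:
  assumes "module k M" "module k N" "\<phi> \<in> Hom_mod k M N" "generates k M T"
    "\<phi> ` carrier M = carrier N"
  shows "generates k N (\<phi> ` T)"
  unfolding generates_def
proof (intro conjI allI impI)
  show "\<phi> ` T \<subseteq> carrier N" using assms(4,5) by (auto simp: generates_def)
  fix W assume "submodule W k N" "\<phi> ` T \<subseteq> W"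
  then have "carrier M \<subseteq> {x \<in> carrier M. \<phi> x \<in> W}"
    using submodule_vimage[OF assms(1-3)] assms(4) unfolding generates_def by blast
  then show "carrier N \<subseteq> W" unfolding assms(5)[symmetric] by auto
qed

lemma finite_module_surj:
  assumes "finite_module k M" "module k N" "\<phi> \<in> Hom_mod k M N" "\<phi> ` carrier M = carrier N"
  shows "finite_module k N"
  using assms generates_image unfolding finite_module_iff by (metis finite_imageI)

lemma finite_module_image:
  assumes "finite_module k M" "module k N" "\<phi> \<in> Hom_mod k M N"
  shows "finite_module k (N\<lparr>carrier := \<phi> ` carrier M\<rparr>)"
proof -
  have M: "module k M" using assms(1) by (simp add: finite_module_is_module)
  then have s: "submodule (\<phi> ` carrier M) k N"
    by (intro submodule_image[OF M assms(2,3)] module.carrier_is_submodule)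
  have "\<phi> \<in> Hom_mod k M (N\<lparr>carrier := \<phi> ` carrier M\<rparr>)"
    using Hom_modD[OF assms(3)] by (intro Hom_modI) auto
  then show ?thesis
    by (intro finite_module_surj[OF assms(1)] module_carrier_update[OF assms(2) s]) auto
qed

subsection \<open>Complements over a field\<close>

text \<open>Zorn's lemma gives a submodule \<open>C\<close> maximal among those that meet
  \<open>W\<close> in zero, and \<open>p\<close> reads off the component in \<open>W\<close> along
  \<open>C\<close>. No finiteness is assumed: the lemma is applied to \<open>K\<close> as a vector
  space over its residue field, which is infinite-dimensional.\<close>

lemma projection_exists:
  assumes "field F" "module F V" "submodule W F V"
  obtains p where "p \<in> Hom_mod F V V" "\<And>x. x \<in> carrier V \<Longrightarrow> p x \<in> W" "\<And>x. x \<in> W \<Longrightarrow> p x = x"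
proof -
  interpret F: field F by fact
  interpret V: module F V by fact
  note W = V.submoduleD[OF assms(3)]
  define \<A> where "\<A> = {C. submodule C F V \<and> C \<inter> W \<subseteq> {\<zero>\<^bsub>V\<^esub>}}"
  have "\<exists>C\<in>\<A>. \<forall>D\<in>\<A>. C \<subseteq> D \<longrightarrow> D = C"
  proof (rule subset_Zorn_nonempty)
    have "submodule {\<zero>\<^bsub>V\<^esub>} F V" by (rule V.submoduleI') auto
    then show "\<A> \<noteq> {}" by (auto simp: \<A>_def)
  next
    fix \<C> assume ne: "\<C> \<noteq> {}" and c: "subset.chain \<A> \<C>"
    have sub: "\<And>C. C \<in> \<C> \<Longrightarrow> submodule C F V \<and> C \<inter> W \<subseteq> {\<zero>\<^bsub>V\<^esub>}"
      using c by (auto simp: subset.chain_def \<A>_def)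
    have "submodule (\<Union>\<C>) F V"
    proof (rule V.submoduleI')
      show "\<Union>\<C> \<subseteq> carrier V" using sub V.submoduleD(1) by blast
      show "\<zero>\<^bsub>V\<^esub> \<in> \<Union>\<C>" using ne sub V.submoduleD(2) by blast
      show "a \<odot>\<^bsub>V\<^esub> x \<in> \<Union>\<C>" if "a \<in> carrier F" "x \<in> \<Union>\<C>" for a x
        using that sub V.submoduleD(4) by blast
      show "x \<oplus>\<^bsub>V\<^esub> y \<in> \<Union>\<C>" if xy: "x \<in> \<Union>\<C>" "y \<in> \<Union>\<C>" for x y
      proof -
        obtain D D' where D: "D \<in> \<C>" "x \<in> D" "D' \<in> \<C>" "y \<in> D'" using xy by auto
        moreover have "D \<subseteq> D' \<or> D' \<subseteq> D" using c D(1,3) unfolding subset.chain_def by blast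
        ultimately obtain E where "E \<in> \<C>" "x \<in> E" "y \<in> E" by blast
        then show ?thesis using sub V.submoduleD(3) by blast
      qed
    qed
    then show "\<Union>\<C> \<in> \<A>" using sub by (auto simp: \<A>_def)
  qed
  then obtain C where "C \<in> \<A>" and *: "\<forall>D\<in>\<A>. C \<subseteq> D \<longrightarrow> D = C" ..
  then have C: "submodule C F V" and CW: "C \<inter> W \<subseteq> {\<zero>\<^bsub>V\<^esub>}" by (simp_all add: \<A>_def)
  have max: "D = C" if "submodule D F V" "D \<inter> W \<subseteq> {\<zero>\<^bsub>V\<^esub>}" "C \<subseteq> D" for D
  proof -
    have "D \<in> \<A>" using that(1,2) by (simp add: \<A>_def)
    then show ?thesis using * that(3) by simp
  qed
  note c = V.submoduleD[OF C]
  \<comment> \<open>If \<open>x\<close> were outside W + C, then C + F x would still meet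
    \<open>W\<close> in zero: an element of the intersection with nonzero coefficient
    \<open>a\<close> at \<open>x\<close> can be divided by \<open>a\<close>, which puts
    \<open>x\<close> into W + C. Maximality of \<open>C\<close> then forces \<open>x\<close> into
    \<open>C\<close> itself.\<close>
  have split: "\<exists>w\<in>W. x \<ominus>\<^bsub>V\<^esub> w \<in> C" if x: "x \<in> carrier V" for x
  proof (rule ccontr)
    assume neg: "\<not> ?thesis"
    let ?X = "{u \<oplus>\<^bsub>V\<^esub> a \<odot>\<^bsub>V\<^esub> x | u a. u \<in> C \<and> a \<in> carrier F}"
    have uC: "\<And>u. u \<in> C \<Longrightarrow> u \<in> carrier V" using c(1) by auto
    have "submodule ?X F V"
    proof (rule V.submoduleI')
      show "?X \<subseteq> carrier V" using x uC by auto
      show "\<zero>\<^bsub>V\<^esub> \<in> ?X" using c(2) x by (auto intro!: exI[of _ "\<zero>\<^bsub>V\<^esub>"] exI[of _ "\<zero>\<^bsub>F\<^esub>"])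
    next
      fix y z assume "y \<in> ?X" "z \<in> ?X"
      then obtain u a v b where *: "u \<in> C" "a \<in> carrier F" "y = u \<oplus>\<^bsub>V\<^esub> a \<odot>\<^bsub>V\<^esub> x"
        "v \<in> C" "b \<in> carrier F" "z = v \<oplus>\<^bsub>V\<^esub> b \<odot>\<^bsub>V\<^esub> x" by blast
      then have "y \<oplus>\<^bsub>V\<^esub> z = (u \<oplus>\<^bsub>V\<^esub> v) \<oplus>\<^bsub>V\<^esub> (a \<oplus>\<^bsub>F\<^esub> b) \<odot>\<^bsub>V\<^esub> x"
        using x uC by (simp add: V.smult_l_distr V.a_ac)
      then show "y \<oplus>\<^bsub>V\<^esub> z \<in> ?X" using * c(3) by blast
    next
      fix b y assume b: "b \<in> carrier F" and "y \<in> ?X"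
      then obtain u a where *: "u \<in> C" "a \<in> carrier F" "y = u \<oplus>\<^bsub>V\<^esub> a \<odot>\<^bsub>V\<^esub> x" by blast
      then have "b \<odot>\<^bsub>V\<^esub> y = b \<odot>\<^bsub>V\<^esub> u \<oplus>\<^bsub>V\<^esub> (b \<otimes>\<^bsub>F\<^esub> a) \<odot>\<^bsub>V\<^esub> x"
        using x uC b by (simp add: V.smult_r_distr V.smult_assoc1)
      then show "b \<odot>\<^bsub>V\<^esub> y \<in> ?X" using * b c(4) by blast
    qed
    moreover have "?X \<inter> W \<subseteq> {\<zero>\<^bsub>V\<^esub>}"
    proof
      fix y assume y: "y \<in> ?X \<inter> W"
      then obtain u a where *: "u \<in> C" "a \<in> carrier F" "y = u \<oplus>\<^bsub>V\<^esub> a \<odot>\<^bsub>V\<^esub> x" by blast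
      show "y \<in> {\<zero>\<^bsub>V\<^esub>}"
      proof (cases "a = \<zero>\<^bsub>F\<^esub>")
        case True
        then have "y = u" using * x uC by simp
        then show ?thesis using CW y * by blast
      next
        case False
        then have i: "inv\<^bsub>F\<^esub> a \<in> carrier F" "inv\<^bsub>F\<^esub> a \<otimes>\<^bsub>F\<^esub> a = \<one>\<^bsub>F\<^esub>"
          using *(2) F.field_Units by auto
        have yV: "y \<in> carrier V" using y W(1) by auto
        have "inv\<^bsub>F\<^esub> a \<odot>\<^bsub>V\<^esub> y = inv\<^bsub>F\<^esub> a \<odot>\<^bsub>V\<^esub> u \<oplus>\<^bsub>V\<^esub> x"
          using * i x uC by (simp add: V.smult_r_distr V.smult_assoc1[symmetric])
        then have "x \<ominus>\<^bsub>V\<^esub> inv\<^bsub>F\<^esub> a \<odot>\<^bsub>V\<^esub> y = \<ominus>\<^bsub>V\<^esub> (inv\<^bsub>F\<^esub> a \<odot>\<^bsub>V\<^esub> u)"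
          using i x uC[OF *(1)] by (simp add: a_minus_def V.minus_add V.a_ac V.r_neg1 V.r_neg2 V.r_neg V.l_neg)
        then have "x \<ominus>\<^bsub>V\<^esub> inv\<^bsub>F\<^esub> a \<odot>\<^bsub>V\<^esub> y \<in> C" using c(4,5) i(1) *(1) by auto
        moreover have "inv\<^bsub>F\<^esub> a \<odot>\<^bsub>V\<^esub> y \<in> W" using y W(4) i(1) by blast
        ultimately show ?thesis using neg by blast
      qed
    qed
    moreover have "C \<subseteq> ?X"
    proof
      fix u assume "u \<in> C"
      moreover from this have "u = u \<oplus>\<^bsub>V\<^esub> \<zero>\<^bsub>F\<^esub> \<odot>\<^bsub>V\<^esub> x" using x uC by simp
      ultimately show "u \<in> ?X" by blast
    qed
    ultimately have X: "?X = C" using max by blast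
    have "\<zero>\<^bsub>V\<^esub> \<oplus>\<^bsub>V\<^esub> \<one>\<^bsub>F\<^esub> \<odot>\<^bsub>V\<^esub> x \<in> ?X" using c(2) by blast
    then have "x \<in> C" using X x by simp
    moreover have "x \<ominus>\<^bsub>V\<^esub> \<zero>\<^bsub>V\<^esub> = x" using x by (simp add: a_minus_def)
    ultimately show False using neg W(2) by metis
  qed
  have uniq: "w = w'" if "w \<in> W" "w' \<in> W" "x \<ominus>\<^bsub>V\<^esub> w \<in> C" "x \<ominus>\<^bsub>V\<^esub> w' \<in> C" "x \<in> carrier V" for x w w'
  proof -
    have wV: "w \<in> carrier V" "w' \<in> carrier V" using that W(1) by auto
    have "(x \<ominus>\<^bsub>V\<^esub> w) \<ominus>\<^bsub>V\<^esub> (x \<ominus>\<^bsub>V\<^esub> w') = w' \<ominus>\<^bsub>V\<^esub> w"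
      by (rule V.minus_minus_cancel[OF that(5) wV])
    then have "w' \<ominus>\<^bsub>V\<^esub> w \<in> C \<inter> W" using c(6)[OF that(3,4)] W(6) that by auto
    then show ?thesis using CW wV by (auto simp: V.minus_eq_zero_iff)
  qed
  define p where "p = (\<lambda>x\<in>carrier V. THE w. w \<in> W \<and> x \<ominus>\<^bsub>V\<^esub> w \<in> C)"
  have pI: "p x = w" if "x \<in> carrier V" "w \<in> W" "x \<ominus>\<^bsub>V\<^esub> w \<in> C" for x w
    using that uniq unfolding p_def by (auto intro!: the_equality)
  have pW: "p x \<in> W" "x \<ominus>\<^bsub>V\<^esub> p x \<in> C" if "x \<in> carrier V" for x
    using split[OF that] pI[OF that] by auto
  have pV: "p x \<in> carrier V" if "x \<in> carrier V" for x using pW[OF that] W(1) by auto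
  show ?thesis
  proof
    show "p \<in> Hom_mod F V V"
    proof (rule Hom_modI)
      fix x y assume xy: "x \<in> carrier V" "y \<in> carrier V"
      have "(x \<oplus>\<^bsub>V\<^esub> y) \<ominus>\<^bsub>V\<^esub> (p x \<oplus>\<^bsub>V\<^esub> p y) = (x \<ominus>\<^bsub>V\<^esub> p x) \<oplus>\<^bsub>V\<^esub> (y \<ominus>\<^bsub>V\<^esub> p y)"
        using xy pV by (simp add: a_minus_def V.minus_add V.a_ac)
      then show "p (x \<oplus>\<^bsub>V\<^esub> y) = p x \<oplus>\<^bsub>V\<^esub> p y"
        using pW xy c(3) W(3) by (intro pI) auto
    next
      fix a x assume ax: "a \<in> carrier F" "x \<in> carrier V"
      have "a \<odot>\<^bsub>V\<^esub> x \<ominus>\<^bsub>V\<^esub> a \<odot>\<^bsub>V\<^esub> p x = a \<odot>\<^bsub>V\<^esub> (x \<ominus>\<^bsub>V\<^esub> p x)"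
        using ax pV by (simp add: a_minus_def V.smult_r_distr V.smult_r_minus)
      then show "p (a \<odot>\<^bsub>V\<^esub> x) = a \<odot>\<^bsub>V\<^esub> p x"
        using pW ax c(4) W(4) by (intro pI) auto
    qed (use pV in \<open>simp_all add: p_def\<close>)
    show "p x \<in> W" if "x \<in> carrier V" for x using pW that by blast
    show "p x = x" if "x \<in> W" for x
      using that W(1) c(2) by (intro pI) (auto simp: a_minus_def V.r_neg)
  qed
qed

text \<open>A set-theoretic section \<open>t\<close> is made linear by removing its component in the
  kernel of \<open>q\<close>: two preimages of the same element differ by a kernel element, which
  the projection \<open>p\<close> onto the kernel fixes, so \<open>t y - p (t y)\<close> does not
  depend on the choice of preimage.\<close>

lemma section_exists:
  assumes "field F" "module F V" "module F W" "q \<in> Hom_mod F V W" "q ` carrier V = carrier W"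
  obtains s where "s \<in> Hom_mod F W V" "\<And>y. y \<in> carrier W \<Longrightarrow> q (s y) = y"
proof -
  interpret V: module F V by fact
  interpret W: module F W by fact
  note h = Hom_modD[OF assms(4)]
  note q0 = Hom_mod_zero[OF V.abelian_group_axioms W.abelian_group_axioms assms(4)]
  note qd = Hom_mod_diff[OF V.abelian_group_axioms W.abelian_group_axioms assms(4)]
  let ?N = "{x \<in> carrier V. q x \<in> {\<zero>\<^bsub>W\<^esub>}}"
  have "submodule {\<zero>\<^bsub>W\<^esub>} F W" by (rule W.submoduleI') auto
  then have "submodule ?N F V" by (rule submodule_vimage[OF assms(2-4)])
  then obtain p where p: "p \<in> Hom_mod F V V" "\<And>x. x \<in> carrier V \<Longrightarrow> p x \<in> ?N" "\<And>x. x \<in> ?N \<Longrightarrow> p x = x"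
    using projection_exists[OF assms(1,2)] by blast
  note hp = Hom_modD[OF p(1)]
  note pd = Hom_mod_diff[OF V.abelian_group_axioms V.abelian_group_axioms p(1)]
  define t where "t = inv_into (carrier V) q"
  have t: "t y \<in> carrier V" "q (t y) = y" if "y \<in> carrier W" for y
    using that assms(5) by (auto simp: t_def inv_into_into f_inv_into_f)
  define s where "s = (\<lambda>y\<in>carrier W. t y \<ominus>\<^bsub>V\<^esub> p (t y))"
  \<comment> \<open>With this formula for an arbitrary preimage \<open>x\<close>, linearity of
    \<open>s\<close> is inherited from that of \<open>p\<close>.\<close>
  have sI: "s (q x) = x \<ominus>\<^bsub>V\<^esub> p x" if x: "x \<in> carrier V" for x
  proof -
    have qx: "q x \<in> carrier W" using h(1) x .
    have "q (t (q x) \<ominus>\<^bsub>V\<^esub> x) = \<zero>\<^bsub>W\<^esub>" using qd t[OF qx] x qx by (simp add: W.minus_eq_zero_iff)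
    then have "t (q x) \<ominus>\<^bsub>V\<^esub> x \<in> ?N" using t(1)[OF qx] x by simp
    from p(3)[OF this] have "p (t (q x)) \<ominus>\<^bsub>V\<^esub> p x = t (q x) \<ominus>\<^bsub>V\<^esub> x"
      using pd t(1)[OF qx] x by simp
    then have "t (q x) \<ominus>\<^bsub>V\<^esub> p (t (q x)) = x \<ominus>\<^bsub>V\<^esub> p x"
      by (rule V.minus_swap[OF t(1)[OF qx] x hp(1)[OF t(1)[OF qx]] hp(1)[OF x]])
    then show ?thesis using qx by (simp add: s_def)
  qed
  show ?thesis
  proof
    show "s \<in> Hom_mod F W V"
    proof (rule Hom_modI)
      fix x y assume "x \<in> carrier W" "y \<in> carrier W"
      then obtain u v where uv: "u \<in> carrier V" "v \<in> carrier V" "x = q u" "y = q v" unfolding assms(5)[symmetric] by auto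
      then have "s (x \<oplus>\<^bsub>W\<^esub> y) = s (q (u \<oplus>\<^bsub>V\<^esub> v))" using h(2) by simp
      then show "s (x \<oplus>\<^bsub>W\<^esub> y) = s x \<oplus>\<^bsub>V\<^esub> s y"
        using uv hp by (simp add: sI a_minus_def V.minus_add V.a_ac)
    next
      fix a x assume "a \<in> carrier F" "x \<in> carrier W"
      then obtain u where uv: "u \<in> carrier V" "x = q u" "a \<in> carrier F" unfolding assms(5)[symmetric] by auto
      then have "s (a \<odot>\<^bsub>W\<^esub> x) = s (q (a \<odot>\<^bsub>V\<^esub> u))" using h(3) by simp
      then show "s (a \<odot>\<^bsub>W\<^esub> x) = a \<odot>\<^bsub>V\<^esub> s x"
        using uv hp by (simp add: sI a_minus_def V.smult_r_distr V.smult_r_minus)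
    qed (use t hp in \<open>auto simp: s_def\<close>)
    show "q (s y) = y" if "y \<in> carrier W" for y
      using t[OF that] that hp(1) p(2)[OF t(1)[OF that]] qd by (simp add: s_def a_minus_def)
  qed
qed

text \<open>Project \<open>W\<close> onto the image of \<open>j\<close> and invert \<open>j\<close>
  there.\<close>

lemma retraction_exists:
  assumes "field F" "module F V" "module F W" "j \<in> Hom_mod F V W" "inj_on j (carrier V)"
  obtains s where "s \<in> Hom_mod F W V" "\<And>x. x \<in> carrier V \<Longrightarrow> s (j x) = x"
proof -
  interpret V: module F V by fact
  interpret W: module F W by fact
  note h = Hom_modD[OF assms(4)]
  have "submodule (j ` carrier V) F W"
    by (rule submodule_image[OF assms(2-4) V.carrier_is_submodule])
  then obtain p where p: "p \<in> Hom_mod F W W" "\<And>x. x \<in> carrier W \<Longrightarrow> p x \<in> j ` carrier V"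
    "\<And>x. x \<in> j ` carrier V \<Longrightarrow> p x = x"
    using projection_exists[OF assms(1,3)] by blast
  note hp = Hom_modD[OF p(1)]
  define t where "t = inv_into (carrier V) j"
  have t: "t (j x) = x" if "x \<in> carrier V" for x using that assms(5) by (simp add: t_def)
  define s where "s = (\<lambda>y\<in>carrier W. t (p y))"
  show ?thesis
  proof
    show "s \<in> Hom_mod F W V"
    proof (rule Hom_modI)
      fix x y assume xy: "x \<in> carrier W" "y \<in> carrier W"
      obtain u v where uv: "u \<in> carrier V" "v \<in> carrier V" "p x = j u" "p y = j v"
        using p(2)[OF xy(1)] p(2)[OF xy(2)] by (elim imageE)
      then have "p (x \<oplus>\<^bsub>W\<^esub> y) = j (u \<oplus>\<^bsub>V\<^esub> v)" using h hp xy by simp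
      then show "s (x \<oplus>\<^bsub>W\<^esub> y) = s x \<oplus>\<^bsub>V\<^esub> s y" using uv xy by (simp add: s_def t)
    next
      fix a x assume ax: "a \<in> carrier F" "x \<in> carrier W"
      obtain u where uv: "u \<in> carrier V" "p x = j u" using p(2)[OF ax(2)] by (elim imageE)
      then have "p (a \<odot>\<^bsub>W\<^esub> x) = j (a \<odot>\<^bsub>V\<^esub> u)" using h hp ax by simp
      then show "s (a \<odot>\<^bsub>W\<^esub> x) = a \<odot>\<^bsub>V\<^esub> s x" using uv ax by (simp add: s_def t)
    next
      fix x assume "x \<in> carrier W"
      then show "s x \<in> carrier V" using p(2)[of x] t by (auto simp: s_def)
    qed (simp add: s_def)
    show "s (j x) = x" if "x \<in> carrier V" for x using that h(1) p(3) t by (simp add: s_def)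
  qed
qed

text \<open>Over a field a submodule is also a quotient, by a projection, and images of finitely
  generated modules are finitely generated. No notion of dimension enters.\<close>

lemma finite_module_submodule:
  assumes "field F" "finite_module F V" "submodule W F V"
  shows "finite_module F (V\<lparr>carrier := W\<rparr>)"
proof -
  have V: "module F V" using assms(2) by (rule finite_module_is_module)
  obtain p where p: "p \<in> Hom_mod F V V" "\<And>x. x \<in> carrier V \<Longrightarrow> p x \<in> W" "\<And>x. x \<in> W \<Longrightarrow> p x = x"
    using projection_exists[OF assms(1) V assms(3)] by blast
  have "W \<subseteq> carrier V" using module.submoduleD(1)[OF V assms(3)] .
  then have "p ` carrier V = W" using p(2,3) by (auto intro!: image_eqI[of _ p])
  then show ?thesis using finite_module_image[OF assms(2) V p(1)] by simp
qed

text \<open>The products of generators of \<open>K\<close> over \<open>k\<close> with generators of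
  \<open>M\<close> over \<open>K\<close> generate. This serves dimension zero, where
  \<open>K\<close> is finite over \<open>k\<close> and therefore every finite
  \<open>K\<close>-module is.\<close>

lemma finite_module_trans:
  assumes "finite_module K M" "cring k" "h \<in> ring_hom k K" "finite_module k (rest h (ring_module K))"
  shows "finite_module k (rest h M)"
proof -
  interpret M: module K M using assms(1) by (rule finite_module_is_module)
  have mk: "module k (rest h M)" by (rule module_rest[OF M.module_axioms assms(2,3)])
  interpret kM: module k "rest h M" by fact
  have mK: "module K (ring_module K)" by (rule module_ring_module[OF M.R.cring_axioms])
  have mkK: "module k (rest h (ring_module K))" by (rule module_rest[OF mK assms(2,3)])
  obtain G where G: "finite G" "generates K M G" using assms(1) by (auto simp: finite_module_iff)
  obtain A where A: "finite A" "generates k (rest h (ring_module K)) A"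
    using assms(4) by (auto simp: finite_module_iff)
  have GM: "G \<subseteq> carrier M" and AK: "A \<subseteq> carrier K" using G(2) A(2) by (auto simp: generates_def)
  let ?T = "(\<lambda>(a, g). a \<odot>\<^bsub>M\<^esub> g) ` (A \<times> G)"
  have "generates k (rest h M) ?T"
    unfolding generates_def
  proof (intro conjI allI impI)
    show "?T \<subseteq> carrier (rest h M)" using GM AK by auto
    fix W assume W: "submodule W k (rest h M)" and T: "?T \<subseteq> W"
    note w = kM.submoduleD[OF W]
    have 1: "a \<odot>\<^bsub>M\<^esub> g \<in> W" if g: "g \<in> G" and a: "a \<in> carrier K" for g a
    proof -
      have "(\<lambda>a\<in>carrier K. a \<odot>\<^bsub>M\<^esub> g) \<in> Hom_mod k (rest h (ring_module K)) (rest h M)"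
        using g GM ring_hom_closed[OF assms(3)]
        by (intro Hom_modI) (auto simp: M.smult_l_distr M.smult_assoc1 subset_iff)
      from submodule_vimage[OF mkK mk this W]
      have "submodule {a \<in> carrier K. a \<odot>\<^bsub>M\<^esub> g \<in> W} k (rest h (ring_module K))"
        by (simp cong: conj_cong)
      moreover have "A \<subseteq> {a \<in> carrier K. a \<odot>\<^bsub>M\<^esub> g \<in> W}" using T g AK by auto
      ultimately have "carrier (rest h (ring_module K)) \<subseteq> {a \<in> carrier K. a \<odot>\<^bsub>M\<^esub> g \<in> W}"
        using A(2) unfolding generates_def by blast
      then show ?thesis using a by auto
    qed
    \<comment> \<open>\<open>W\<close> is only stable under \<open>k\<close>. The elements all of
      whose \<open>K\<close>-multiples lie in \<open>W\<close> form a \<open>K\<close>-submodule, to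
      which generation of \<open>M\<close> over \<open>K\<close> applies.\<close>
    let ?U = "{x \<in> carrier M. \<forall>a\<in>carrier K. a \<odot>\<^bsub>M\<^esub> x \<in> W}"
    have "submodule ?U K M"
      using w by (intro M.submoduleI') (auto simp: M.smult_r_distr M.smult_assoc1[symmetric])
    then have "carrier M \<subseteq> ?U" using G(2) 1 GM unfolding generates_def by blast
    then have sub: "x \<in> ?U" if "x \<in> carrier M" for x using that by (rule subsetD)
    have "x \<in> W" if x: "x \<in> carrier M" for x
    proof -
      have "\<forall>a\<in>carrier K. a \<odot>\<^bsub>M\<^esub> x \<in> W" using sub[OF x] by (rule CollectE) (rule conjunct2)
      then have "\<one>\<^bsub>K\<^esub> \<odot>\<^bsub>M\<^esub> x \<in> W" by (rule bspec) (rule M.R.one_closed)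
      then show ?thesis by (simp only: M.smult_one[OF x])
    qed
    then show "carrier (rest h M) \<subseteq> W" by (simp only: rest_simps subset_iff) blast
  qed
  moreover have "finite ?T" using G(1) A(1) by simp
  ultimately show ?thesis using mk unfolding finite_module_iff by (intro conjI exI[of _ ?T])
qed

lemma a_inv_ring_module:
  assumes "cring R" "x \<in> carrier R"
  shows "\<ominus>\<^bsub>ring_module R\<^esub> x = \<ominus>\<^bsub>R\<^esub> x"
proof -
  interpret R: cring R by fact
  interpret M: module R "ring_module R" by (rule module_ring_module[OF assms(1)])
  show ?thesis using assms(2) M.M.l_neg[of x] M.M.a_inv_closed[of x] R.minus_equality[of "\<ominus>\<^bsub>ring_module R\<^esub> x" x] by simp
qed

lemma finite_ring_module:
  assumes "field F"
  shows "finite_module F (ring_module F)"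
proof -
  interpret F: field F by fact
  interpret R: module F "ring_module F" by (rule module_ring_module[OF F.cring_axioms])
  have "generates F (ring_module F) {\<one>\<^bsub>F\<^esub>}"
    unfolding generates_def
  proof (intro conjI allI impI)
    fix W assume "submodule W F (ring_module F)" "{\<one>\<^bsub>F\<^esub>} \<subseteq> W"
    then show "carrier (ring_module F) \<subseteq> W" using R.submoduleD(4)[of W _ "\<one>\<^bsub>F\<^esub>"] by auto
  qed simp
  then show ?thesis using R.module_axioms unfolding finite_module_iff by blast
qed

lemma submodule_mspan:
  assumes "module R M" "T \<subseteq> carrier M"
  shows "submodule (mspan R M T) R M"
proof -
  interpret module R M by fact
  show ?thesis
    unfolding mspan_def
    by (rule submoduleI') (use submoduleD carrier_is_submodule assms(2) in \<open>(fastforce | blast)+\<close>)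
qed

subsection \<open>The endomorphism ring\<close>

lemma End_ring_simps [simp]:
  "carrier (End_ring k M) = Hom_mod k M M"
  "\<phi> \<otimes>\<^bsub>End_ring k M\<^esub> \<psi> = compose (carrier M) \<phi> \<psi>"
  "\<one>\<^bsub>End_ring k M\<^esub> = (\<lambda>x\<in>carrier M. x)"
  "\<zero>\<^bsub>End_ring k M\<^esub> = (\<lambda>x\<in>carrier M. \<zero>\<^bsub>M\<^esub>)"
  "\<phi> \<oplus>\<^bsub>End_ring k M\<^esub> \<psi> = (\<lambda>x\<in>carrier M. \<phi> x \<oplus>\<^bsub>M\<^esub> \<psi> x)"
  by (simp_all add: End_ring_def)

lemma ring_End_ring:
  assumes "module k M"
  shows "ring (End_ring k M)"
proof -
  interpret M: module k M by fact
  note c = Hom_mod_compose[OF _ _ M.abelian_group_axioms assms] Hom_mod_add[OF _ _ assms assms]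
  \<comment> \<open>The additive inverse is taken as the composite with the scalar -1, so that its
    linearity is an instance of closure under composition.\<close>
  have neg: "compose (carrier M) (\<lambda>x\<in>carrier M. (\<ominus>\<^bsub>k\<^esub> \<one>\<^bsub>k\<^esub>) \<odot>\<^bsub>M\<^esub> x) \<phi> \<in> Hom_mod k M M"
    if "\<phi> \<in> Hom_mod k M M" for \<phi>
    by (rule c(1)[OF that Hom_mod_smult[OF assms]]) simp
  show ?thesis
  proof (rule ringI)
    show "abelian_group (End_ring k M)"
    proof (rule abelian_groupI)
      fix \<phi> assume \<phi>: "\<phi> \<in> carrier (End_ring k M)"
      then show "\<exists>\<psi>\<in>carrier (End_ring k M). \<psi> \<oplus>\<^bsub>End_ring k M\<^esub> \<phi> = \<zero>\<^bsub>End_ring k M\<^esub>"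
        using Hom_modD(1)[of \<phi> k M M]
        by (intro bexI[OF _ neg[of \<phi>, folded End_ring_simps(1)]])
          (auto simp: fun_eq_iff compose_eq M.smult_l_minus M.l_neg)
      show "\<zero>\<^bsub>End_ring k M\<^esub> \<oplus>\<^bsub>End_ring k M\<^esub> \<phi> = \<phi>"
        using \<phi> Hom_modD(1,4)[of \<phi> k M M] by (auto simp: fun_eq_iff extensional_def)
    qed (auto simp: c Hom_mod_zero_map assms fun_eq_iff M.a_ac Hom_modD)
    show "monoid (End_ring k M)"
    proof (rule monoidI)
      fix \<phi> assume \<phi>: "\<phi> \<in> carrier (End_ring k M)"
      then show "\<one>\<^bsub>End_ring k M\<^esub> \<otimes>\<^bsub>End_ring k M\<^esub> \<phi> = \<phi>" "\<phi> \<otimes>\<^bsub>End_ring k M\<^esub> \<one>\<^bsub>End_ring k M\<^esub> = \<phi>"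
        using \<phi> Hom_modD(1,4)[of \<phi> k M M] by (auto simp: fun_eq_iff compose_def extensional_def)
    next
      fix \<phi> \<psi> assume "\<phi> \<in> carrier (End_ring k M)" "\<psi> \<in> carrier (End_ring k M)"
      then show "\<phi> \<otimes>\<^bsub>End_ring k M\<^esub> \<psi> \<in> carrier (End_ring k M)" using c(1) by simp
    qed (auto simp: Hom_mod_id assms fun_eq_iff compose_def Hom_modD)
  qed (auto simp: fun_eq_iff compose_def Hom_modD)
qed

lemma End_ring_pow_Suc:
  assumes "x \<in> carrier M"
  shows "(\<phi> [^]\<^bsub>End_ring k M\<^esub> Suc q) x = (\<phi> [^]\<^bsub>End_ring k M\<^esub> q) (\<phi> x)"
  using assms by (simp add: compose_eq)

lemma End_ring_pow:
  assumes "\<And>x. x \<in> carrier M \<Longrightarrow> \<phi> x \<in> carrier M" "x \<in> carrier M"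
  shows "(\<phi> [^]\<^bsub>End_ring k M\<^esub> q) x = (\<phi> ^^ q) x"
  using assms(2)
proof (induction q arbitrary: x)
  case (Suc q)
  then show ?case
    using End_ring_pow_Suc[OF Suc.prems] assms(1)[OF Suc.prems] by (simp add: funpow_swap1)
qed simp

text \<open>Additive inverses come from multiplication by -1. What remains to be checked is what a
  \<open>bt_family\<close> provides.\<close>

lemma idealI_mult:
  assumes "ring R" "I \<subseteq> carrier R" "\<zero>\<^bsub>R\<^esub> \<in> I" "\<And>x y. x \<in> I \<Longrightarrow> y \<in> I \<Longrightarrow> x \<oplus>\<^bsub>R\<^esub> y \<in> I"
    "\<And>a x. a \<in> carrier R \<Longrightarrow> x \<in> I \<Longrightarrow> a \<otimes>\<^bsub>R\<^esub> x \<in> I" "\<And>a x. a \<in> carrier R \<Longrightarrow> x \<in> I \<Longrightarrow> x \<otimes>\<^bsub>R\<^esub> a \<in> I"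
  shows "ideal I R"
proof -
  interpret ring R by fact
  have "\<ominus>\<^bsub>R\<^esub> x \<in> I" if "x \<in> I" for x
    using assms(5)[of "\<ominus>\<^bsub>R\<^esub> \<one>\<^bsub>R\<^esub>" x] that assms(2) by (auto simp: l_minus subset_iff)
  then have "subgroup I (add_monoid R)"
    using assms(2-4) by (intro add.subgroupI) (auto simp: a_inv_def)
  then show ?thesis using assms by (intro idealI) auto
qed

section \<open>Quotients by systems of representatives\<close>

text \<open>The coset of \<open>x\<close> modulo \<open>N\<close> does not involve the ambient
  carrier, so one projection serves all lattices that contain \<open>N\<close>.\<close>

lemma quot_module_proj_carrier_update [simp]:
  "quot_module_proj (M\<lparr>carrier := L\<rparr>) N = quot_module_proj M N"
  by (simp add: quot_module_proj_def a_r_coset_def r_coset_def fun_eq_iff)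

lemma quot_module_proj_mem:
  assumes "module R M" "submodule N R M" "x \<in> carrier M"
  obtains n where "n \<in> N" "quot_module_proj M N x = n \<oplus>\<^bsub>M\<^esub> x"
proof -
  interpret module R M by fact
  have "\<zero>\<^bsub>M\<^esub> \<oplus>\<^bsub>M\<^esub> x \<in> N +>\<^bsub>M\<^esub> x"
    using submoduleD(2)[OF assms(2)] by (auto simp: a_r_coset_def r_coset_def)
  then have "quot_module_proj M N x \<in> N +>\<^bsub>M\<^esub> x"
    unfolding quot_module_proj_def coset_rep_def by (rule someI)
  then show ?thesis using that by (auto simp: a_r_coset_def r_coset_def)
qed

text \<open>The representative is chosen from the coset as a set, hence equal cosets have the same
  representative; conversely a common representative \<open>n + x = m + y\<close> exhibits
  \<open>x - y\<close> as \<open>m - n\<close>.\<close>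

lemma quot_module_proj_eq_iff:
  assumes "module R M" "submodule N R M" "x \<in> carrier M" "y \<in> carrier M"
  shows "quot_module_proj M N x = quot_module_proj M N y \<longleftrightarrow> x \<ominus>\<^bsub>M\<^esub> y \<in> N"
proof
  interpret M: module R M by fact
  note N = M.submoduleD[OF assms(2)]
  obtain n m where nm: "n \<in> N" "quot_module_proj M N x = n \<oplus>\<^bsub>M\<^esub> x"
    "m \<in> N" "quot_module_proj M N y = m \<oplus>\<^bsub>M\<^esub> y"
    using quot_module_proj_mem assms by metis
  have nmc: "n \<in> carrier M" "m \<in> carrier M" using nm N(1) by auto
  assume "quot_module_proj M N x = quot_module_proj M N y"
  then have "n \<oplus>\<^bsub>M\<^esub> x = m \<oplus>\<^bsub>M\<^esub> y" using nm by simp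
  then have "x \<oplus>\<^bsub>M\<^esub> n = y \<oplus>\<^bsub>M\<^esub> m" using nmc assms by (simp add: M.a_comm)
  then have "x \<oplus>\<^bsub>M\<^esub> n \<ominus>\<^bsub>M\<^esub> n = y \<oplus>\<^bsub>M\<^esub> m \<ominus>\<^bsub>M\<^esub> n" by simp
  then have x: "x = y \<oplus>\<^bsub>M\<^esub> (m \<ominus>\<^bsub>M\<^esub> n)"
    using nmc assms by (simp add: a_minus_def M.a_assoc M.r_neg)
  have "x \<ominus>\<^bsub>M\<^esub> y = m \<ominus>\<^bsub>M\<^esub> n"
    by (subst x) (use nmc assms in \<open>simp add: a_minus_def M.a_comm[of y] M.a_assoc M.r_neg\<close>)
  then show "x \<ominus>\<^bsub>M\<^esub> y \<in> N" using N(6)[OF nm(3,1)] by simp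
next
  interpret M: module R M by fact
  note N = M.submoduleD[OF assms(2)]
  have sub: "N +>\<^bsub>M\<^esub> u \<subseteq> N +>\<^bsub>M\<^esub> v"
    if uv: "u \<in> carrier M" "v \<in> carrier M" "u \<ominus>\<^bsub>M\<^esub> v \<in> N" for u v
  proof
    fix z assume "z \<in> N +>\<^bsub>M\<^esub> u"
    then obtain h where h: "h \<in> N" "z = h \<oplus>\<^bsub>M\<^esub> u" by (auto simp: a_r_coset_def r_coset_def)
    have "h \<in> carrier M" using h N(1) by auto
    then have "z = (h \<oplus>\<^bsub>M\<^esub> (u \<ominus>\<^bsub>M\<^esub> v)) \<oplus>\<^bsub>M\<^esub> v"
      using h uv(1,2) by (simp add: a_minus_def M.a_assoc M.l_neg)
    then show "z \<in> N +>\<^bsub>M\<^esub> v" using N(3)[OF h(1) uv(3)] by (auto simp: a_r_coset_def r_coset_def)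
  qed
  assume xy: "x \<ominus>\<^bsub>M\<^esub> y \<in> N"
  have "y \<ominus>\<^bsub>M\<^esub> x = \<ominus>\<^bsub>M\<^esub> (x \<ominus>\<^bsub>M\<^esub> y)"
    using assms by (simp add: a_minus_def M.minus_add M.a_comm)
  then have "y \<ominus>\<^bsub>M\<^esub> x \<in> N" using N(5)[OF xy] by simp
  then have "N +>\<^bsub>M\<^esub> x = N +>\<^bsub>M\<^esub> y" using sub xy assms by blast
  then show "quot_module_proj M N x = quot_module_proj M N y" by (simp add: quot_module_proj_def)
qed

text \<open>The module axioms are equations and existence statements, so they pass along any
  surjection compatible with the operations. This spares all computations with cosets in quotient
  modules.\<close>

lemma module_of_surj:
  assumes "module R M" "carrier Q = p ` carrier M"
    "\<And>x y. x \<in> carrier M \<Longrightarrow> y \<in> carrier M \<Longrightarrow> p x \<oplus>\<^bsub>Q\<^esub> p y = p (x \<oplus>\<^bsub>M\<^esub> y)"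
    "\<And>a x. a \<in> carrier R \<Longrightarrow> x \<in> carrier M \<Longrightarrow> a \<odot>\<^bsub>Q\<^esub> p x = p (a \<odot>\<^bsub>M\<^esub> x)"
    "\<zero>\<^bsub>Q\<^esub> = p \<zero>\<^bsub>M\<^esub>"
  shows "module R Q"
proof -
  interpret M: module R M by fact
  show ?thesis
  proof (rule moduleI)
    show "abelian_group Q"
    proof (rule abelian_groupI)
      fix y assume "y \<in> carrier Q"
      then obtain x where "x \<in> carrier M" "y = p x" using assms(2) by auto
      then have "p (\<ominus>\<^bsub>M\<^esub> x) \<in> carrier Q" "p (\<ominus>\<^bsub>M\<^esub> x) \<oplus>\<^bsub>Q\<^esub> y = \<zero>\<^bsub>Q\<^esub>"
        using assms by (auto simp: M.l_neg)
      then show "\<exists>z\<in>carrier Q. z \<oplus>\<^bsub>Q\<^esub> y = \<zero>\<^bsub>Q\<^esub>" by blast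
    qed (use assms in \<open>auto simp: M.a_ac\<close>)
  qed (use assms in \<open>auto simp: M.R.cring_axioms M.smult_l_distr M.smult_r_distr M.smult_assoc1\<close>)
qed

lemma lattice_quot_simps [simp]:
  "carrier (lattice_quot \<sigma> M L L') = quot_module_proj M L' ` L"
  "x \<oplus>\<^bsub>lattice_quot \<sigma> M L L'\<^esub> y = quot_module_proj M L' (x \<oplus>\<^bsub>M\<^esub> y)"
  "\<zero>\<^bsub>lattice_quot \<sigma> M L L'\<^esub> = quot_module_proj M L' \<zero>\<^bsub>M\<^esub>"
  "a \<odot>\<^bsub>lattice_quot \<sigma> M L L'\<^esub> x = quot_module_proj M L' (\<sigma> a \<odot>\<^bsub>M\<^esub> x)"
  by (simp_all add: lattice_quot_def quot_module_def)

lemma refinement_iff: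
  "refinement \<phi> (L1', L2') (L1, L2) \<longleftrightarrow> L1' \<subseteq> L1 \<and> L2 \<subseteq> L2' \<and> \<phi> ` L1' \<subseteq> L2 \<and> \<phi> ` L1 \<subseteq> L2'"
  by (simp add: refinement_def)

lemma induced_map_eq:
  "induced_map M N \<phi> (L1', L2') (L1, L2) =
    (\<lambda>x\<in>quot_module_proj M L1' ` L1. quot_module_proj N L2 (\<phi> x))"
  by (simp add: induced_map_def quot_module_def)

section \<open>Families of operators\<close>

text \<open>
  \<open>Y\<close> is a two-sided ideal of the category \<open>B\<close> of operators between finite modules. All modules live on
  one type, because an induction hypothesis cannot be polymorphic.
\<close>

definition bt_family ::
    "'k ring \<Rightarrow> 'a ring \<Rightarrow> ('k \<Rightarrow> 'a) \<Rightarrow>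
      (('a, 'b) module \<Rightarrow> ('a, 'b) module \<Rightarrow> ('b \<Rightarrow> 'b) set) \<Rightarrow>
      (('a, 'b) module \<Rightarrow> ('a, 'b) module \<Rightarrow> ('b \<Rightarrow> 'b) set) \<Rightarrow> bool" where
  "bt_family k K \<iota> B Y \<longleftrightarrow>
     (\<forall>M N. finite_module K M \<longrightarrow> finite_module K N \<longrightarrow>
        Y M N \<subseteq> B M N \<and> B M N \<subseteq> Hom_mod k (rest \<iota> M) (rest \<iota> N) \<and> Hom_mod K M N \<subseteq> B M N \<and>
        (\<lambda>x\<in>carrier M. \<zero>\<^bsub>N\<^esub>) \<in> Y M N \<and>
        (\<forall>\<phi>\<in>Y M N. \<forall>\<psi>\<in>Y M N. (\<lambda>x\<in>carrier M. \<phi> x \<oplus>\<^bsub>N\<^esub> \<psi> x) \<in> Y M N)) \<and>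
     (\<forall>M N P. finite_module K M \<longrightarrow> finite_module K N \<longrightarrow> finite_module K P \<longrightarrow>
        (\<forall>\<phi>\<in>Y M N. \<forall>\<psi>\<in>B N P. compose (carrier M) \<psi> \<phi> \<in> Y M P) \<and>
        (\<forall>\<phi>\<in>B M N. \<forall>\<psi>\<in>Y N P. compose (carrier M) \<psi> \<phi> \<in> Y M P))"

lemma bt_familyD:
  assumes "bt_family k K \<iota> B Y" "finite_module K M" "finite_module K N"
  shows "\<And>\<phi>. \<phi> \<in> Y M N \<Longrightarrow> \<phi> \<in> B M N"
    "\<And>\<phi>. \<phi> \<in> B M N \<Longrightarrow> \<phi> \<in> Hom_mod k (rest \<iota> M) (rest \<iota> N)"
    "\<And>\<phi>. \<phi> \<in> Hom_mod K M N \<Longrightarrow> \<phi> \<in> B M N"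
    "(\<lambda>x\<in>carrier M. \<zero>\<^bsub>N\<^esub>) \<in> Y M N"
    "\<And>\<phi> \<psi>. \<phi> \<in> Y M N \<Longrightarrow> \<psi> \<in> Y M N \<Longrightarrow> (\<lambda>x\<in>carrier M. \<phi> x \<oplus>\<^bsub>N\<^esub> \<psi> x) \<in> Y M N"
    "\<And>P \<phi> \<psi>. finite_module K P \<Longrightarrow> \<phi> \<in> Y M N \<Longrightarrow> \<psi> \<in> B N P \<Longrightarrow> compose (carrier M) \<psi> \<phi> \<in> Y M P"
    "\<And>P \<phi> \<psi>. finite_module K P \<Longrightarrow> \<phi> \<in> B M N \<Longrightarrow> \<psi> \<in> Y N P \<Longrightarrow> compose (carrier M) \<psi> \<phi> \<in> Y M P"
  using assms unfolding bt_family_def by (blast+)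

section \<open>The recursion step\<close>

text \<open>
  \<open>S\<close> is a complete discrete valuation ring with fraction field \<open>K\<close>, uniformizer \<open>\<pi>\<close> and residue map \<open>r\<close>,
  which is split by \<open>\<sigma>\<close>.
\<close>

locale bt_step =
  fixes k :: "'k ring" and K :: "'a ring" (structure) and \<iota> :: "'k \<Rightarrow> 'a" and S :: "'a set"
    and \<kappa> :: "'a ring" and r :: "'a \<Rightarrow> 'a" and \<sigma> :: "'a \<Rightarrow> 'a" and \<pi> :: 'a
  assumes field_k: "field k" and field_K: "field K" and field_\<kappa>: "field \<kappa>"
    and subring_S: "subring S K"
    and \<iota>_hom: "\<iota> \<in> ring_hom k K" and \<iota>_S: "\<And>c. c \<in> carrier k \<Longrightarrow> \<iota> c \<in> S"
    and r_hom: "r \<in> ring_hom (sub_ring K S) \<kappa>"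
    and \<sigma>_hom: "\<sigma> \<in> ring_hom \<kappa> (sub_ring K S)"
    and r_\<sigma>: "\<And>a. a \<in> carrier \<kappa> \<Longrightarrow> r (\<sigma> a) = a"
    and \<sigma>_r_\<iota>: "\<And>c. c \<in> carrier k \<Longrightarrow> \<sigma> (r (\<iota> c)) = \<iota> c"
    and \<pi>_S: "\<pi> \<in> S" and \<pi>_nz: "\<pi> \<noteq> \<zero>" and r_\<pi>: "r \<pi> = \<zero>\<^bsub>\<kappa>\<^esub>"
    and r_kernel: "\<And>x. x \<in> S \<Longrightarrow> r x = \<zero>\<^bsub>\<kappa>\<^esub> \<Longrightarrow> \<exists>y\<in>S. x = \<pi> \<otimes> y"
    and exhaust: "\<And>x. x \<in> carrier K \<Longrightarrow> \<exists>n::nat. \<pi> [^] n \<otimes> x \<in> S"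
    and complete: "\<And>x::nat \<Rightarrow> 'a. (\<And>i. x i \<in> S) \<Longrightarrow>
      (\<And>i. \<exists>y\<in>S. x (Suc i) \<ominus> x i = \<pi> [^] i \<otimes> y) \<Longrightarrow>
      \<exists>!z. z \<in> S \<and> (\<forall>i. \<exists>y\<in>S. z \<ominus> x i = \<pi> [^] i \<otimes> y)"
begin

abbreviation "\<O> \<equiv> sub_ring K S"

sublocale K: field K by (rule field_K)
sublocale \<kappa>: field \<kappa> by (rule field_\<kappa>)

section \<open>The valuation ring, its residue field and the lifting\<close>

lemma cring_k: "cring k"
  using field_k by (simp add: field_def domain_def)

lemma S_closed:
  "x \<in> S \<Longrightarrow> x \<in> carrier K" "\<zero> \<in> S" "\<one> \<in> S"
  "x \<in> S \<Longrightarrow> y \<in> S \<Longrightarrow> x \<oplus> y \<in> S" "x \<in> S \<Longrightarrow> y \<in> S \<Longrightarrow> x \<otimes> y \<in> S"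
  "x \<in> S \<Longrightarrow> \<ominus> x \<in> S" "x \<in> S \<Longrightarrow> y \<in> S \<Longrightarrow> x \<ominus> y \<in> S"
  using subringE[OF subring_S] by (auto simp: a_minus_def)

lemma pow_S: "\<pi> [^] (n::nat) \<in> S"
  by (induction n) (auto simp: S_closed \<pi>_S)

lemma pow_K [simp]: "\<pi> [^] (n::nat) \<in> carrier K"
  using pow_S S_closed(1) by blast

lemma \<pi>_K [simp]: "\<pi> \<in> carrier K" using \<pi>_S S_closed(1) by blast

lemma pow_nz: "\<pi> [^] (n::nat) \<noteq> \<zero>"
  by (induction n) (auto simp: \<pi>_nz K.integral_iff)

lemma \<sigma>_props:
  "a \<in> carrier \<kappa> \<Longrightarrow> \<sigma> a \<in> S" "a \<in> carrier \<kappa> \<Longrightarrow> \<sigma> a \<in> carrier K"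
  "a \<in> carrier \<kappa> \<Longrightarrow> b \<in> carrier \<kappa> \<Longrightarrow> \<sigma> (a \<oplus>\<^bsub>\<kappa>\<^esub> b) = \<sigma> a \<oplus> \<sigma> b"
  "a \<in> carrier \<kappa> \<Longrightarrow> b \<in> carrier \<kappa> \<Longrightarrow> \<sigma> (a \<otimes>\<^bsub>\<kappa>\<^esub> b) = \<sigma> a \<otimes> \<sigma> b"
  "\<sigma> \<one>\<^bsub>\<kappa>\<^esub> = \<one>"
  using ring_hom_closed[OF \<sigma>_hom] ring_hom_add[OF \<sigma>_hom] ring_hom_mult[OF \<sigma>_hom]
    ring_hom_one[OF \<sigma>_hom] S_closed(1) by auto

lemma r_props:
  "a \<in> S \<Longrightarrow> r a \<in> carrier \<kappa>"
  "a \<in> S \<Longrightarrow> b \<in> S \<Longrightarrow> r (a \<oplus> b) = r a \<oplus>\<^bsub>\<kappa>\<^esub> r b"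
  "a \<in> S \<Longrightarrow> b \<in> S \<Longrightarrow> r (a \<otimes> b) = r a \<otimes>\<^bsub>\<kappa>\<^esub> r b"
  "r \<one> = \<one>\<^bsub>\<kappa>\<^esub>"
  using ring_hom_closed[OF r_hom] ring_hom_add[OF r_hom] ring_hom_mult[OF r_hom]
    ring_hom_one[OF r_hom] by auto

lemma r_minus:
  assumes "a \<in> S" "b \<in> S"
  shows "r (a \<ominus> b) = r a \<ominus>\<^bsub>\<kappa>\<^esub> r b"
proof -
  have "a = (a \<ominus> b) \<oplus> b"
    using assms S_closed(1) by (simp add: a_minus_def K.a_assoc K.l_neg)
  then have "r a = r (a \<ominus> b) \<oplus>\<^bsub>\<kappa>\<^esub> r b" using r_props(2) assms S_closed by metis
  then show ?thesis using r_props(1) assms S_closed(7) by (simp add: a_minus_def \<kappa>.a_assoc \<kappa>.r_neg)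
qed

abbreviation "\<iota>' \<equiv> r \<circ> \<iota>"

lemma \<iota>'_hom: "\<iota>' \<in> ring_hom k \<kappa>"
  by (rule ring_hom_memI)
    (use \<iota>_S r_props ring_hom_add[OF \<iota>_hom] ring_hom_mult[OF \<iota>_hom] ring_hom_one[OF \<iota>_hom] in auto)

lemma module_O: "module K M \<Longrightarrow> module \<O> M"
  by (rule module_subring[OF _ K.cring_axioms subring_S])

lemma module_\<kappa>: "module \<O> M \<Longrightarrow> module \<kappa> (rest \<sigma> M)"
  by (rule module_rest[OF _ \<kappa>.cring_axioms \<sigma>_hom])

lemma module_k: "module K M \<Longrightarrow> module k (rest \<iota> M)"
  by (rule module_rest[OF _ cring_k \<iota>_hom])

lemma module_k': "module \<kappa> M \<Longrightarrow> module k (rest \<iota>' M)"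
  by (rule module_rest[OF _ cring_k \<iota>'_hom])

subsection \<open>Lattices\<close>

lemma Lat_iff:
  assumes "module K M"
  shows "L \<in> Lat K S M \<longleftrightarrow> submodule L \<O> M \<and>
    (\<exists>G. finite G \<and> generates \<O> (M\<lparr>carrier := L\<rparr>) G) \<and> generates K M L"
proof -
  interpret O: module \<O> M by (rule module_O[OF assms])
  show ?thesis
    using module_carrier_update[OF O.module_axioms] mspan_eq_carrier_iff[OF assms] O.submoduleD(1)
    unfolding Lat_def finite_module_iff by blast
qed

lemma Lat_submodule: "L \<in> Lat K S M \<Longrightarrow> submodule L \<O> M"
  by (simp add: Lat_def)

lemma Lat_sub: "module K M \<Longrightarrow> L \<in> Lat K S M \<Longrightarrow> x \<in> L \<Longrightarrow> x \<in> carrier M"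
  using module.submoduleD(1)[OF module_O Lat_submodule] by blast

lemma Lat_scale:
  assumes "module K M" "L \<in> Lat K S M" "a \<in> carrier K" "a \<noteq> \<zero>"
  shows "(\<lambda>x. a \<odot>\<^bsub>M\<^esub> x) ` L \<in> Lat K S M"
proof -
  interpret M: module K M by fact
  interpret O: module \<O> M by (rule module_O[OF assms(1)])
  note L = Lat_submodule[OF assms(2)]
  have LM: "x \<in> L \<Longrightarrow> x \<in> carrier M" for x using Lat_sub[OF assms(1,2)] .
  have mL: "module \<O> (M\<lparr>carrier := L\<rparr>)" by (rule module_carrier_update[OF O.module_axioms L])
  have h: "(\<lambda>x\<in>L. a \<odot>\<^bsub>M\<^esub> x) \<in> Hom_mod \<O> (M\<lparr>carrier := L\<rparr>) M"
    using O.submoduleD[OF L] assms(3) LM S_closed(1)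
    by (intro Hom_modI) (auto simp: M.smult_r_distr M.smult_assoc1[symmetric] K.m_comm)
  have im: "(\<lambda>x\<in>L. a \<odot>\<^bsub>M\<^esub> x) ` L = (\<lambda>x. a \<odot>\<^bsub>M\<^esub> x) ` L" by simp
  have fin: "finite_module \<O> (M\<lparr>carrier := L\<rparr>)" using assms(2) by (simp add: Lat_def)
  have 1: "submodule ((\<lambda>x. a \<odot>\<^bsub>M\<^esub> x) ` L) \<O> M"
    using submodule_image[OF mL O.module_axioms h module.carrier_is_submodule[OF mL]] im by simp
  moreover have "finite_module \<O> (M\<lparr>carrier := (\<lambda>x. a \<odot>\<^bsub>M\<^esub> x) ` L\<rparr>)"
    using finite_module_image[OF fin O.module_axioms h] im by simp
  moreover have "generates K M ((\<lambda>x. a \<odot>\<^bsub>M\<^esub> x) ` L)"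
    unfolding generates_def
  proof (intro conjI allI impI)
    show "(\<lambda>x. a \<odot>\<^bsub>M\<^esub> x) ` L \<subseteq> carrier M" using LM assms(3) by auto
    fix W assume W: "submodule W K M" "(\<lambda>x. a \<odot>\<^bsub>M\<^esub> x) ` L \<subseteq> W"
    have "L \<subseteq> W"
    proof
      fix x assume x: "x \<in> L"
      have i: "inv\<^bsub>K\<^esub> a \<in> carrier K" "inv\<^bsub>K\<^esub> a \<otimes> a = \<one>" using assms(3,4) K.field_Units by auto
      have "inv\<^bsub>K\<^esub> a \<odot>\<^bsub>M\<^esub> (a \<odot>\<^bsub>M\<^esub> x) \<in> W" using W x M.submoduleD(4)[OF W(1) i(1)] by auto
      then show "x \<in> W" using i LM[OF x] assms(3) by (simp add: M.smult_assoc1[symmetric])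
    qed
    then show "carrier M \<subseteq> W" using assms(2) W(1) by (auto simp: Lat_iff[OF assms(1)] generates_def)
  qed
  ultimately show ?thesis
    using Lat_iff[OF assms(1)] by (simp add: finite_module_iff)
qed

text \<open>The elements of \<open>N\<close> that some power of \<open>\<pi>\<close> moves into
  \<open>L'\<close> form a \<open>K\<close>-submodule, since denominators are cleared by powers of
  \<open>\<pi>\<close>. It contains \<open>L'\<close> and is therefore everything. Finitely many
  generators of \<open>L\<close> then share an exponent.\<close>

lemma Lat_absorb:
  assumes "module K M" "module K N" "\<phi> \<in> Hom_mod K M N" "L \<in> Lat K S M" "L' \<in> Lat K S N"
  shows "\<exists>n::nat. \<forall>x\<in>L. \<pi> [^] n \<odot>\<^bsub>N\<^esub> \<phi> x \<in> L'"
proof -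
  interpret M: module K M by fact
  interpret N: module K N by fact
  interpret OM: module \<O> M by (rule module_O[OF assms(1)])
  interpret ON: module \<O> N by (rule module_O[OF assms(2)])
  note L = Lat_submodule[OF assms(4)]
  note l' = ON.submoduleD[OF Lat_submodule[OF assms(5)]]
  have mono: "\<pi> [^] (n + m) \<odot>\<^bsub>N\<^esub> y \<in> L'" if "\<pi> [^] n \<odot>\<^bsub>N\<^esub> y \<in> L'" "y \<in> carrier N" for n m :: nat and y
  proof -
    have "\<pi> [^] (n + m) \<odot>\<^bsub>N\<^esub> y = \<pi> [^] m \<odot>\<^bsub>N\<^esub> (\<pi> [^] n \<odot>\<^bsub>N\<^esub> y)"
      using that(2) by (simp add: N.smult_assoc1[symmetric] K.nat_pow_mult add.commute)
    then show ?thesis using l'(4)[of "\<pi> [^] m"] that(1) pow_S by simp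
  qed
  let ?V = "{y \<in> carrier N. \<exists>n::nat. \<pi> [^] n \<odot>\<^bsub>N\<^esub> y \<in> L'}"
  have "submodule ?V K N"
  proof (rule N.submoduleI')
    show "\<zero>\<^bsub>N\<^esub> \<in> ?V" using l'(2) by auto
    fix x y assume "x \<in> ?V" "y \<in> ?V"
    then obtain n m :: nat where *: "x \<in> carrier N" "y \<in> carrier N"
      "\<pi> [^] n \<odot>\<^bsub>N\<^esub> x \<in> L'" "\<pi> [^] m \<odot>\<^bsub>N\<^esub> y \<in> L'" by auto
    then have "\<pi> [^] (n + m) \<odot>\<^bsub>N\<^esub> (x \<oplus>\<^bsub>N\<^esub> y) \<in> L'"
      using l'(3) mono[of n x m] mono[of m y n] by (simp add: N.smult_r_distr add.commute)
    then show "x \<oplus>\<^bsub>N\<^esub> y \<in> ?V" using * by blast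
  next
    fix a x assume a: "a \<in> carrier K" and "x \<in> ?V"
    then obtain n :: nat where *: "x \<in> carrier N" "\<pi> [^] n \<odot>\<^bsub>N\<^esub> x \<in> L'" by auto
    obtain m :: nat where m: "\<pi> [^] m \<otimes> a \<in> S" using exhaust[OF a] by blast
    have "\<pi> [^] (m + n) \<odot>\<^bsub>N\<^esub> (a \<odot>\<^bsub>N\<^esub> x) = (\<pi> [^] m \<otimes> a) \<odot>\<^bsub>N\<^esub> (\<pi> [^] n \<odot>\<^bsub>N\<^esub> x)"
      using a *(1) by (simp add: N.smult_assoc1[symmetric] K.nat_pow_mult[symmetric] K.m_ac)
    then have "\<pi> [^] (m + n) \<odot>\<^bsub>N\<^esub> (a \<odot>\<^bsub>N\<^esub> x) \<in> L'" using l'(4) m *(2) by simp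
    then show "a \<odot>\<^bsub>N\<^esub> x \<in> ?V" using a *(1) by blast
  qed auto
  moreover have "L' \<subseteq> ?V"
  proof
    fix y assume y: "y \<in> L'"
    then have "\<pi> [^] (0::nat) \<odot>\<^bsub>N\<^esub> y \<in> L'" using l'(1) by auto
    then show "y \<in> ?V" using y l'(1) by blast
  qed
  ultimately have V: "\<exists>n::nat. \<pi> [^] n \<odot>\<^bsub>N\<^esub> y \<in> L'" if "y \<in> carrier N" for y
    using assms(5) that unfolding Lat_iff[OF assms(2)] generates_def by blast
  obtain G where G: "finite G" "generates \<O> (M\<lparr>carrier := L\<rparr>) G"
    using assms(4) unfolding Lat_iff[OF assms(1)] by blast
  have GL: "G \<subseteq> L" using G(2) by (simp add: generates_def)
  have LM: "x \<in> L \<Longrightarrow> x \<in> carrier M" for x using Lat_sub[OF assms(1,4)] .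
  have "\<exists>n::nat. \<forall>g\<in>G. \<pi> [^] n \<odot>\<^bsub>N\<^esub> \<phi> g \<in> L'" using G(1) GL
  proof (induction G rule: finite_induct)
    case (insert g G)
    then obtain n m :: nat where *: "\<forall>g\<in>G. \<pi> [^] n \<odot>\<^bsub>N\<^esub> \<phi> g \<in> L'" "\<pi> [^] m \<odot>\<^bsub>N\<^esub> \<phi> g \<in> L'"
      using V[of "\<phi> g"] Hom_modD(1)[OF assms(3)] LM by auto
    then have "\<forall>h\<in>insert g G. \<pi> [^] (n + m) \<odot>\<^bsub>N\<^esub> \<phi> h \<in> L'"
      using mono[of n _ m] mono[of m _ n] Hom_modD(1)[OF assms(3)] LM insert.prems by (auto simp: add.commute)
    then show ?case by blast
  qed simp
  then obtain n :: nat where n: "\<forall>g\<in>G. \<pi> [^] n \<odot>\<^bsub>N\<^esub> \<phi> g \<in> L'" by blast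
  have mL: "module \<O> (M\<lparr>carrier := L\<rparr>)" by (rule module_carrier_update[OF OM.module_axioms L])
  have "submodule {x \<in> L. \<pi> [^] n \<odot>\<^bsub>N\<^esub> \<phi> x \<in> L'} \<O> (M\<lparr>carrier := L\<rparr>)"
  proof (rule module.submoduleI'[OF mL])
    show "\<zero>\<^bsub>M\<lparr>carrier := L\<rparr>\<^esub> \<in> {x \<in> L. \<pi> [^] n \<odot>\<^bsub>N\<^esub> \<phi> x \<in> L'}"
      using OM.submoduleD(2)[OF L] l'(2)
        Hom_mod_zero[OF M.abelian_group_axioms N.abelian_group_axioms assms(3)] by simp
    fix x y assume "x \<in> {x \<in> L. \<pi> [^] n \<odot>\<^bsub>N\<^esub> \<phi> x \<in> L'}" "y \<in> {x \<in> L. \<pi> [^] n \<odot>\<^bsub>N\<^esub> \<phi> x \<in> L'}"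
    then show "x \<oplus>\<^bsub>M\<lparr>carrier := L\<rparr>\<^esub> y \<in> {x \<in> L. \<pi> [^] n \<odot>\<^bsub>N\<^esub> \<phi> x \<in> L'}"
      using OM.submoduleD(3)[OF L] LM Hom_modD[OF assms(3)] l'(3) by (simp add: N.smult_r_distr)
  next
    fix a x assume a: "a \<in> carrier \<O>" and x: "x \<in> {x \<in> L. \<pi> [^] n \<odot>\<^bsub>N\<^esub> \<phi> x \<in> L'}"
    have aK: "a \<in> carrier K" using a S_closed(1) by simp
    have "\<pi> [^] n \<odot>\<^bsub>N\<^esub> \<phi> (a \<odot>\<^bsub>M\<^esub> x) = a \<odot>\<^bsub>N\<^esub> (\<pi> [^] n \<odot>\<^bsub>N\<^esub> \<phi> x)"
      using aK x LM Hom_modD(1,3)[OF assms(3)] by (simp add: N.smult_assoc1[symmetric] K.m_comm)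
    then show "a \<odot>\<^bsub>M\<lparr>carrier := L\<rparr>\<^esub> x \<in> {x \<in> L. \<pi> [^] n \<odot>\<^bsub>N\<^esub> \<phi> x \<in> L'}"
      using a x l'(4) OM.submoduleD(4)[OF L] by simp
  qed auto
  moreover have "G \<subseteq> {x \<in> L. \<pi> [^] n \<odot>\<^bsub>N\<^esub> \<phi> x \<in> L'}" using n GL by auto
  ultimately have "L \<subseteq> {x \<in> L. \<pi> [^] n \<odot>\<^bsub>N\<^esub> \<phi> x \<in> L'}" using G(2) unfolding generates_def by simp
  then show ?thesis by blast
qed

text \<open>One half of the refinement property for \<open>K\<close>-linear maps. For the identity
  it says that any two lattices have a common smaller one.\<close>

lemma Lat_below:
  assumes "module K M" "module K N" "\<phi> \<in> Hom_mod K M N" "L \<in> Lat K S M" "L' \<in> Lat K S N"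
  obtains L1 where "L1 \<in> Lat K S M" "L1 \<subseteq> L" "\<phi> ` L1 \<subseteq> L'"
proof -
  interpret OM: module \<O> M by (rule module_O[OF assms(1)])
  obtain n :: nat where n: "\<And>x. x \<in> L \<Longrightarrow> \<pi> [^] n \<odot>\<^bsub>N\<^esub> \<phi> x \<in> L'" using Lat_absorb[OF assms] by blast
  show ?thesis
  proof
    show "(\<lambda>x. \<pi> [^] n \<odot>\<^bsub>M\<^esub> x) ` L \<in> Lat K S M"
      by (rule Lat_scale[OF assms(1,4) pow_K pow_nz])
    show "(\<lambda>x. \<pi> [^] n \<odot>\<^bsub>M\<^esub> x) ` L \<subseteq> L"
      using OM.submoduleD(4)[OF Lat_submodule[OF assms(4)]] pow_S by auto
    show "\<phi> ` (\<lambda>x. \<pi> [^] n \<odot>\<^bsub>M\<^esub> x) ` L \<subseteq> L'"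
      using n Hom_modD(3)[OF assms(3) pow_K] Lat_sub[OF assms(1,4)] by auto
  qed
qed

text \<open>The other half: instead of shrinking the source by \<open>\<pi>^n\<close>, the target is
  enlarged by \<open>\<pi>^-n\<close>.\<close>

lemma Lat_above:
  assumes "module K M" "module K N" "\<phi> \<in> Hom_mod K M N" "L \<in> Lat K S M" "L' \<in> Lat K S N"
  obtains L1 where "L1 \<in> Lat K S N" "L' \<subseteq> L1" "\<phi> ` L \<subseteq> L1"
proof -
  interpret N: module K N by fact
  interpret ON: module \<O> N by (rule module_O[OF assms(2)])
  obtain n :: nat where n: "\<And>x. x \<in> L \<Longrightarrow> \<pi> [^] n \<odot>\<^bsub>N\<^esub> \<phi> x \<in> L'" using Lat_absorb[OF assms] by blast
  define a where "a = inv\<^bsub>K\<^esub> (\<pi> [^] n)"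
  have a: "a \<in> carrier K" "a \<noteq> \<zero>" "a \<otimes> \<pi> [^] n = \<one>"
  proof -
    have "\<pi> [^] n \<in> Units K" using pow_nz[of n] pow_K[of n] K.field_Units by simp
    then show "a \<in> carrier K" "a \<otimes> \<pi> [^] n = \<one>" by (simp_all add: a_def)
    then show "a \<noteq> \<zero>" by auto
  qed
  have *: "a \<odot>\<^bsub>N\<^esub> (\<pi> [^] n \<odot>\<^bsub>N\<^esub> y) = y" if "y \<in> carrier N" for y
    using that a by (simp add: N.smult_assoc1[symmetric])
  show ?thesis
  proof
    show "(\<lambda>x. a \<odot>\<^bsub>N\<^esub> x) ` L' \<in> Lat K S N"
      by (rule Lat_scale[OF assms(2,5) a(1,2)])
    show "L' \<subseteq> (\<lambda>x. a \<odot>\<^bsub>N\<^esub> x) ` L'"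
    proof
      fix y assume y: "y \<in> L'"
      then have "\<pi> [^] n \<odot>\<^bsub>N\<^esub> y \<in> L'"
        using ON.submoduleD(4)[OF Lat_submodule[OF assms(5)]] pow_S by simp
      then show "y \<in> (\<lambda>x. a \<odot>\<^bsub>N\<^esub> x) ` L'"
        using *[OF Lat_sub[OF assms(2,5) y]] by (metis imageI)
    qed
    show "\<phi> ` L \<subseteq> (\<lambda>x. a \<odot>\<^bsub>N\<^esub> x) ` L'"
    proof
      fix y assume "y \<in> \<phi> ` L"
      then obtain x where x: "x \<in> L" "y = \<phi> x" by auto
      then have "y \<in> carrier N" using Hom_modD(1)[OF assms(3)] Lat_sub[OF assms(1,4)] by auto
      then show "y \<in> (\<lambda>x. a \<odot>\<^bsub>N\<^esub> x) ` L'" using *[of y] n[OF x(1)] x(2) by (metis imageI)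
    qed
  qed
qed

lemma Lat_exists:
  assumes "finite_module K M"
  obtains L where "L \<in> Lat K S M"
proof -
  interpret M: module K M using assms by (rule finite_module_is_module)
  interpret OM: module \<O> M by (rule module_O[OF M.module_axioms])
  obtain G where G: "finite G" "generates K M G" using assms by (auto simp: finite_module_iff)
  have GM: "G \<subseteq> carrier M" using G(2) by (simp add: generates_def)
  let ?L = "mspan \<O> M G"
  have L: "submodule ?L \<O> M" by (rule submodule_mspan[OF OM.module_axioms GM])
  have GL: "G \<subseteq> ?L" by (auto simp: mspan_def)
  have mL: "module \<O> (M\<lparr>carrier := ?L\<rparr>)" by (rule module_carrier_update[OF OM.module_axioms L])
  have "generates \<O> (M\<lparr>carrier := ?L\<rparr>) G"
    unfolding generates_def
  proof (intro conjI allI impI)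
    show "G \<subseteq> carrier (M\<lparr>carrier := ?L\<rparr>)" using GL by simp
    fix W assume W: "submodule W \<O> (M\<lparr>carrier := ?L\<rparr>)" "G \<subseteq> W"
    have "submodule W \<O> M"
      using W(1) OM.submoduleD(1)[OF L] by (auto simp: module.submodule_iff[OF mL] OM.submodule_iff)
    then show "carrier (M\<lparr>carrier := ?L\<rparr>) \<subseteq> W" using W(2) by (auto simp: mspan_def)
  qed
  moreover have "generates K M ?L"
    using G(2) GL OM.submoduleD(1)[OF L] unfolding generates_def by blast
  ultimately have "?L \<in> Lat K S M" using L G(1) unfolding Lat_iff[OF M.module_axioms] by blast
  then show ?thesis by (rule that)
qed

subsection \<open>Quotients of lattices\<close>

text \<open>Replacing an element of \<open>L\<close> by its representative changes it by an element
  of \<open>L'\<close>, and these errors are respected by addition and by the scalars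
  \<open>\<sigma> a\<close>, which lie in \<open>S\<close>.\<close>

lemma lattice_quot_proj:
  assumes "module K M" "submodule L \<O> M" "submodule L' \<O> M" "L' \<subseteq> L"
  shows "(\<lambda>x\<in>L. quot_module_proj M L' x) \<in> Hom_mod \<kappa> (rest \<sigma> (M\<lparr>carrier := L\<rparr>)) (lattice_quot \<sigma> M L L')"
    and "module \<kappa> (lattice_quot \<sigma> M L L')"
proof -
  interpret M: module K M by fact
  interpret OM: module \<O> M by (rule module_O[OF assms(1)])
  note l = OM.submoduleD[OF assms(2)] and l' = OM.submoduleD[OF assms(3)]
  have LM: "x \<in> L \<Longrightarrow> x \<in> carrier M" for x using l(1) by auto
  let ?p = "quot_module_proj M L'"
  have p: "?p x \<in> L" "?p x \<ominus>\<^bsub>M\<^esub> x \<in> L'" if "x \<in> L" for x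
  proof -
    have "x \<in> carrier M" using LM that .
    then obtain n where n: "n \<in> L'" "?p x = n \<oplus>\<^bsub>M\<^esub> x"
      using quot_module_proj_mem[OF OM.module_axioms assms(3)] by blast
    then show "?p x \<in> L" using l(3) that assms(4) by auto
    have "n \<in> carrier M" using n l'(1) by blast
    then have "?p x \<ominus>\<^bsub>M\<^esub> x = n" using n(2) LM[OF that] by (simp add: a_minus_def M.M.a_assoc M.M.r_neg)
    then show "?p x \<ominus>\<^bsub>M\<^esub> x \<in> L'" using n by simp
  qed
  note eq = quot_module_proj_eq_iff[OF OM.module_axioms assms(3)]
  have add: "?p (?p x \<oplus>\<^bsub>M\<^esub> ?p y) = ?p (x \<oplus>\<^bsub>M\<^esub> y)" if xy: "x \<in> L" "y \<in> L" for x y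
  proof -
    have "(?p x \<oplus>\<^bsub>M\<^esub> ?p y) \<ominus>\<^bsub>M\<^esub> (x \<oplus>\<^bsub>M\<^esub> y) = (?p x \<ominus>\<^bsub>M\<^esub> x) \<oplus>\<^bsub>M\<^esub> (?p y \<ominus>\<^bsub>M\<^esub> y)"
      using p(1) xy LM by (simp add: a_minus_def M.M.minus_add M.M.a_ac)
    then show ?thesis using eq p xy LM l'(3) by simp
  qed
  have smult: "?p (\<sigma> a \<odot>\<^bsub>M\<^esub> ?p x) = ?p (\<sigma> a \<odot>\<^bsub>M\<^esub> x)" if ax: "a \<in> carrier \<kappa>" "x \<in> L" for a x
  proof -
    have "\<sigma> a \<odot>\<^bsub>M\<^esub> ?p x \<ominus>\<^bsub>M\<^esub> \<sigma> a \<odot>\<^bsub>M\<^esub> x = \<sigma> a \<odot>\<^bsub>M\<^esub> (?p x \<ominus>\<^bsub>M\<^esub> x)"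
      using p(1) ax LM \<sigma>_props by (simp add: a_minus_def M.smult_r_distr M.smult_r_minus)
    then show ?thesis using eq p ax LM l'(4) \<sigma>_props by simp
  qed
  have mL: "module \<kappa> (rest \<sigma> (M\<lparr>carrier := L\<rparr>))"
    by (rule module_\<kappa>[OF module_carrier_update[OF OM.module_axioms assms(2)]])
  show "module \<kappa> (lattice_quot \<sigma> M L L')"
    by (rule module_of_surj[OF mL, of _ ?p]) (auto simp: add smult)
  show "(\<lambda>x\<in>L. ?p x) \<in> Hom_mod \<kappa> (rest \<sigma> (M\<lparr>carrier := L\<rparr>)) (lattice_quot \<sigma> M L L')"
    by (rule Hom_modI) (auto simp: add smult l(3,4) \<sigma>_props)
qed

lemma quot_mem:
  assumes "module K M" "submodule L \<O> M" "submodule L' \<O> M" "L' \<subseteq> L" "x \<in> L"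
  shows "quot_module_proj M L' x \<in> L"
proof -
  interpret OM: module \<O> M by (rule module_O[OF assms(1)])
  note l = OM.submoduleD[OF assms(2)]
  obtain n where n: "n \<in> L'" "quot_module_proj M L' x = n \<oplus>\<^bsub>M\<^esub> x"
    using quot_module_proj_mem[OF OM.module_axioms assms(3)] assms(5) l(1) by blast
  then show ?thesis using l(3) assms(4,5) by auto
qed

lemma quot_eq_iff:
  assumes "module K M" "submodule L \<O> M" "x \<in> carrier M" "y \<in> carrier M"
  shows "quot_module_proj M L x = quot_module_proj M L y \<longleftrightarrow> x \<ominus>\<^bsub>M\<^esub> y \<in> L"
  using quot_module_proj_eq_iff[OF module_O[OF assms(1)] assms(2-4)] .

text \<open>Some power \<open>\<pi>^N\<close> sends \<open>L\<close> into \<open>L'\<close>. Every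
  \<open>a\<close> in \<open>S\<close> is \<open>\<sigma> (r a) + \<pi> b\<close>, so over the
  residue field the classes of \<open>\<pi>^m g\<close>, with m < N and \<open>g\<close> from a set
  of generators of \<open>L\<close>, generate the quotient.\<close>

lemma finite_lattice_quot:
  assumes "module K M" "L \<in> Lat K S M" "L' \<in> Lat K S M" "L' \<subseteq> L"
  shows "finite_module \<kappa> (lattice_quot \<sigma> M L L')"
proof -
  interpret M: module K M by fact
  interpret OM: module \<O> M by (rule module_O[OF assms(1)])
  note sL = Lat_submodule[OF assms(2)] and sL' = Lat_submodule[OF assms(3)]
  note l = OM.submoduleD[OF sL] and l' = OM.submoduleD[OF sL']
  have LM: "x \<in> L \<Longrightarrow> x \<in> carrier M" for x using l(1) by auto
  note proj = lattice_quot_proj[OF assms(1) sL sL' assms(4)]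
  interpret Q: module \<kappa> "lattice_quot \<sigma> M L L'" by (rule proj(2))
  define p where "p = (\<lambda>x\<in>L. quot_module_proj M L' x)"
  note hp = proj(1)[folded p_def]
  have mL: "module \<O> (M\<lparr>carrier := L\<rparr>)" by (rule module_carrier_update[OF OM.module_axioms sL])
  note mL\<kappa> = module_\<kappa>[OF mL]
  have pLQ: "p ` L = carrier (lattice_quot \<sigma> M L L')" by (auto simp: p_def)
  have p_add: "p (x \<oplus>\<^bsub>M\<^esub> y) = p x \<oplus>\<^bsub>lattice_quot \<sigma> M L L'\<^esub> p y" if "x \<in> L" "y \<in> L" for x y
    using Hom_modD(2)[OF hp, of x y] that by simp
  have p_smult: "p (\<sigma> a \<odot>\<^bsub>M\<^esub> x) = a \<odot>\<^bsub>lattice_quot \<sigma> M L L'\<^esub> p x" if "x \<in> L" "a \<in> carrier \<kappa>" for x a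
    using Hom_modD(3)[OF hp, of a x] that by simp
  have p_zero: "p x = \<zero>\<^bsub>lattice_quot \<sigma> M L L'\<^esub>" if "x \<in> L'" for x
  proof -
    have x: "x \<in> carrier M" "x \<in> L" using that assms(4) l'(1) by auto
    then have "x \<ominus>\<^bsub>M\<^esub> \<zero>\<^bsub>M\<^esub> = x" by (simp add: a_minus_def)
    then show ?thesis using quot_eq_iff[OF assms(1) sL' x(1), of "\<zero>\<^bsub>M\<^esub>"] that x by (simp add: p_def)
  qed
  obtain N :: nat where N: "\<And>x. x \<in> L \<Longrightarrow> \<pi> [^] N \<odot>\<^bsub>M\<^esub> (\<lambda>x\<in>carrier M. x) x \<in> L'"
    using Lat_absorb[OF assms(1,1) Hom_mod_id[OF assms(1)] assms(2,3)] by blast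
  have big: "p (\<pi> [^] m \<odot>\<^bsub>M\<^esub> x) = \<zero>\<^bsub>lattice_quot \<sigma> M L L'\<^esub>" if "x \<in> L" "N \<le> m" for x and m :: nat
  proof -
    have "\<pi> [^] m \<odot>\<^bsub>M\<^esub> x = \<pi> [^] (m - N) \<odot>\<^bsub>M\<^esub> (\<pi> [^] N \<odot>\<^bsub>M\<^esub> x)"
      using that LM by (simp add: M.smult_assoc1[symmetric] K.nat_pow_mult)
    moreover have "\<pi> [^] (m - N) \<odot>\<^bsub>M\<^esub> (\<pi> [^] N \<odot>\<^bsub>M\<^esub> x) \<in> L'"
      using N[OF that(1)] that(1) LM l'(4) pow_S by simp
    ultimately show ?thesis using p_zero by simp
  qed
  have piL: "\<pi> [^] m \<odot>\<^bsub>M\<^esub> x \<in> L" if "x \<in> L" for x and m :: nat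
    using l(4) pow_S that by simp
  obtain G where G: "finite G" "generates \<O> (M\<lparr>carrier := L\<rparr>) G"
    using assms(2) unfolding Lat_iff[OF assms(1)] by blast
  have GL: "G \<subseteq> L" using G(2) by (simp add: generates_def)
  let ?T = "(\<lambda>(m, g). p (\<pi> [^] m \<odot>\<^bsub>M\<^esub> g)) ` ({..<N} \<times> G)"
  have "generates \<kappa> (lattice_quot \<sigma> M L L') ?T"
    unfolding generates_def
  proof (intro conjI allI impI)
    show "?T \<subseteq> carrier (lattice_quot \<sigma> M L L')"
      using GL piL unfolding pLQ[symmetric] by auto
    fix W assume W: "submodule W \<kappa> (lattice_quot \<sigma> M L L')" "?T \<subseteq> W"
    note w = Q.submoduleD[OF W(1)]
    \<comment> \<open>\<open>W\<close> is stable only under the residue field. Requiring all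
      multiples by powers of \<open>\<pi>\<close> to land in \<open>W\<close> gives a submodule over
      the valuation ring.\<close>
    let ?U = "{x \<in> L. \<forall>m::nat. p (\<pi> [^] m \<odot>\<^bsub>M\<^esub> x) \<in> W}"
    have "submodule ?U \<O> (M\<lparr>carrier := L\<rparr>)"
    proof (rule module.submoduleI'[OF mL])
      show "\<zero>\<^bsub>M\<lparr>carrier := L\<rparr>\<^esub> \<in> ?U" using l(2) l'(2) p_zero[of "\<zero>\<^bsub>M\<^esub>"] w(2) by simp
      show "x \<oplus>\<^bsub>M\<lparr>carrier := L\<rparr>\<^esub> y \<in> ?U" if "x \<in> ?U" "y \<in> ?U" for x y
        using that l(3) LM piL w(3) by (auto simp: M.smult_r_distr p_add simp del: lattice_quot_simps)
      fix a x assume a: "a \<in> carrier \<O>" and x: "x \<in> ?U"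
      have aS: "a \<in> S" using a by simp
      \<comment> \<open>Downward induction on \<open>m\<close>: from \<open>N\<close> on all classes
        vanish, and below \<open>N\<close> splitting off the leading digit of \<open>a\<close>
        leaves a multiple of the next power of \<open>\<pi>\<close>.\<close>
      have "p (\<pi> [^] m \<odot>\<^bsub>M\<^esub> (a \<odot>\<^bsub>M\<^esub> x)) \<in> W" if "a \<in> S" for a and m :: nat
        using that
      proof (induction "N - m" arbitrary: m a)
        case 0
        then have "a \<odot>\<^bsub>M\<^esub> x \<in> L" using x l(4) by auto
        then show ?case using big 0 w(2) by simp
      next
        case (Suc d)
        have sr: "r a \<in> carrier \<kappa>" "\<sigma> (r a) \<in> S" using Suc.prems r_props \<sigma>_props by auto
        have "r (a \<ominus> \<sigma> (r a)) = \<zero>\<^bsub>\<kappa>\<^esub>"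
          using Suc.prems sr by (simp add: r_minus r_\<sigma> \<kappa>.minus_eq_zero_iff)
        then obtain b where b: "b \<in> S" "a \<ominus> \<sigma> (r a) = \<pi> \<otimes> b"
          using r_kernel[OF S_closed(7)[OF Suc.prems sr(2)]] by blast
        have c: "a \<in> carrier K" "b \<in> carrier K" "\<sigma> (r a) \<in> carrier K" "x \<in> carrier M" "x \<in> L"
          using Suc.prems b(1) sr S_closed(1) x LM by auto
        have "a = \<sigma> (r a) \<oplus> \<pi> \<otimes> b"
          unfolding b(2)[symmetric] using c(1,3) by (simp add: a_minus_def K.a_comm[of a] K.r_neg2)
        then have "\<pi> [^] m \<odot>\<^bsub>M\<^esub> (a \<odot>\<^bsub>M\<^esub> x) = \<pi> [^] m \<odot>\<^bsub>M\<^esub> ((\<sigma> (r a) \<oplus> \<pi> \<otimes> b) \<odot>\<^bsub>M\<^esub> x)" by simp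
        also have "\<dots> = \<sigma> (r a) \<odot>\<^bsub>M\<^esub> (\<pi> [^] m \<odot>\<^bsub>M\<^esub> x) \<oplus>\<^bsub>M\<^esub> \<pi> [^] Suc m \<odot>\<^bsub>M\<^esub> (b \<odot>\<^bsub>M\<^esub> x)"
          using c by (simp add: M.smult_l_distr M.smult_r_distr M.smult_assoc1[symmetric] K.m_ac)
        finally have *: "\<pi> [^] m \<odot>\<^bsub>M\<^esub> (a \<odot>\<^bsub>M\<^esub> x) =
          \<sigma> (r a) \<odot>\<^bsub>M\<^esub> (\<pi> [^] m \<odot>\<^bsub>M\<^esub> x) \<oplus>\<^bsub>M\<^esub> \<pi> [^] Suc m \<odot>\<^bsub>M\<^esub> (b \<odot>\<^bsub>M\<^esub> x)" .
        have L: "\<sigma> (r a) \<odot>\<^bsub>M\<^esub> (\<pi> [^] m \<odot>\<^bsub>M\<^esub> x) \<in> L" "\<pi> [^] Suc m \<odot>\<^bsub>M\<^esub> (b \<odot>\<^bsub>M\<^esub> x) \<in> L"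
          using l(4)[of "\<sigma> (r a)"] l(4)[of b x] piL[of x m] piL[of "b \<odot>\<^bsub>M\<^esub> x" "Suc m"] c sr b by auto
        have "p (\<pi> [^] Suc m \<odot>\<^bsub>M\<^esub> (b \<odot>\<^bsub>M\<^esub> x)) \<in> W" using Suc.hyps(1)[of "Suc m" b] Suc.hyps(2) b(1) by simp
        moreover have "p (\<sigma> (r a) \<odot>\<^bsub>M\<^esub> (\<pi> [^] m \<odot>\<^bsub>M\<^esub> x)) \<in> W"
          using p_smult[OF piL[OF c(5)] sr(1)] w(4)[OF sr(1)] x by auto
        ultimately show ?case unfolding * p_add[OF L] by (intro w(3))
      qed
      then show "a \<odot>\<^bsub>M\<lparr>carrier := L\<rparr>\<^esub> x \<in> ?U" using aS x l(4) by simp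
    qed auto
    moreover have "G \<subseteq> ?U"
    proof
      fix g assume g: "g \<in> G"
      have "p (\<pi> [^] m \<odot>\<^bsub>M\<^esub> g) \<in> W" for m :: nat
      proof (cases "m < N")
        case True
        then have "p (\<pi> [^] m \<odot>\<^bsub>M\<^esub> g) \<in> ?T" using g by (intro image_eqI[of _ _ "(m, g)"]) auto
        then show ?thesis using W(2) by blast
      qed (use big[of g m] g GL w(2) in auto)
      then show "g \<in> ?U" using g GL by auto
    qed
    ultimately have "L \<subseteq> ?U" using G(2) unfolding generates_def by simp
    then have "p x \<in> W" if "x \<in> L" for x
      using that LM[OF that] by (auto dest!: subsetD spec[of _ 0])
    then show "carrier (lattice_quot \<sigma> M L L') \<subseteq> W" unfolding pLQ[symmetric] by blast
  qed
  moreover have "finite ?T" using G(1) by simp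
  ultimately show ?thesis using Q.module_axioms unfolding finite_module_iff by (intro conjI exI[of _ ?T])
qed

subsection \<open>Induced maps\<close>

text \<open>\<open>refinement\<close> compares sets only. Bundling it with the modules, the
  linearity and the lattice conditions lets a single fact carry all hypotheses about an induced
  map.\<close>

definition refines where
  "refines M N \<phi> L1' L2' L1 L2 \<longleftrightarrow> module K M \<and> module K N \<and> \<phi> \<in> Hom_mod k (rest \<iota> M) (rest \<iota> N) \<and>
     L1' \<in> Lat K S M \<and> L1 \<in> Lat K S M \<and> L2' \<in> Lat K S N \<and> L2 \<in> Lat K S N \<and>
     refinement \<phi> (L1', L2') (L1, L2)"

lemma refinesD:
  assumes "refines M N \<phi> L1' L2' L1 L2"
  shows "module K M" "module K N" "\<phi> \<in> Hom_mod k (rest \<iota> M) (rest \<iota> N)"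
    "L1' \<in> Lat K S M" "L1 \<in> Lat K S M" "L2' \<in> Lat K S N" "L2 \<in> Lat K S N"
    "L1' \<subseteq> L1" "L2 \<subseteq> L2'" "\<And>x. x \<in> L1' \<Longrightarrow> \<phi> x \<in> L2" "\<And>x. x \<in> L1 \<Longrightarrow> \<phi> x \<in> L2'"
  using assms by (auto simp: refines_def refinement_iff)

lemma refinesI:
  assumes "module K M" "module K N" "\<phi> \<in> Hom_mod k (rest \<iota> M) (rest \<iota> N)"
    "L1' \<in> Lat K S M" "L1 \<in> Lat K S M" "L2' \<in> Lat K S N" "L2 \<in> Lat K S N"
    "L1' \<subseteq> L1" "L2 \<subseteq> L2'" "\<And>x. x \<in> L1' \<Longrightarrow> \<phi> x \<in> L2" "\<And>x. x \<in> L1 \<Longrightarrow> \<phi> x \<in> L2'"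
  shows "refines M N \<phi> L1' L2' L1 L2"
  using assms by (auto simp: refines_def refinement_iff)

lemma Hom_k_props:
  assumes "module K M" "module K N" "\<phi> \<in> Hom_mod k (rest \<iota> M) (rest \<iota> N)"
  shows "x \<in> carrier M \<Longrightarrow> \<phi> x \<in> carrier N"
    "x \<in> carrier M \<Longrightarrow> y \<in> carrier M \<Longrightarrow> \<phi> (x \<oplus>\<^bsub>M\<^esub> y) = \<phi> x \<oplus>\<^bsub>N\<^esub> \<phi> y"
    "c \<in> carrier k \<Longrightarrow> x \<in> carrier M \<Longrightarrow> \<phi> (\<iota> c \<odot>\<^bsub>M\<^esub> x) = \<iota> c \<odot>\<^bsub>N\<^esub> \<phi> x"
    "\<phi> \<zero>\<^bsub>M\<^esub> = \<zero>\<^bsub>N\<^esub>"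
    "x \<in> carrier M \<Longrightarrow> y \<in> carrier M \<Longrightarrow> \<phi> (x \<ominus>\<^bsub>M\<^esub> y) = \<phi> x \<ominus>\<^bsub>N\<^esub> \<phi> y"
    "\<phi> \<in> extensional (carrier M)"
proof -
  interpret M: module K M by fact
  interpret N: module K N by fact
  have e: "abelian_group (rest \<iota> M)" "abelian_group (rest \<iota> N)"
    using module_k assms(1,2) module.axioms(2) by blast+
  show "\<phi> \<zero>\<^bsub>M\<^esub> = \<zero>\<^bsub>N\<^esub>" using Hom_mod_zero[OF e assms(3)] by simp
  show "\<phi> (x \<ominus>\<^bsub>M\<^esub> y) = \<phi> x \<ominus>\<^bsub>N\<^esub> \<phi> y" if "x \<in> carrier M" "y \<in> carrier M"
  proof -
    have "(x \<ominus>\<^bsub>M\<^esub> y) \<oplus>\<^bsub>M\<^esub> y = x" using that by (simp add: a_minus_def M.M.a_assoc M.M.l_neg)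
    then have "\<phi> (x \<ominus>\<^bsub>M\<^esub> y) \<oplus>\<^bsub>N\<^esub> \<phi> y = \<phi> x"
      using Hom_modD(2)[OF assms(3), of "x \<ominus>\<^bsub>M\<^esub> y" y] that by simp
    then have "\<phi> x \<ominus>\<^bsub>N\<^esub> \<phi> y = (\<phi> (x \<ominus>\<^bsub>M\<^esub> y) \<oplus>\<^bsub>N\<^esub> \<phi> y) \<ominus>\<^bsub>N\<^esub> \<phi> y" by simp
    also have "\<dots> = \<phi> (x \<ominus>\<^bsub>M\<^esub> y)"
      using Hom_modD(1)[OF assms(3)] that by (simp add: a_minus_def N.M.a_assoc N.M.r_neg)
    finally show ?thesis by simp
  qed
qed (use Hom_modD[OF assms(3)] in simp_all)

text \<open>The lifting is a map of \<open>k\<close>-rings: by \<open>\<sigma>_r_\<iota>\<close> the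
  scalars from \<open>k\<close> act the same way directly and through the residue field.\<close>

lemma Hom_\<kappa>_k:
  assumes "\<phi> \<in> Hom_mod \<kappa> (rest \<sigma> M) (rest \<sigma> N)"
  shows "\<phi> \<in> Hom_mod k (rest \<iota> M) (rest \<iota> N)"
proof (rule Hom_modI)
  fix c x assume "c \<in> carrier k" "x \<in> carrier (rest \<iota> M)"
  then show "\<phi> (c \<odot>\<^bsub>rest \<iota> M\<^esub> x) = c \<odot>\<^bsub>rest \<iota> N\<^esub> \<phi> x"
    using Hom_modD(3)[OF assms, of "r (\<iota> c)" x] \<sigma>_r_\<iota>[of c] ring_hom_closed[OF \<iota>'_hom, of c] by simp
qed (use Hom_modD[OF assms] in simp_all)

lemma Hom_K_\<kappa>:
  assumes "\<phi> \<in> Hom_mod K M N"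
  shows "\<phi> \<in> Hom_mod \<kappa> (rest \<sigma> M) (rest \<sigma> N)"
  using Hom_modD[OF assms] \<sigma>_props by (intro Hom_modI) auto

lemma quot_ops:
  assumes "module K M" "L \<in> Lat K S M" "L' \<in> Lat K S M" "L' \<subseteq> L"
  shows "x \<in> L \<Longrightarrow> y \<in> L \<Longrightarrow> quot_module_proj M L' (quot_module_proj M L' x \<oplus>\<^bsub>M\<^esub> quot_module_proj M L' y) =
      quot_module_proj M L' (x \<oplus>\<^bsub>M\<^esub> y)"
    "a \<in> carrier \<kappa> \<Longrightarrow> x \<in> L \<Longrightarrow> quot_module_proj M L' (\<sigma> a \<odot>\<^bsub>M\<^esub> quot_module_proj M L' x) =
      quot_module_proj M L' (\<sigma> a \<odot>\<^bsub>M\<^esub> x)"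
    "x \<in> L \<Longrightarrow> quot_module_proj M L' x \<in> L"
    "x \<in> L \<Longrightarrow> y \<in> L \<Longrightarrow> quot_module_proj M L' x = quot_module_proj M L' y \<longleftrightarrow> x \<ominus>\<^bsub>M\<^esub> y \<in> L'"
    "x \<in> L \<Longrightarrow> y \<in> L \<Longrightarrow> x \<oplus>\<^bsub>M\<^esub> y \<in> L" "a \<in> S \<Longrightarrow> x \<in> L \<Longrightarrow> a \<odot>\<^bsub>M\<^esub> x \<in> L"
    "x \<in> L \<Longrightarrow> quot_module_proj M L' x \<ominus>\<^bsub>M\<^esub> x \<in> L'"
    "x \<in> L \<Longrightarrow> quot_module_proj M L' (quot_module_proj M L' x) = quot_module_proj M L' x"
proof -
  note s = Lat_submodule[OF assms(2)] Lat_submodule[OF assms(3)]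
  interpret M: module K M by fact
  interpret OM: module \<O> M by (rule module_O[OF assms(1)])
  note l = OM.submoduleD[OF s(1)]
  note p = Hom_modD[OF lattice_quot_proj(1)[OF assms(1) s assms(4)]]
  show 1: "quot_module_proj M L' x \<in> L" if "x \<in> L" for x
    by (rule quot_mem[OF assms(1) s assms(4) that])
  show "x \<in> L \<Longrightarrow> y \<in> L \<Longrightarrow> x \<oplus>\<^bsub>M\<^esub> y \<in> L" "a \<in> S \<Longrightarrow> x \<in> L \<Longrightarrow> a \<odot>\<^bsub>M\<^esub> x \<in> L"
    using l by auto
  show "x \<in> L \<Longrightarrow> y \<in> L \<Longrightarrow> quot_module_proj M L' (quot_module_proj M L' x \<oplus>\<^bsub>M\<^esub> quot_module_proj M L' y) =
      quot_module_proj M L' (x \<oplus>\<^bsub>M\<^esub> y)"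
    using p(2)[of x y] l(3) by simp
  show "a \<in> carrier \<kappa> \<Longrightarrow> x \<in> L \<Longrightarrow> quot_module_proj M L' (\<sigma> a \<odot>\<^bsub>M\<^esub> quot_module_proj M L' x) =
      quot_module_proj M L' (\<sigma> a \<odot>\<^bsub>M\<^esub> x)"
    using p(3)[of a x] l(4)[of "\<sigma> a" x] \<sigma>_props(1) by simp
  show 2: "x \<in> L \<Longrightarrow> y \<in> L \<Longrightarrow> quot_module_proj M L' x = quot_module_proj M L' y \<longleftrightarrow> x \<ominus>\<^bsub>M\<^esub> y \<in> L'" for x y
    using quot_eq_iff[OF assms(1) s(2)] l(1) by blast
  show 3: "quot_module_proj M L' x \<ominus>\<^bsub>M\<^esub> x \<in> L'" if "x \<in> L"
  proof -
    have xM: "x \<in> carrier M" using l(1) that by blast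
    obtain n where n: "n \<in> L'" "quot_module_proj M L' x = n \<oplus>\<^bsub>M\<^esub> x"
      using quot_module_proj_mem[OF OM.module_axioms s(2) xM] by blast
    have "n \<in> carrier M" using n(1) OM.submoduleD(1)[OF s(2)] by blast
    have "quot_module_proj M L' x \<ominus>\<^bsub>M\<^esub> x = n"
      using n(2) xM \<open>n \<in> carrier M\<close> by (simp add: a_minus_def M.M.a_assoc M.M.r_neg)
    then show ?thesis using n(1) by simp
  qed
  show "quot_module_proj M L' (quot_module_proj M L' x) = quot_module_proj M L' x" if "x \<in> L"
    using 2[OF 1[OF that] that] 3[OF that] by simp
qed

text \<open>\<open>induced_map\<close> applies \<phi> to the chosen representative; since \<phi>
  maps \<open>L1'\<close> into \<open>L2\<close>, any other element of the coset gives the same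
  result.\<close>

lemma induced_apply:
  assumes "refines M N \<phi> L1' L2' L1 L2" "x \<in> L1"
  shows "induced_map M N \<phi> (L1', L2') (L1, L2) (quot_module_proj M L1' x) = quot_module_proj N L2 (\<phi> x)"
proof -
  note d = refinesD[OF assms(1)]
  note q = quot_ops[OF d(1,5,4,8)] and q2 = quot_ops[OF d(2,6,7,9)]
  have "\<phi> (quot_module_proj M L1' x) \<ominus>\<^bsub>N\<^esub> \<phi> x = \<phi> (quot_module_proj M L1' x \<ominus>\<^bsub>M\<^esub> x)"
    using Hom_k_props(5)[OF d(1-3)] q(3)[OF assms(2)] Lat_sub[OF d(1,5)] assms(2) by simp
  also have "\<dots> \<in> L2" by (rule d(10)[OF q(7)[OF assms(2)]])
  finally have "quot_module_proj N L2 (\<phi> (quot_module_proj M L1' x)) = quot_module_proj N L2 (\<phi> x)"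
    using q2(4) d(11) q(3) assms(2) by simp
  then show ?thesis using assms(2) by (simp add: induced_map_eq)
qed

lemma induced_closed:
  assumes "refines M N \<phi> L1' L2' L1 L2" "x \<in> L1"
  shows "quot_module_proj N L2 (\<phi> x) \<in> quot_module_proj N L2 ` L2'"
  using refinesD(11)[OF assms] by blast

lemma induced_hom:
  assumes "refines M N \<phi> L1' L2' L1 L2" "R \<subseteq> carrier \<kappa>"
    "\<And>a x. a \<in> R \<Longrightarrow> x \<in> L1 \<Longrightarrow> \<phi> (\<sigma> a \<odot>\<^bsub>M\<^esub> x) = \<sigma> a \<odot>\<^bsub>N\<^esub> \<phi> x"
    "a \<in> R" "x \<in> quot_module_proj M L1' ` L1" "y \<in> quot_module_proj M L1' ` L1"
  defines "Q1 \<equiv> lattice_quot \<sigma> M L1 L1'" and "Q2 \<equiv> lattice_quot \<sigma> N L2' L2"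
    and "f \<equiv> induced_map M N \<phi> (L1', L2') (L1, L2)"
  shows "f (x \<oplus>\<^bsub>Q1\<^esub> y) = f x \<oplus>\<^bsub>Q2\<^esub> f y" "f (a \<odot>\<^bsub>Q1\<^esub> x) = a \<odot>\<^bsub>Q2\<^esub> f x" "f x \<in> carrier Q2"
proof -
  note d = refinesD[OF assms(1)]
  note q = quot_ops[OF d(1,5,4,8)] and q2 = quot_ops[OF d(2,6,7,9)]
  note f = induced_apply[OF assms(1), folded f_def]
  obtain u v where uv: "u \<in> L1" "v \<in> L1" "x = quot_module_proj M L1' u" "y = quot_module_proj M L1' v"
    using assms(5,6) by auto
  have c: "u \<in> carrier M" "v \<in> carrier M" using uv Lat_sub[OF d(1,5)] by auto
  show "f (x \<oplus>\<^bsub>Q1\<^esub> y) = f x \<oplus>\<^bsub>Q2\<^esub> f y"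
    using uv q(1,5) q2(1) d(11) Hom_k_props(2)[OF d(1-3)] c by (simp add: Q1_def Q2_def f)
  show "f (a \<odot>\<^bsub>Q1\<^esub> x) = a \<odot>\<^bsub>Q2\<^esub> f x"
    using uv q(2,6) q2(2) d(11) assms(2-4) \<sigma>_props(1) by (simp add: Q1_def Q2_def f subset_iff)
  show "f x \<in> carrier Q2" using uv d(11) by (simp add: Q2_def f)
qed

lemma induced_extensional:
  "induced_map M N \<phi> (L1', L2') (L1, L2) \<in> extensional (quot_module_proj M L1' ` L1)"
  by (simp add: induced_map_eq)

lemma induced_Hom_\<kappa>:
  assumes "refines M N \<phi> L1' L2' L1 L2"
    "\<And>a x. a \<in> carrier \<kappa> \<Longrightarrow> x \<in> carrier M \<Longrightarrow> \<phi> (\<sigma> a \<odot>\<^bsub>M\<^esub> x) = \<sigma> a \<odot>\<^bsub>N\<^esub> \<phi> x"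
  shows "induced_map M N \<phi> (L1', L2') (L1, L2) \<in>
    Hom_mod \<kappa> (lattice_quot \<sigma> M L1 L1') (lattice_quot \<sigma> N L2' L2)"
proof -
  note d = refinesD[OF assms(1)]
  have lin: "\<phi> (\<sigma> a \<odot>\<^bsub>M\<^esub> x) = \<sigma> a \<odot>\<^bsub>N\<^esub> \<phi> x" if "a \<in> carrier \<kappa>" "x \<in> L1" for a x
    using that assms(2) Lat_sub[OF d(1,5)] by auto
  note h = induced_hom[OF assms(1) subset_refl lin]
  show ?thesis
    using h[OF _ _ \<kappa>.zero_closed] h(2)
    by (intro Hom_modI) (auto simp: induced_extensional simp del: lattice_quot_simps(2-))
qed

lemma refines_quot:
  assumes "refines M N \<phi> L1' L2' L1 L2"
  shows "finite_module \<kappa> (lattice_quot \<sigma> M L1 L1')" "finite_module \<kappa> (lattice_quot \<sigma> N L2' L2)"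
  using finite_lattice_quot[OF refinesD(1,5,4,8)[OF assms]] finite_lattice_quot[OF refinesD(2,6,7,9)[OF assms]] by simp_all

text \<open>The quotient \<open>L2'/L2\<close> is the target for \<phi> and the source for \<psi>,
  which explains the exchanged order of the middle lattices in the second refinement.\<close>

lemma refines_compose:
  assumes "refines M N \<phi> L1' L2' L1 L2" "refines N P \<psi> L2 L3' L2' L3"
  shows "refines M P (compose (carrier M) \<psi> \<phi>) L1' L3' L1 L3"
    and "induced_map M P (compose (carrier M) \<psi> \<phi>) (L1', L3') (L1, L3) =
      compose (carrier (lattice_quot \<sigma> M L1 L1'))
        (induced_map N P \<psi> (L2, L3') (L2', L3)) (induced_map M N \<phi> (L1', L2') (L1, L2))"
proof -
  note d = refinesD[OF assms(1)] and e = refinesD[OF assms(2)]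
  have c: "compose (carrier M) \<psi> \<phi> x = \<psi> (\<phi> x)" if "x \<in> L1" for x
    using Lat_sub[OF d(1,5) that] by (simp add: compose_eq)
  show r: "refines M P (compose (carrier M) \<psi> \<phi>) L1' L3' L1 L3"
  proof (rule refinesI[OF d(1) e(2) _ d(4,5) e(6,7) d(8) e(9)])
    show "compose (carrier M) \<psi> \<phi> \<in> Hom_mod k (rest \<iota> M) (rest \<iota> P)"
      using Hom_mod_compose[OF d(3) e(3)] module_k[OF d(1)] module.axioms(2) by fastforce
  qed (use c d(8,10,11) e(10,11) in auto)
  show "induced_map M P (compose (carrier M) \<psi> \<phi>) (L1', L3') (L1, L3) =
      compose (carrier (lattice_quot \<sigma> M L1 L1'))
        (induced_map N P \<psi> (L2, L3') (L2', L3)) (induced_map M N \<phi> (L1', L2') (L1, L2))"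
  proof (rule extensionalityI[of _ "quot_module_proj M L1' ` L1"])
    fix y assume "y \<in> quot_module_proj M L1' ` L1"
    then obtain x where x: "x \<in> L1" "y = quot_module_proj M L1' x" by auto
    then show "induced_map M P (compose (carrier M) \<psi> \<phi>) (L1', L3') (L1, L3) y =
      compose (carrier (lattice_quot \<sigma> M L1 L1'))
        (induced_map N P \<psi> (L2, L3') (L2', L3)) (induced_map M N \<phi> (L1', L2') (L1, L2)) y"
      by (simp add: induced_apply[OF r] compose_eq induced_apply[OF assms(1)]
          induced_apply[OF assms(2) d(11)] c)
  qed (simp_all add: induced_extensional)
qed

text \<open>The maps induced by the identity are the canonical maps
  \<open>L1/L1' \<rightarrow> L2'/L2\<close>. Special cases are the projections to a quotient by a
  larger lattice and the inclusions into a quotient of a larger lattice.\<close>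

lemma refines_id:
  assumes "module K M" "L1' \<in> Lat K S M" "L1 \<in> Lat K S M" "L2' \<in> Lat K S M" "L2 \<in> Lat K S M"
    "L1' \<subseteq> L1" "L2 \<subseteq> L2'" "L1' \<subseteq> L2" "L1 \<subseteq> L2'"
  shows "refines M M (\<lambda>x\<in>carrier M. x) L1' L2' L1 L2"
    and "x \<in> L1 \<Longrightarrow> induced_map M M (\<lambda>x\<in>carrier M. x) (L1', L2') (L1, L2) (quot_module_proj M L1' x) =
      quot_module_proj M L2 x"
    and "induced_map M M (\<lambda>x\<in>carrier M. x) (L1', L2') (L1, L2) \<in>
      Hom_mod \<kappa> (lattice_quot \<sigma> M L1 L1') (lattice_quot \<sigma> M L2' L2)"
proof -
  show r: "refines M M (\<lambda>x\<in>carrier M. x) L1' L2' L1 L2"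
    using Hom_mod_id[OF module_k[OF assms(1)]] assms Lat_sub[OF assms(1,3)] by (intro refinesI) auto
  show "x \<in> L1 \<Longrightarrow> induced_map M M (\<lambda>x\<in>carrier M. x) (L1', L2') (L1, L2) (quot_module_proj M L1' x) =
      quot_module_proj M L2 x"
    using induced_apply[OF r] Lat_sub[OF assms(1,3)] by simp
  interpret M: module K M by fact
  show "induced_map M M (\<lambda>x\<in>carrier M. x) (L1', L2') (L1, L2) \<in>
      Hom_mod \<kappa> (lattice_quot \<sigma> M L1 L1') (lattice_quot \<sigma> M L2' L2)"
    using \<sigma>_props by (intro induced_Hom_\<kappa>[OF r]) simp
qed

text \<open>
  The induced map of a refinement is recovered from that of a refinement with a larger quotient in
  the source and in the target by composing with \<open>\<kappa>\<close>-linear maps, since over the field \<open>\<kappa>\<close>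
  surjections have sections and injections have retractions.
\<close>

lemma induced_coarsen:
  assumes F: "bt_family k \<kappa> \<iota>' B Y"
    and c: "refines M N \<phi> L1' L2' L1 L2" and f: "refines M N \<phi> U1' U2' U1 U2"
    and sub: "U1' \<subseteq> L1'" "L1 \<subseteq> U1" "U2 \<subseteq> L2" "L2' \<subseteq> U2'"
    and Y: "induced_map M N \<phi> (U1', U2') (U1, U2) \<in> Y (lattice_quot \<sigma> M U1 U1') (lattice_quot \<sigma> N U2' U2)"
  shows "induced_map M N \<phi> (L1', L2') (L1, L2) \<in> Y (lattice_quot \<sigma> M L1 L1') (lattice_quot \<sigma> N L2' L2)"
proof -
  note dc = refinesD[OF c] and df = refinesD[OF f]
  \<comment> \<open>The canonical maps are \<open>?q\<close>:
    \<open>L1/U1' \<rightarrow> L1/L1'\<close> and \<open>?o\<close>: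
    \<open>U2'/U2 \<rightarrow> U2'/L2\<close>, which are surjective, and \<open>?i\<close>:
    \<open>L1/U1' \<rightarrow> U1/U1'\<close> and \<open>?j\<close>:
    \<open>L2'/L2 \<rightarrow> U2'/L2\<close>, which are injective. Below, \<open>t\<close> is a
    section of \<open>?q\<close> and \<open>w\<close> a retraction of \<open>?j\<close>.\<close>
  let ?q = "induced_map M M (\<lambda>x\<in>carrier M. x) (U1', L1) (L1, L1')"
  let ?i = "induced_map M M (\<lambda>x\<in>carrier M. x) (U1', U1) (L1, U1')"
  let ?j = "induced_map N N (\<lambda>x\<in>carrier N. x) (L2, U2') (L2', L2)"
  let ?o = "induced_map N N (\<lambda>x\<in>carrier N. x) (U2, U2') (U2', L2)"
  let ?A = "lattice_quot \<sigma> M L1 L1'" and ?A' = "lattice_quot \<sigma> M L1 U1'" and ?A'' = "lattice_quot \<sigma> M U1 U1'"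
  let ?B = "lattice_quot \<sigma> N L2' L2" and ?B' = "lattice_quot \<sigma> N U2' L2" and ?B'' = "lattice_quot \<sigma> N U2' U2"
  have s: "U1' \<subseteq> L1" "L2 \<subseteq> U2'" using dc(8,9) sub by auto
  note fin = refines_quot[OF c] refines_quot[OF f] finite_lattice_quot[OF dc(1,5) df(4) s(1)]
    finite_lattice_quot[OF dc(2) df(6) dc(7) s(2)]
  note q = refines_id[OF dc(1) df(4) dc(5) dc(5) dc(4) s(1) dc(8) sub(1) subset_refl]
  note i = refines_id[OF dc(1) df(4) dc(5) df(5) df(4) s(1) df(8) subset_refl sub(2)]
  note j = refines_id[OF dc(2) dc(7) dc(6) df(6) dc(7) dc(9) s(2) subset_refl sub(4)]
  note o = refines_id[OF dc(2) df(7) df(6) df(6) dc(7) df(9) s(2) sub(3) subset_refl]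
  have "?q ` carrier ?A' = carrier ?A"
    using q(2) by (auto simp: image_image)
  then obtain t where t: "t \<in> Hom_mod \<kappa> ?A ?A'" "\<And>y. y \<in> carrier ?A \<Longrightarrow> ?q (t y) = y"
    using section_exists[OF field_\<kappa> fin(5)[THEN finite_module_is_module] fin(1)[THEN finite_module_is_module] q(3)]
    by blast
  have "inj_on ?j (carrier ?B)"
  proof (rule inj_onI)
    fix x y assume "x \<in> carrier ?B" "y \<in> carrier ?B" and e: "?j x = ?j y"
    then obtain u v where "u \<in> L2'" "v \<in> L2'" "x = quot_module_proj N L2 u" "y = quot_module_proj N L2 v" by auto
    then show "x = y" using e j(2) by simp
  qed
  then obtain w where w: "w \<in> Hom_mod \<kappa> ?B' ?B" "\<And>x. x \<in> carrier ?B \<Longrightarrow> w (?j x) = x"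
    using retraction_exists[OF field_\<kappa> fin(2)[THEN finite_module_is_module] fin(6)[THEN finite_module_is_module] j(3)]
    by blast
  let ?f = "induced_map M N \<phi> (U1', U2') (U1, U2)"
  \<comment> \<open>The path is \<open>L1/L1' \<rightarrow> L1/U1' \<rightarrow> U1/U1'
    \<rightarrow> U2'/U2 \<rightarrow> U2'/L2 \<rightarrow> L2'/L2\<close>. All arrows but the third
    are linear over the residue field.\<close>
  let ?g = "compose (carrier ?A) w (compose (carrier ?A) ?o (compose (carrier ?A) ?f (compose (carrier ?A) ?i t)))"
  note D = bt_familyD[OF F]
  have "module \<kappa> ?A" "abelian_group ?A" using fin(1) finite_module_is_module module.axioms(2) by blast+
  then have "compose (carrier ?A) ?i t \<in> B ?A ?A''"
    using Hom_mod_compose[OF t(1) i(3)] D(3)[OF fin(1) fin(3)] by blast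
  then have "compose (carrier ?A) ?f (compose (carrier ?A) ?i t) \<in> Y ?A ?B''"
    using D(7)[OF fin(1,3,4)] Y by blast
  then have "compose (carrier ?A) ?o (compose (carrier ?A) ?f (compose (carrier ?A) ?i t)) \<in> Y ?A ?B'"
    using D(6)[OF fin(1,4,6)] D(3)[OF fin(4,6)] o(3) by blast
  then have g: "?g \<in> Y ?A ?B"
    using D(6)[OF fin(1,6,2)] D(3)[OF fin(6,2)] w(1) by blast
  have "induced_map M N \<phi> (L1', L2') (L1, L2) = ?g"
  proof (rule extensionalityI[of _ "carrier ?A"])
    fix y assume y: "y \<in> carrier ?A"
    then obtain x where x: "x \<in> L1" "y = quot_module_proj M L1' x" by auto
    \<comment> \<open>\<open>t y\<close> is the class modulo \<open>U1'\<close> of some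
      \<open>z\<close> in \<open>L1\<close>, and this \<open>z\<close> still represents
      \<open>y\<close> modulo \<open>L1'\<close>. All the maps can be evaluated along
      \<open>z\<close>.\<close>
    have "t y \<in> carrier ?A'" using Hom_modD(1)[OF t(1) y] .
    then obtain z where z: "z \<in> L1" "t y = quot_module_proj M U1' z" by auto
    have zx: "quot_module_proj M L1' z = y" using t(2)[OF y] q(2)[OF z(1)] z(2) by simp
    have zU: "z \<in> U1" using z(1) sub(2) by blast
    have "?g y = w (?o (?f (?i (t y))))" using y by (simp add: compose_eq)
    also have "\<dots> = w (quot_module_proj N L2 (\<phi> z))"
      using z zU by (simp add: i(2) induced_apply[OF f] o(2)[OF df(11)])
    also have "\<dots> = w (?j (quot_module_proj N L2 (\<phi> z)))" using j(2)[OF dc(11)[OF z(1)]] by simp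
    also have "\<dots> = quot_module_proj N L2 (\<phi> z)" using dc(11)[OF z(1)] by (intro w(2)) simp
    also have "\<dots> = induced_map M N \<phi> (L1', L2') (L1, L2) y"
      using induced_apply[OF c z(1)] zx by simp
    finally show "induced_map M N \<phi> (L1', L2') (L1, L2) y = ?g y" by simp
  qed (simp_all add: induced_extensional)
  then show ?thesis using g by simp
qed

subsection \<open>Lifting families from \<open>\<kappa>\<close> to \<open>K\<close>\<close>

definition refinable where
  "refinable M N \<phi> \<longleftrightarrow> (\<forall>L1\<in>Lat K S M. \<forall>L2\<in>Lat K S N. \<exists>L1'\<in>Lat K S M. \<exists>L2'\<in>Lat K S N.
     refinement \<phi> (L1', L2') (L1, L2))"

text \<open>One step of the recursion with the family over the residue field as a parameter. It
  covers \<open>BT\<close> as well as \<open>BT_ideal\<close> for i > 1, so closure properties are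
  proved for both at once.\<close>

definition lift where
  "lift Y M N = {\<phi> \<in> Hom_mod k (rest \<iota> M) (rest \<iota> N). refinable M N \<phi> \<and>
     (\<forall>L1\<in>Lat K S M. \<forall>L2\<in>Lat K S N. \<forall>L1'\<in>Lat K S M. \<forall>L2'\<in>Lat K S N.
        refinement \<phi> (L1', L2') (L1, L2) \<longrightarrow>
        induced_map M N \<phi> (L1', L2') (L1, L2) \<in> Y (lattice_quot \<sigma> M L1 L1') (lattice_quot \<sigma> N L2' L2))}"

text \<open>The two lattices of a refinement satisfy independent conditions, one shrinking the
  source and one enlarging the target; they are extracted and recombined separately.\<close>

lemma refinable_below:
  assumes "refinable M N \<phi>" "L1 \<in> Lat K S M" "L2 \<in> Lat K S N"
  shows "\<exists>L. L \<in> Lat K S M \<and> L \<subseteq> L1 \<and> (\<forall>x\<in>L. \<phi> x \<in> L2)"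
proof -
  obtain L L2' where "L \<in> Lat K S M" "refinement \<phi> (L, L2') (L1, L2)"
    using assms(1)[unfolded refinable_def, rule_format, OF assms(2,3)] by blast
  then show ?thesis unfolding refinement_iff by (intro exI[of _ L]) blast
qed

lemma refinable_above:
  assumes "refinable M N \<phi>" "L1 \<in> Lat K S M" "L2 \<in> Lat K S N"
  shows "\<exists>L. L \<in> Lat K S N \<and> L2 \<subseteq> L \<and> (\<forall>x\<in>L1. \<phi> x \<in> L)"
proof -
  obtain L1' L where "L \<in> Lat K S N" "refinement \<phi> (L1', L) (L1, L2)"
    using assms(1)[unfolded refinable_def, rule_format, OF assms(2,3)] by blast
  then show ?thesis unfolding refinement_iff by (intro exI[of _ L]) blast
qed

lemma refinableI:
  assumes "\<And>L1 L2. L1 \<in> Lat K S M \<Longrightarrow> L2 \<in> Lat K S N \<Longrightarrow> \<exists>L\<in>Lat K S M. L \<subseteq> L1 \<and> \<phi> ` L \<subseteq> L2"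
    "\<And>L1 L2. L1 \<in> Lat K S M \<Longrightarrow> L2 \<in> Lat K S N \<Longrightarrow> \<exists>L\<in>Lat K S N. L2 \<subseteq> L \<and> \<phi> ` L1 \<subseteq> L"
  shows "refinable M N \<phi>"
  using assms unfolding refinable_def refinement_iff by meson

lemma liftD:
  assumes "\<phi> \<in> lift Y M N"
  shows "\<phi> \<in> Hom_mod k (rest \<iota> M) (rest \<iota> N)" "refinable M N \<phi>"
    "\<And>L1' L2' L1 L2. refines M N \<phi> L1' L2' L1 L2 \<Longrightarrow>
       induced_map M N \<phi> (L1', L2') (L1, L2) \<in> Y (lattice_quot \<sigma> M L1 L1') (lattice_quot \<sigma> N L2' L2)"
  using assms unfolding lift_def refines_def by blast+

lemma liftI:
  assumes "module K M" "module K N" "\<phi> \<in> Hom_mod k (rest \<iota> M) (rest \<iota> N)" "refinable M N \<phi>"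
    "\<And>L1' L2' L1 L2. refines M N \<phi> L1' L2' L1 L2 \<Longrightarrow>
       induced_map M N \<phi> (L1', L2') (L1, L2) \<in> Y (lattice_quot \<sigma> M L1 L1') (lattice_quot \<sigma> N L2' L2)"
  shows "\<phi> \<in> lift Y M N"
  using assms unfolding lift_def refines_def by blast

text \<open>By \<open>induced_coarsen\<close> it is enough to test one refinement with larger
  quotients beyond each given one.\<close>

lemma liftI_fine:
  assumes "bt_family k \<kappa> \<iota>' B Y" "module K M" "module K N"
    "\<phi> \<in> Hom_mod k (rest \<iota> M) (rest \<iota> N)" "refinable M N \<phi>"
    "\<And>L1' L2' L1 L2. refines M N \<phi> L1' L2' L1 L2 \<Longrightarrow>
       \<exists>U1' U2' U1 U2. refines M N \<phi> U1' U2' U1 U2 \<and> U1' \<subseteq> L1' \<and> L1 \<subseteq> U1 \<and> U2 \<subseteq> L2 \<and> L2' \<subseteq> U2' \<and>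
       induced_map M N \<phi> (U1', U2') (U1, U2) \<in> Y (lattice_quot \<sigma> M U1 U1') (lattice_quot \<sigma> N U2' U2)"
  shows "\<phi> \<in> lift Y M N"
  using assms(2-5)
proof (rule liftI)
  fix L1' L2' L1 L2 assume c: "refines M N \<phi> L1' L2' L1 L2"
  from assms(6)[OF this] show "induced_map M N \<phi> (L1', L2') (L1, L2) \<in> Y (lattice_quot \<sigma> M L1 L1') (lattice_quot \<sigma> N L2' L2)"
    using induced_coarsen[OF assms(1) c] by blast
qed

text \<open>Linearity over the residue field, acting through \<open>\<sigma>\<close>, passes to
  induced maps, and \<open>B\<close> contains all linear maps there. This covers
  \<open>K\<close>-linear maps and also the projection onto the valuation ring, which is linear over
  the residue field only.\<close>

lemma lift_\<kappa>_linear: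
  assumes "bt_family k \<kappa> \<iota>' B Y" "module K M" "module K N"
    "\<phi> \<in> Hom_mod \<kappa> (rest \<sigma> M) (rest \<sigma> N)" "refinable M N \<phi>"
  shows "\<phi> \<in> lift B M N"
proof (rule liftI[OF assms(2,3) Hom_\<kappa>_k[OF assms(4)] assms(5)])
  fix L1' L2' L1 L2 assume c: "refines M N \<phi> L1' L2' L1 L2"
  show "induced_map M N \<phi> (L1', L2') (L1, L2) \<in> B (lattice_quot \<sigma> M L1 L1') (lattice_quot \<sigma> N L2' L2)"
    using Hom_modD(3)[OF assms(4)] by (intro bt_familyD(3)[OF assms(1) refines_quot[OF c]] induced_Hom_\<kappa>[OF c]) auto
qed

lemma lift_linear:
  assumes "bt_family k \<kappa> \<iota>' B Y" "module K M" "module K N" "\<phi> \<in> Hom_mod K M N"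
  shows "\<phi> \<in> lift B M N"
proof (rule lift_\<kappa>_linear[OF assms(1-3) Hom_K_\<kappa>[OF assms(4)]])
  show "refinable M N \<phi>"
    by (rule refinableI) (metis Lat_below[OF assms(2-4)], metis Lat_above[OF assms(2-4)])
qed

lemma lift_zero:
  assumes "bt_family k \<kappa> \<iota>' B Y" "module K M" "module K N"
  shows "(\<lambda>x\<in>carrier M. \<zero>\<^bsub>N\<^esub>) \<in> lift Y M N"
proof -
  interpret ON: module \<O> N by (rule module_O[OF assms(3)])
  have lin: "(\<lambda>x\<in>carrier M. \<zero>\<^bsub>N\<^esub>) \<in> Hom_mod K M N" by (rule Hom_mod_zero_map[OF assms(2,3)])
  note l = liftD[OF lift_linear[OF assms lin]]
  show ?thesis
  proof (rule liftI[OF assms(2,3) l(1,2)])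
    fix L1' L2' L1 L2 assume c: "refines M N (\<lambda>x\<in>carrier M. \<zero>\<^bsub>N\<^esub>) L1' L2' L1 L2"
    note d = refinesD[OF c]
    have "induced_map M N (\<lambda>x\<in>carrier M. \<zero>\<^bsub>N\<^esub>) (L1', L2') (L1, L2) =
      (\<lambda>x\<in>carrier (lattice_quot \<sigma> M L1 L1'). \<zero>\<^bsub>lattice_quot \<sigma> N L2' L2\<^esub>)"
    proof (rule extensionalityI[of _ "quot_module_proj M L1' ` L1"])
      fix y assume "y \<in> quot_module_proj M L1' ` L1"
      then obtain x where "x \<in> L1" "y = quot_module_proj M L1' x" by auto
      then show "induced_map M N (\<lambda>x\<in>carrier M. \<zero>\<^bsub>N\<^esub>) (L1', L2') (L1, L2) y =
        (\<lambda>x\<in>carrier (lattice_quot \<sigma> M L1 L1'). \<zero>\<^bsub>lattice_quot \<sigma> N L2' L2\<^esub>) y"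
        using induced_apply[OF c] Lat_sub[OF d(1,5)] by simp
    qed (simp_all add: induced_extensional)
    then show "induced_map M N (\<lambda>x\<in>carrier M. \<zero>\<^bsub>N\<^esub>) (L1', L2') (L1, L2) \<in>
      Y (lattice_quot \<sigma> M L1 L1') (lattice_quot \<sigma> N L2' L2)"
      using bt_familyD(4)[OF assms(1) refines_quot[OF c]] by simp
  qed
qed

text \<open>A refinement for the sum need not be one for either summand. Shrinking
  \<open>L1'\<close> and enlarging \<open>L2'\<close> makes it one for both, and there the induced
  map is the sum of the induced maps.\<close>

lemma lift_add:
  assumes F: "bt_family k \<kappa> \<iota>' B Y" and MN: "module K M" "module K N"
    and \<phi>: "\<phi> \<in> lift Y M N" and \<psi>: "\<psi> \<in> lift Y M N"
  shows "(\<lambda>x\<in>carrier M. \<phi> x \<oplus>\<^bsub>N\<^esub> \<psi> x) \<in> lift Y M N" (is "?s \<in> _")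
proof -
  interpret ON: module \<O> N by (rule module_O[OF MN(2)])
  note p = liftD[OF \<phi>] and q = liftD[OF \<psi>]
  have hom: "?s \<in> Hom_mod k (rest \<iota> M) (rest \<iota> N)"
    using Hom_mod_add[OF p(1) q(1) module_k[OF MN(1)] module_k[OF MN(2)]] by simp
  have sum: "?s x \<in> L" if "L \<in> Lat K S N" "\<phi> x \<in> L" "\<psi> x \<in> L" "x \<in> carrier M" for x L
    using ON.submoduleD(3)[OF Lat_submodule[OF that(1)]] that by simp
  have below: "\<exists>L\<in>Lat K S M. L \<subseteq> L1 \<and> (\<forall>x\<in>L. \<phi> x \<in> L2 \<and> \<psi> x \<in> L2)"
    if L: "L1 \<in> Lat K S M" "L2 \<in> Lat K S N" for L1 L2
  proof -
    obtain L where L': "L \<in> Lat K S M" "L \<subseteq> L1" "\<And>x. x \<in> L \<Longrightarrow> \<phi> x \<in> L2"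
      using refinable_below[OF p(2) L] by blast
    obtain L' where "L' \<in> Lat K S M" "L' \<subseteq> L" "\<And>x. x \<in> L' \<Longrightarrow> \<psi> x \<in> L2"
      using refinable_below[OF q(2) L'(1) L(2)] by blast
    then show ?thesis using L'(2,3) by (intro bexI[of _ L']) auto
  qed
  have above: "\<exists>L\<in>Lat K S N. L2 \<subseteq> L \<and> (\<forall>x\<in>L1. \<phi> x \<in> L \<and> \<psi> x \<in> L)"
    if L: "L1 \<in> Lat K S M" "L2 \<in> Lat K S N" for L1 L2
  proof -
    obtain L where L': "L \<in> Lat K S N" "L2 \<subseteq> L" "\<And>x. x \<in> L1 \<Longrightarrow> \<phi> x \<in> L"
      using refinable_above[OF p(2) L] by blast
    obtain L' where "L' \<in> Lat K S N" "L \<subseteq> L'" "\<And>x. x \<in> L1 \<Longrightarrow> \<psi> x \<in> L'"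
      using refinable_above[OF q(2) L(1) L'(1)] by blast
    then show ?thesis using L'(2,3) by (intro bexI[of _ L']) auto
  qed
  have "refinable M N ?s"
  proof (rule refinableI)
    fix L1 L2 assume L: "L1 \<in> Lat K S M" "L2 \<in> Lat K S N"
    from below[OF L] obtain L where l: "L \<in> Lat K S M" "L \<subseteq> L1" "\<forall>x\<in>L. \<phi> x \<in> L2 \<and> \<psi> x \<in> L2" by blast
    then have "?s ` L \<subseteq> L2" using sum[OF L(2)] Lat_sub[OF MN(1) l(1)] by blast
    then show "\<exists>L\<in>Lat K S M. L \<subseteq> L1 \<and> ?s ` L \<subseteq> L2" using l by blast
    from above[OF L] obtain L where l: "L \<in> Lat K S N" "L2 \<subseteq> L" "\<forall>x\<in>L1. \<phi> x \<in> L \<and> \<psi> x \<in> L" by blast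
    then have "?s ` L1 \<subseteq> L" using sum[OF l(1)] Lat_sub[OF MN(1) L(1)] by blast
    then show "\<exists>L\<in>Lat K S N. L2 \<subseteq> L \<and> ?s ` L1 \<subseteq> L" using l by blast
  qed
  then show ?thesis
  proof (rule liftI_fine[OF F MN hom])
    fix L1' L2' L1 L2 assume c: "refines M N ?s L1' L2' L1 L2"
    note d = refinesD[OF c]
    obtain U where U: "U \<in> Lat K S M" "U \<subseteq> L1'" "\<forall>x\<in>U. \<phi> x \<in> L2 \<and> \<psi> x \<in> L2" using below[OF d(4,7)] by blast
    obtain V where V: "V \<in> Lat K S N" "L2' \<subseteq> V" "\<forall>x\<in>L1. \<phi> x \<in> V \<and> \<psi> x \<in> V" using above[OF d(5,6)] by blast
    have s: "U \<subseteq> L1" "L2 \<subseteq> V" using U V d by auto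
    have r: "refines M N \<phi> U V L1 L2" "refines M N \<psi> U V L1 L2"
      using p(1) q(1) U V d s by (auto intro!: refinesI[OF MN])
    have r': "refines M N ?s U V L1 L2"
      using hom U V d s sum Lat_sub[OF MN(1)] by (intro refinesI[OF MN]) blast+
    let ?Q1 = "lattice_quot \<sigma> M L1 U" and ?Q2 = "lattice_quot \<sigma> N V L2"
    have "induced_map M N ?s (U, V) (L1, L2) = (\<lambda>x\<in>carrier ?Q1.
      induced_map M N \<phi> (U, V) (L1, L2) x \<oplus>\<^bsub>?Q2\<^esub> induced_map M N \<psi> (U, V) (L1, L2) x)"
    proof (rule extensionalityI[of _ "quot_module_proj M U ` L1"])
      fix y assume "y \<in> quot_module_proj M U ` L1"
      then obtain x where x: "x \<in> L1" "y = quot_module_proj M U x" by auto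
      have "x \<in> carrier M" using Lat_sub[OF d(1,5) x(1)] .
      then show "induced_map M N ?s (U, V) (L1, L2) y = (\<lambda>x\<in>carrier ?Q1.
        induced_map M N \<phi> (U, V) (L1, L2) x \<oplus>\<^bsub>?Q2\<^esub> induced_map M N \<psi> (U, V) (L1, L2) x) y"
        using x V(3) by (simp add: induced_apply[OF r'] induced_apply[OF r(1)] induced_apply[OF r(2)]
            quot_ops(1)[OF MN(2) V(1) d(7) s(2)])
    qed (simp_all add: induced_extensional)
    also have "\<dots> \<in> Y ?Q1 ?Q2"
      by (rule bt_familyD(5)[OF F refines_quot[OF r'] p(3)[OF r(1)] q(3)[OF r(2)]])
    finally show "\<exists>U1' U2' U1 U2. refines M N ?s U1' U2' U1 U2 \<and> U1' \<subseteq> L1' \<and> L1 \<subseteq> U1 \<and> U2 \<subseteq> L2 \<and> L2' \<subseteq> U2' \<and>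
       induced_map M N ?s (U1', U2') (U1, U2) \<in> Y (lattice_quot \<sigma> M U1 U1') (lattice_quot \<sigma> N U2' U2)"
      using r' U V by blast
  qed
qed

text \<open>Each half passes through a lattice of \<open>N\<close>, and finite generation of
  \<open>N\<close> provides one to start from.\<close>

lemma refinable_compose:
  assumes "finite_module K N" "refinable M N \<phi>" "refinable N P \<psi>" "module K M"
  shows "refinable M P (compose (carrier M) \<psi> \<phi>)"
proof (rule refinableI)
  obtain L0 where L0: "L0 \<in> Lat K S N" using Lat_exists[OF assms(1)] .
  have c: "compose (carrier M) \<psi> \<phi> x = \<psi> (\<phi> x)" if "x \<in> L" "L \<in> Lat K S M" for x L
    using Lat_sub[OF assms(4) that(2,1)] by (simp add: compose_eq)
  fix L1 L3 assume L: "L1 \<in> Lat K S M" "L3 \<in> Lat K S P"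
  obtain L2 where L2: "L2 \<in> Lat K S N" "L2 \<subseteq> L0" "\<And>x. x \<in> L2 \<Longrightarrow> \<psi> x \<in> L3"
    using refinable_below[OF assms(3) L0 L(2)] by blast
  obtain L1' where "L1' \<in> Lat K S M" "L1' \<subseteq> L1" "\<And>x. x \<in> L1' \<Longrightarrow> \<phi> x \<in> L2"
    using refinable_below[OF assms(2) L(1) L2(1)] by blast
  then show "\<exists>L\<in>Lat K S M. L \<subseteq> L1 \<and> compose (carrier M) \<psi> \<phi> ` L \<subseteq> L3"
    using L2 c by (intro bexI[of _ L1']) auto
  obtain L2' where L2': "L2' \<in> Lat K S N" "L0 \<subseteq> L2'" "\<And>x. x \<in> L1 \<Longrightarrow> \<phi> x \<in> L2'"
    using refinable_above[OF assms(2) L(1) L0] by blast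
  obtain L3' where "L3' \<in> Lat K S P" "L3 \<subseteq> L3'" "\<And>x. x \<in> L2' \<Longrightarrow> \<psi> x \<in> L3'"
    using refinable_above[OF assms(3) L2'(1) L(2)] by blast
  then show "\<exists>L\<in>Lat K S P. L3 \<subseteq> L \<and> compose (carrier M) \<psi> \<phi> ` L1 \<subseteq> L"
    using L2' c L(1) by (intro bexI[of _ L3']) auto
qed

lemma lift_compose:
  assumes F: "bt_family k \<kappa> \<iota>' B Y" and M: "module K M" and N: "finite_module K N" and P: "module K P"
    and "(\<phi> \<in> lift Y M N \<and> \<psi> \<in> lift B N P) \<or> (\<phi> \<in> lift B M N \<and> \<psi> \<in> lift Y N P)"
  shows "compose (carrier M) \<psi> \<phi> \<in> lift Y M P"
proof -
  \<comment> \<open>The two cases differ only in which factor lies in the ideal; with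
    \<open>Y1\<close> and \<open>Y2\<close> they share one argument about lattices.\<close>
  obtain Y1 Y2 where \<phi>: "\<phi> \<in> lift Y1 M N" and \<psi>: "\<psi> \<in> lift Y2 N P"
    and cases: "(Y1 = Y \<and> Y2 = B) \<or> (Y1 = B \<and> Y2 = Y)" using assms(5) by blast
  have N': "module K N" using N by (rule finite_module_is_module)
  note p = liftD[OF \<phi>] and q = liftD[OF \<psi>]
  have hom: "compose (carrier M) \<psi> \<phi> \<in> Hom_mod k (rest \<iota> M) (rest \<iota> P)"
    using Hom_mod_compose[OF p(1) q(1)] module_k[OF M] module.axioms(2) by fastforce
  show ?thesis
  proof (rule liftI_fine[OF F M P hom refinable_compose[OF N p(2) q(2) M]])
    fix L1' L3' L1 L3 assume c: "refines M P (compose (carrier M) \<psi> \<phi>) L1' L3' L1 L3"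
    note d = refinesD[OF c]
    \<comment> \<open>The order of choices matters: \<open>L2'\<close> takes in \<phi>(L1), then
      \<open>V\<close> takes in \<psi>(L2'); \<open>L2\<close> is chosen inside \<open>L2'\<close>
      and small enough for \<psi>, and finally \<open>U\<close> small enough for \<phi>. Only
      \<open>L1'\<close> and \<open>L3'\<close> are replaced.\<close>
    obtain L0 where L0: "L0 \<in> Lat K S N" using Lat_exists[OF N] .
    obtain L2' where L2': "L2' \<in> Lat K S N" "L0 \<subseteq> L2'" "\<And>x. x \<in> L1 \<Longrightarrow> \<phi> x \<in> L2'"
      using refinable_above[OF p(2) d(5) L0] by blast
    obtain V where V: "V \<in> Lat K S P" "L3' \<subseteq> V" "\<And>x. x \<in> L2' \<Longrightarrow> \<psi> x \<in> V"
      using refinable_above[OF q(2) L2'(1) d(6)] by blast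
    obtain L2 where L2: "L2 \<in> Lat K S N" "L2 \<subseteq> L2'" "\<And>x. x \<in> L2 \<Longrightarrow> \<psi> x \<in> L3"
      using refinable_below[OF q(2) L2'(1) d(7)] by blast
    obtain U where U: "U \<in> Lat K S M" "U \<subseteq> L1'" "\<And>x. x \<in> U \<Longrightarrow> \<phi> x \<in> L2"
      using refinable_below[OF p(2) d(4) L2(1)] by blast
    have s: "U \<subseteq> L1" "L3 \<subseteq> V" using U V d by auto
    have r1: "refines M N \<phi> U L2' L1 L2" by (rule refinesI[OF M N' p(1) U(1) d(5) L2'(1) L2(1) s(1) L2(2) U(3) L2'(3)])
    have r2: "refines N P \<psi> L2 V L2' L3" by (rule refinesI[OF N' P q(1) L2(1) L2'(1) V(1) d(7) L2(2) s(2) L2(3) V(3)])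
    note r = refines_compose[OF r1 r2]
    note fin = refines_quot[OF r1] refines_quot(2)[OF r2]
    have "induced_map M P (compose (carrier M) \<psi> \<phi>) (U, V) (L1, L3) \<in>
      Y (lattice_quot \<sigma> M L1 U) (lattice_quot \<sigma> P V L3)"
      unfolding r(2) using p(3)[OF r1] q(3)[OF r2] cases
        bt_familyD(6,7)[OF F fin(1,2) fin(3)] by blast
    then show "\<exists>U1' U2' U1 U2. refines M P (compose (carrier M) \<psi> \<phi>) U1' U2' U1 U2 \<and> U1' \<subseteq> L1' \<and> L1 \<subseteq> U1 \<and>
       U2 \<subseteq> L3 \<and> L3' \<subseteq> U2' \<and> induced_map M P (compose (carrier M) \<psi> \<phi>) (U1', U2') (U1, U2) \<in>
       Y (lattice_quot \<sigma> M U1 U1') (lattice_quot \<sigma> P U2' U2)"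
      using r(1) U V by blast
  qed
qed

lemma lift_mono:
  assumes F: "bt_family k \<kappa> \<iota>' B Y" and MN: "module K M" "module K N"
  shows "lift Y M N \<subseteq> lift B M N"
proof
  fix \<phi> assume \<phi>: "\<phi> \<in> lift Y M N"
  note p = liftD[OF \<phi>]
  show "\<phi> \<in> lift B M N"
    by (rule liftI[OF MN p(1,2)]) (rule bt_familyD(1)[OF F refines_quot p(3)])
qed

lemma bt_family_lift:
  assumes F: "bt_family k \<kappa> \<iota>' B Y"
  shows "bt_family k K \<iota> (lift B) (lift Y)"
proof -
  have fm: "\<And>M. finite_module K M \<Longrightarrow> module K M" by (rule finite_module_is_module)
  show ?thesis
    unfolding bt_family_def
  proof (intro conjI allI impI ballI)
    show "lift Y M N \<subseteq> lift B M N" if "finite_module K M" "finite_module K N" for M N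
      using lift_mono[OF F fm fm] that .
    show "lift B M N \<subseteq> Hom_mod k (rest \<iota> M) (rest \<iota> N)" for M N using liftD(1) by blast
    show "Hom_mod K M N \<subseteq> lift B M N" if "finite_module K M" "finite_module K N" for M N
      using lift_linear[OF F fm fm] that by blast
    show "(\<lambda>x\<in>carrier M. \<zero>\<^bsub>N\<^esub>) \<in> lift Y M N" if "finite_module K M" "finite_module K N" for M N
      using lift_zero[OF F fm fm] that .
    show "(\<lambda>x\<in>carrier M. \<phi> x \<oplus>\<^bsub>N\<^esub> \<psi> x) \<in> lift Y M N"
      if "finite_module K M" "finite_module K N" "\<phi> \<in> lift Y M N" "\<psi> \<in> lift Y M N" for M N \<phi> \<psi>
      using lift_add[OF F fm fm] that by blast
    show "compose (carrier M) \<psi> \<phi> \<in> lift Y M P"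
      if "finite_module K M" "finite_module K N" "finite_module K P" "\<phi> \<in> lift Y M N" "\<psi> \<in> lift B N P"
      for M N P \<phi> \<psi>
      using lift_compose[OF F fm _ fm] that by blast
    show "compose (carrier M) \<psi> \<phi> \<in> lift Y M P"
      if "finite_module K M" "finite_module K N" "finite_module K P" "\<phi> \<in> lift B M N" "\<psi> \<in> lift Y N P"
      for M N P \<phi> \<psi>
      using lift_compose[OF F fm _ fm] that by blast
  qed
qed

subsection \<open>The ideals of index \<open>1\<close>\<close>

text \<open>The index (1,1) condition imposed on an arbitrary family; \<open>discrete_ops\<close> is
  its counterpart for (1,2). Neither mentions induced maps, so the ideal properties follow from
  refinability alone.\<close>

definition bounded_ops where
  "bounded_ops B M N = {\<phi> \<in> B M N. \<exists>L\<in>Lat K S N. \<phi> ` carrier M \<subseteq> L}"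

definition discrete_ops where
  "discrete_ops B M N = {\<phi> \<in> B M N. \<exists>L\<in>Lat K S M. \<forall>x\<in>L. \<phi> x = \<zero>\<^bsub>N\<^esub>}"

lemma bounded_opsI: "\<phi> \<in> B M N \<Longrightarrow> L \<in> Lat K S N \<Longrightarrow> (\<And>x. x \<in> carrier M \<Longrightarrow> \<phi> x \<in> L) \<Longrightarrow> \<phi> \<in> bounded_ops B M N"
  unfolding bounded_ops_def by blast

lemma discrete_opsI: "\<phi> \<in> B M N \<Longrightarrow> L \<in> Lat K S M \<Longrightarrow> (\<And>x. x \<in> L \<Longrightarrow> \<phi> x = \<zero>\<^bsub>N\<^esub>) \<Longrightarrow> \<phi> \<in> discrete_ops B M N"
  unfolding discrete_ops_def by blast

lemma Lat_both_below:
  assumes "module K M" "L1 \<in> Lat K S M" "L2 \<in> Lat K S M"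
  shows "\<exists>L\<in>Lat K S M. L \<subseteq> L1 \<and> L \<subseteq> L2"
proof -
  obtain L where L: "L \<in> Lat K S M" "L \<subseteq> L1" "(\<lambda>x\<in>carrier M. x) ` L \<subseteq> L2"
    using Lat_below[OF assms(1,1) Hom_mod_id[OF assms(1)] assms(2,3)] .
  then have "L \<subseteq> L2" using Lat_sub[OF assms(1) L(1)] by force
  then show ?thesis using L by blast
qed

lemma Lat_both_above:
  assumes "module K M" "L1 \<in> Lat K S M" "L2 \<in> Lat K S M"
  shows "\<exists>L\<in>Lat K S M. L1 \<subseteq> L \<and> L2 \<subseteq> L"
proof -
  obtain L where L: "L \<in> Lat K S M" "L2 \<subseteq> L" "(\<lambda>x\<in>carrier M. x) ` L1 \<subseteq> L"
    using Lat_above[OF assms(1,1) Hom_mod_id[OF assms(1)] assms(2,3)] .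
  then have "L1 \<subseteq> L" using Lat_sub[OF assms(1,2)] by force
  then show ?thesis using L by blast
qed

lemma Lat_add: "module K M \<Longrightarrow> L \<in> Lat K S M \<Longrightarrow> x \<in> L \<Longrightarrow> y \<in> L \<Longrightarrow> x \<oplus>\<^bsub>M\<^esub> y \<in> L"
  by (rule module.submoduleD(3)[OF module_O Lat_submodule])

lemma Lat_diff: "module K M \<Longrightarrow> L \<in> Lat K S M \<Longrightarrow> x \<in> L \<Longrightarrow> y \<in> L \<Longrightarrow> x \<ominus>\<^bsub>M\<^esub> y \<in> L"
  by (rule module.submoduleD(6)[OF module_O Lat_submodule])

lemma Lat_zero: "module K M \<Longrightarrow> L \<in> Lat K S M \<Longrightarrow> \<zero>\<^bsub>M\<^esub> \<in> L"
  by (rule module.submoduleD(2)[OF module_O Lat_submodule])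

text \<open>If \<phi> has values in a lattice \<open>L\<close>, refinability of \<psi> provides a
  lattice that contains \<psi>(L). Sums use a common larger lattice.\<close>

lemma bt_family_bounded:
  assumes F: "bt_family k K \<iota> B B" and ref: "\<And>M N \<phi>. \<phi> \<in> B M N \<Longrightarrow> refinable M N \<phi>"
  shows "bt_family k K \<iota> B (bounded_ops B)"
proof -
  note D = bt_familyD[OF F]
  have fm: "\<And>M. finite_module K M \<Longrightarrow> module K M" by (rule finite_module_is_module)
  show ?thesis
    unfolding bt_family_def
  proof (intro conjI allI impI ballI)
    show "bounded_ops B M N \<subseteq> B M N" for M N by (auto simp: bounded_ops_def)
    show "B M N \<subseteq> Hom_mod k (rest \<iota> M) (rest \<iota> N)" "Hom_mod K M N \<subseteq> B M N"
      if "finite_module K M" "finite_module K N" for M N using D(2,3)[OF that] by auto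
    show "(\<lambda>x\<in>carrier M. \<zero>\<^bsub>N\<^esub>) \<in> bounded_ops B M N" if fin: "finite_module K M" "finite_module K N" for M N
    proof -
      obtain L where L: "L \<in> Lat K S N" using Lat_exists[OF fin(2)] .
      show ?thesis using Lat_zero[OF fm[OF fin(2)] L] by (intro bounded_opsI[of _ B M N, OF D(4)[OF fin] L]) simp
    qed
    show "(\<lambda>x\<in>carrier M. \<phi> x \<oplus>\<^bsub>N\<^esub> \<psi> x) \<in> bounded_ops B M N"
      if fin: "finite_module K M" "finite_module K N" and ops: "\<phi> \<in> bounded_ops B M N" "\<psi> \<in> bounded_ops B M N"
      for M N \<phi> \<psi>
    proof -
      obtain L1 L2 where L: "L1 \<in> Lat K S N" "\<phi> ` carrier M \<subseteq> L1" "L2 \<in> Lat K S N" "\<psi> ` carrier M \<subseteq> L2"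
        using ops unfolding bounded_ops_def by blast
      obtain L where L': "L \<in> Lat K S N" "L1 \<subseteq> L" "L2 \<subseteq> L"
        using Lat_both_above[OF fm[OF fin(2)] L(1,3)] by blast
      have ops': "\<phi> \<in> B M N" "\<psi> \<in> B M N" using ops unfolding bounded_ops_def by auto
      have "\<phi> x \<in> L" "\<psi> x \<in> L" if "x \<in> carrier M" for x using that L L' by auto
      then show ?thesis
        using Lat_add[OF fm[OF fin(2)] L'(1)] by (intro bounded_opsI[of _ B M N, OF D(5)[OF fin ops'] L'(1)]) simp
    qed
    show "compose (carrier M) \<psi> \<phi> \<in> bounded_ops B M P"
      if fin: "finite_module K M" "finite_module K N" "finite_module K P"
        and ops: "\<phi> \<in> bounded_ops B M N" "\<psi> \<in> B N P" for M N P \<phi> \<psi>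
    proof -
      obtain L where L: "L \<in> Lat K S N" "\<phi> ` carrier M \<subseteq> L" using ops unfolding bounded_ops_def by blast
      obtain L0 where L0: "L0 \<in> Lat K S P" using Lat_exists[OF fin(3)] .
      obtain V where V: "V \<in> Lat K S P" "\<forall>x\<in>L. \<psi> x \<in> V" using refinable_above[OF ref[OF ops(2)] L(1) L0] by blast
      have ops': "\<phi> \<in> B M N" using ops unfolding bounded_ops_def by auto
      show ?thesis
        using V(2) L(2) by (intro bounded_opsI[of _ B M P, OF D(6)[OF fin(1,2,3) ops' ops(2)] V(1)]) (auto simp: compose_eq)
    qed
    show "compose (carrier M) \<psi> \<phi> \<in> bounded_ops B M P"
      if fin: "finite_module K M" "finite_module K N" "finite_module K P"
        and ops: "\<phi> \<in> B M N" "\<psi> \<in> bounded_ops B N P" for M N P \<phi> \<psi>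
    proof -
      obtain L where L: "L \<in> Lat K S P" "\<psi> ` carrier N \<subseteq> L" using ops unfolding bounded_ops_def by blast
      have ops': "\<psi> \<in> B N P" using ops unfolding bounded_ops_def by auto
      show ?thesis
        using L(2) Hom_modD(1)[OF D(2)[OF fin(1,2) ops(1)]]
        by (intro bounded_opsI[of _ B M P, OF D(6)[OF fin(1,2,3) ops(1) ops'] L(1)]) (auto simp: compose_eq)
    qed
  qed
qed

text \<open>Dual to the bounded case: if \<psi> kills \<open>L\<close>, refinability of \<phi>
  provides a lattice that \<phi> maps into \<open>L\<close>. Sums use a common smaller
  lattice.\<close>

lemma bt_family_discrete:
  assumes F: "bt_family k K \<iota> B B" and ref: "\<And>M N \<phi>. \<phi> \<in> B M N \<Longrightarrow> refinable M N \<phi>"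
  shows "bt_family k K \<iota> B (discrete_ops B)"
proof -
  note D = bt_familyD[OF F]
  have fm: "\<And>M. finite_module K M \<Longrightarrow> module K M" by (rule finite_module_is_module)
  show ?thesis
    unfolding bt_family_def
  proof (intro conjI allI impI ballI)
    show "discrete_ops B M N \<subseteq> B M N" for M N by (auto simp: discrete_ops_def)
    show "B M N \<subseteq> Hom_mod k (rest \<iota> M) (rest \<iota> N)" "Hom_mod K M N \<subseteq> B M N"
      if "finite_module K M" "finite_module K N" for M N using D(2,3)[OF that] by auto
    show "(\<lambda>x\<in>carrier M. \<zero>\<^bsub>N\<^esub>) \<in> discrete_ops B M N" if fin: "finite_module K M" "finite_module K N" for M N
    proof -
      obtain L where L: "L \<in> Lat K S M" using Lat_exists[OF fin(1)] .
      show ?thesis using Lat_sub[OF fm[OF fin(1)] L] by (intro discrete_opsI[of _ B M N, OF D(4)[OF fin] L]) simp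
    qed
    show "(\<lambda>x\<in>carrier M. \<phi> x \<oplus>\<^bsub>N\<^esub> \<psi> x) \<in> discrete_ops B M N"
      if fin: "finite_module K M" "finite_module K N" and ops: "\<phi> \<in> discrete_ops B M N" "\<psi> \<in> discrete_ops B M N"
      for M N \<phi> \<psi>
    proof -
      interpret N: module K N by (rule fm[OF fin(2)])
      obtain L1 L2 where L: "L1 \<in> Lat K S M" "\<forall>x\<in>L1. \<phi> x = \<zero>\<^bsub>N\<^esub>" "L2 \<in> Lat K S M" "\<forall>x\<in>L2. \<psi> x = \<zero>\<^bsub>N\<^esub>"
        using ops unfolding discrete_ops_def by blast
      obtain L where L': "L \<in> Lat K S M" "L \<subseteq> L1" "L \<subseteq> L2"
        using Lat_both_below[OF fm[OF fin(1)] L(1,3)] by blast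
      have ops': "\<phi> \<in> B M N" "\<psi> \<in> B M N" using ops unfolding discrete_ops_def by auto
      have "\<phi> x = \<zero>\<^bsub>N\<^esub>" "\<psi> x = \<zero>\<^bsub>N\<^esub>" "x \<in> carrier M" if "x \<in> L" for x
        using that L L' Lat_sub[OF fm[OF fin(1)] L'(1)] by auto
      then show ?thesis by (intro discrete_opsI[of _ B M N, OF D(5)[OF fin ops'] L'(1)]) simp
    qed
    show "compose (carrier M) \<psi> \<phi> \<in> discrete_ops B M P"
      if fin: "finite_module K M" "finite_module K N" "finite_module K P"
        and ops: "\<phi> \<in> discrete_ops B M N" "\<psi> \<in> B N P" for M N P \<phi> \<psi>
    proof -
      obtain L where L: "L \<in> Lat K S M" "\<forall>x\<in>L. \<phi> x = \<zero>\<^bsub>N\<^esub>" using ops unfolding discrete_ops_def by blast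
      have ops': "\<phi> \<in> B M N" using ops unfolding discrete_ops_def by auto
      have "\<psi> \<zero>\<^bsub>N\<^esub> = \<zero>\<^bsub>P\<^esub>" using Hom_k_props(4)[OF fm[OF fin(2)] fm[OF fin(3)] D(2)[OF fin(2,3) ops(2)]] .
      then show ?thesis
        using L(2) Lat_sub[OF fm[OF fin(1)] L(1)]
        by (intro discrete_opsI[of _ B M P, OF D(6)[OF fin(1,2,3) ops' ops(2)] L(1)]) (auto simp: compose_eq)
    qed
    show "compose (carrier M) \<psi> \<phi> \<in> discrete_ops B M P"
      if fin: "finite_module K M" "finite_module K N" "finite_module K P"
        and ops: "\<phi> \<in> B M N" "\<psi> \<in> discrete_ops B N P" for M N P \<phi> \<psi>
    proof -
      obtain L where L: "L \<in> Lat K S N" "\<forall>x\<in>L. \<psi> x = \<zero>\<^bsub>P\<^esub>" using ops unfolding discrete_ops_def by blast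
      have ops': "\<psi> \<in> B N P" using ops unfolding discrete_ops_def by auto
      obtain L0 where L0: "L0 \<in> Lat K S M" using Lat_exists[OF fin(1)] .
      obtain V where V: "V \<in> Lat K S M" "\<forall>x\<in>V. \<phi> x \<in> L" using refinable_below[OF ref[OF ops(1)] L0 L(1)] by blast
      show ?thesis
        using V(2) L(2) Lat_sub[OF fm[OF fin(1)] V(1)]
        by (intro discrete_opsI[of _ B M P, OF D(6)[OF fin(1,2,3) ops(1) ops'] V(1)]) (auto simp: compose_eq)
    qed
  qed
qed

subsection \<open>Finite potency\<close>

text \<open>The operator is determined on \<open>L2\<close> by classes modulo a killed lattice, so
  its iterates can be followed in the quotient. The exponent becomes n + 2: one application enters
  \<open>L2\<close>, n applications are tracked modulo the killed lattice, and one more removes the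
  ambiguity of the class.\<close>

lemma finite_potent_step:
  assumes M: "module K M" and \<phi>: "\<phi> \<in> Hom_mod k (rest \<iota> M) (rest \<iota> M)"
    and L2: "L2 \<in> Lat K S M" "\<phi> ` carrier M \<subseteq> L2" and L1: "L1 \<in> Lat K S M" "\<forall>x\<in>L1. \<phi> x = \<zero>\<^bsub>M\<^esub>"
    and step: "\<And>L1 L2. refines M M \<phi> L1 L2 L2 L1 \<Longrightarrow>
      finite_potent k (rest \<iota>' (lattice_quot \<sigma> M L2 L1)) (induced_map M M \<phi> (L1, L2) (L2, L1))"
  shows "finite_potent k (rest \<iota> M) \<phi>"
proof -
  interpret M: module K M by (rule M)
  note h = Hom_k_props[OF M M \<phi>]
  \<comment> \<open>\<open>L1\<close> need not lie in \<open>L2\<close>; a common smaller lattice is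
    still killed by \<phi> and can be divided out of \<open>L2\<close>.\<close>
  obtain L where L: "L \<in> Lat K S M" "L \<subseteq> L1" "L \<subseteq> L2" using Lat_both_below[OF M L1(1) L2(1)] by blast
  have zero: "\<phi> x = \<zero>\<^bsub>M\<^esub>" if "x \<in> L" for x using L1(2) L(2) that by blast
  have img: "\<phi> x \<in> L2" if "x \<in> carrier M" for x using L2(2) that by blast
  note L2M = Lat_sub[OF M L2(1)]
  have r: "refines M M \<phi> L L2 L2 L"
    using zero img L2M Lat_zero[OF M L(1)] by (intro refinesI[OF M M \<phi> L(1) L2(1) L2(1) L(1) L(3,3)]) auto
  let ?Q = "lattice_quot \<sigma> M L2 L" and ?f = "induced_map M M \<phi> (L, L2) (L2, L)"
  let ?p = "quot_module_proj M L"
  note q = quot_ops[OF M L2(1) L(1,3)]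
  obtain n :: nat where n: "finite_module k ((rest \<iota>' ?Q)\<lparr>carrier := (?f [^]\<^bsub>End_ring k (rest \<iota>' ?Q)\<^esub> n) ` carrier (rest \<iota>' ?Q)\<rparr>)"
    using step[OF r] unfolding finite_potent_def by blast
  define W where "W = (?f ^^ n) ` ?p ` L2"
  have f_closed: "?f y \<in> ?p ` L2" if "y \<in> ?p ` L2" for y
    using that induced_apply[OF r] induced_closed[OF r] by auto
  have "(?f [^]\<^bsub>End_ring k (rest \<iota>' ?Q)\<^esub> n) y = (?f ^^ n) y" if "y \<in> ?p ` L2" for y
    using that f_closed by (intro End_ring_pow) auto
  then have W: "finite_module k ((rest \<iota>' ?Q)\<lparr>carrier := W\<rparr>)"
    using n by (simp add: W_def cong: image_cong_simp)
  have iter_closed: "(\<phi> ^^ m) x \<in> L2" if "x \<in> L2" for x m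
    using that by (induction m) (auto simp: img L2M)
  have iter: "(?f ^^ m) (?p x) = ?p ((\<phi> ^^ m) x)" if "x \<in> L2" for x m
    by (induction m) (auto simp: induced_apply[OF r] iter_closed[OF that])
  have WL2: "W \<subseteq> ?p ` L2" unfolding W_def using iter iter_closed by auto
  have \<phi>p: "\<phi> (?p x) = \<phi> x" if "x \<in> L2" for x
  proof -
    have c: "?p x \<in> carrier M" "x \<in> carrier M" using q(3)[OF that] that L2M by auto
    have "\<phi> (?p x) \<ominus>\<^bsub>M\<^esub> \<phi> x = \<phi> (?p x \<ominus>\<^bsub>M\<^esub> x)" using h(5)[OF c] by simp
    also have "\<dots> = \<zero>\<^bsub>M\<^esub>" using zero q(7)[OF that] by blast
    finally show ?thesis using h(1) c by (simp add: M.minus_eq_zero_iff)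
  qed
  \<comment> \<open>Elements of \<open>W\<close> are representatives whose sums are again replaced
    by representatives. \<phi> is nevertheless additive on them, because it does not see the
    difference.\<close>
  have g: "(\<lambda>x\<in>W. \<phi> x) \<in> Hom_mod k ((rest \<iota>' ?Q)\<lparr>carrier := W\<rparr>) (rest \<iota> M)"
  proof (rule Hom_modI)
    have WM: "x \<in> L2" "x \<in> carrier M" if "x \<in> W" for x using WL2 that q(3) L2M by auto
    interpret W: module k "(rest \<iota>' ?Q)\<lparr>carrier := W\<rparr>" using W by (rule finite_module_is_module)
    show "(\<lambda>x\<in>W. \<phi> x) x \<in> carrier (rest \<iota> M)" if "x \<in> carrier ((rest \<iota>' ?Q)\<lparr>carrier := W\<rparr>)" for x
      using that WM h(1) by simp
    show "(\<lambda>x\<in>W. \<phi> x) (x \<oplus>\<^bsub>(rest \<iota>' ?Q)\<lparr>carrier := W\<rparr>\<^esub> y) = (\<lambda>x\<in>W. \<phi> x) x \<oplus>\<^bsub>rest \<iota> M\<^esub> (\<lambda>x\<in>W. \<phi> x) y"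
      if "x \<in> carrier ((rest \<iota>' ?Q)\<lparr>carrier := W\<rparr>)" "y \<in> carrier ((rest \<iota>' ?Q)\<lparr>carrier := W\<rparr>)" for x y
      using that W.add.m_closed[OF that] WM q(5) h(2) by (simp add: \<phi>p)
    show "(\<lambda>x\<in>W. \<phi> x) (c \<odot>\<^bsub>(rest \<iota>' ?Q)\<lparr>carrier := W\<rparr>\<^esub> x) = c \<odot>\<^bsub>rest \<iota> M\<^esub> (\<lambda>x\<in>W. \<phi> x) x"
      if "c \<in> carrier k" "x \<in> carrier ((rest \<iota>' ?Q)\<lparr>carrier := W\<rparr>)" for c x
      using that W.smult_closed[OF that] WM q(6) h(3) \<sigma>_r_\<iota> \<iota>_S by (simp add: \<phi>p)
    show "(\<lambda>x\<in>W. \<phi> x) \<in> extensional (carrier ((rest \<iota>' ?Q)\<lparr>carrier := W\<rparr>))" by simp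
  qed
  note kM = module_k[OF M]
  have fin: "finite_module k ((rest \<iota> M)\<lparr>carrier := \<phi> ` W\<rparr>)"
    using finite_module_image[OF W kM g] by simp
  have sub: "submodule ((\<phi> ^^ m) ` carrier M) k (rest \<iota> M)" for m
  proof (induction m)
    case 0
    then show ?case using module.carrier_is_submodule[OF kM] by simp
  next
    case (Suc m)
    then show ?case using submodule_image[OF kM kM \<phi> Suc.IH] by (simp add: image_image)
  qed
  \<comment> \<open>Finite rank follows from inclusion in the image of \<open>W\<close>, since
    \<open>k\<close> is a field.\<close>
  let ?V = "(\<phi> ^^ (n + 2)) ` carrier M"
  have "?V \<subseteq> \<phi> ` W"
  proof
    fix y assume "y \<in> ?V"
    then obtain x where x: "x \<in> carrier M" "y = (\<phi> ^^ (n + 2)) x" by auto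
    have 1: "\<phi> x \<in> L2" using img x by blast
    have "y = \<phi> ((\<phi> ^^ n) (\<phi> x))" using x by (simp add: funpow_swap1)
    also have "\<dots> = \<phi> ((?f ^^ n) (?p (\<phi> x)))" using iter[OF 1] \<phi>p iter_closed[OF 1] by simp
    finally show "y \<in> \<phi> ` W" using 1 unfolding W_def by blast
  qed
  then have "submodule ?V k ((rest \<iota> M)\<lparr>carrier := \<phi> ` W\<rparr>)"
    using sub[of "n + 2"] unfolding module.submodule_iff[OF kM] module.submodule_iff[OF finite_module_is_module[OF fin]]
    by simp
  then have "finite_module k ((rest \<iota> M)\<lparr>carrier := ?V\<rparr>)"
    using finite_module_submodule[OF field_k fin] by simp
  moreover have "(\<phi> [^]\<^bsub>End_ring k (rest \<iota> M)\<^esub> (n + 2)) x = (\<phi> ^^ (n + 2)) x" if "x \<in> carrier M" for x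
    using that h(1) by (intro End_ring_pow) auto
  ultimately have "finite_module k ((rest \<iota> M)\<lparr>carrier := (\<phi> [^]\<^bsub>End_ring k (rest \<iota> M)\<^esub> (n + 2)) ` carrier (rest \<iota> M)\<rparr>)"
    by (simp cong: image_cong_simp)
  then show ?thesis unfolding finite_potent_def by (intro exI[of _ "n + 2"]) simp
qed

subsection \<open>Decomposition of the identity for index \<open>1\<close>\<close>

lemma module_K: "module K (ring_module K)"
  by (rule module_ring_module[OF K.cring_axioms])

lemma S_Lat: "S \<in> Lat K S (ring_module K)"
proof -
  interpret R: module K "ring_module K" by (rule module_K)
  interpret OR: module \<O> "ring_module K" by (rule module_O[OF module_K])
  have s: "submodule S \<O> (ring_module K)" using S_closed by (intro OR.submoduleI') auto
  have "generates \<O> ((ring_module K)\<lparr>carrier := S\<rparr>) {\<one>}"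
    unfolding generates_def
  proof (intro conjI allI impI)
    fix W assume W: "submodule W \<O> ((ring_module K)\<lparr>carrier := S\<rparr>)" "{\<one>} \<subseteq> W"
    note w = module.submoduleD(4)[OF module_carrier_update[OF OR.module_axioms s] W(1)]
    show "carrier ((ring_module K)\<lparr>carrier := S\<rparr>) \<subseteq> W"
      using w[of _ "\<one>"] W(2) S_closed(1) by auto
  qed (use S_closed in auto)
  moreover have "generates K (ring_module K) S"
    unfolding generates_def
  proof (intro conjI allI impI)
    fix W assume W: "submodule W K (ring_module K)" "S \<subseteq> W"
    show "carrier (ring_module K) \<subseteq> W"
      using R.submoduleD(4)[OF W(1), of _ "\<one>"] W(2) S_closed(3) by auto
  qed (use S_closed(1) in auto)
  ultimately show ?thesis using s unfolding Lat_iff[OF module_K] by blast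
qed

text \<open>The projection \<open>p\<close> onto \<open>S\<close> exists because the residue field
  is a field, and it is linear over that field only, so refinability has to be checked by hand:
  \<open>p\<close> is the identity on lattices inside \<open>S\<close>, and lattices containing
  \<open>S\<close> contain its image. The complement \<open>q\<close> vanishes on
  \<open>S\<close>.\<close>

lemma bounded_discrete_decomposition:
  assumes F: "bt_family k \<kappa> \<iota>' B Y"
  defines "R \<equiv> ring_module K"
  shows "\<exists>p\<in>bounded_ops (lift B) R R. \<exists>q\<in>discrete_ops (lift B) R R.
    \<forall>x\<in>carrier K. p x \<oplus> q x = x"
proof -
  note mR = module_K[folded R_def] and SR = S_Lat[folded R_def]
  have R: "carrier R = carrier K" "add R = add K" "smult R = monoid.mult K" "\<zero>\<^bsub>R\<^esub> = \<zero>" by (simp_all add: R_def)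
  have m\<kappa>: "module \<kappa> (rest \<sigma> R)" by (rule module_\<kappa>[OF module_O[OF mR]])
  have "submodule S \<kappa> (rest \<sigma> R)"
    by (rule submodule_rest[OF module_O[OF mR] \<kappa>.cring_axioms \<sigma>_hom Lat_submodule[OF SR]])
  then obtain p where p: "p \<in> Hom_mod \<kappa> (rest \<sigma> R) (rest \<sigma> R)" "\<And>x. x \<in> carrier K \<Longrightarrow> p x \<in> S"
    "\<And>x. x \<in> S \<Longrightarrow> p x = x"
    using projection_exists[OF field_\<kappa> m\<kappa>] R by (metis rest_simps(1))
  note hp = Hom_modD[OF p(1)]
  have pK: "p x \<in> carrier K" if "x \<in> carrier K" for x using p(2)[OF that] S_closed(1) by blast
  define q where "q = (\<lambda>x\<in>carrier K. x \<ominus> p x)"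
  have q: "q \<in> Hom_mod \<kappa> (rest \<sigma> R) (rest \<sigma> R)"
  proof (rule Hom_modI)
    fix x y assume "x \<in> carrier (rest \<sigma> R)" "y \<in> carrier (rest \<sigma> R)"
    then show "q (x \<oplus>\<^bsub>rest \<sigma> R\<^esub> y) = q x \<oplus>\<^bsub>rest \<sigma> R\<^esub> q y"
      using hp(2)[of x y] pK by (simp add: q_def R a_minus_def K.minus_add K.a_ac)
  next
    fix c x assume "c \<in> carrier \<kappa>" "x \<in> carrier (rest \<sigma> R)"
    then show "q (c \<odot>\<^bsub>rest \<sigma> R\<^esub> x) = c \<odot>\<^bsub>rest \<sigma> R\<^esub> q x"
      using hp(3)[of c x] pK \<sigma>_props by (simp add: q_def R a_minus_def K.r_distr K.r_minus)
  qed (use pK in \<open>auto simp: q_def R\<close>)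
  have below: "\<exists>L\<in>Lat K S R. L \<subseteq> L1 \<and> L \<subseteq> L2 \<and> L \<subseteq> S" if "L1 \<in> Lat K S R" "L2 \<in> Lat K S R" for L1 L2
    using Lat_both_below[OF mR that] Lat_both_below[OF mR _ SR] by (meson subset_trans)
  have above: "\<exists>L\<in>Lat K S R. L1 \<subseteq> L \<and> L2 \<subseteq> L \<and> S \<subseteq> L" if "L1 \<in> Lat K S R" "L2 \<in> Lat K S R" for L1 L2
    using Lat_both_above[OF mR that] Lat_both_above[OF mR _ SR] by (meson subset_trans)
  have refp: "refinable R R p"
  proof (rule refinableI)
    fix L1 L2 assume L: "L1 \<in> Lat K S R" "L2 \<in> Lat K S R"
    obtain L where "L \<in> Lat K S R" "L \<subseteq> L1" "L \<subseteq> L2" "L \<subseteq> S" using below[OF L] by blast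
    moreover from this have "p ` L \<subseteq> L2" using p(3) by (auto simp: subset_iff)
    ultimately show "\<exists>L\<in>Lat K S R. L \<subseteq> L1 \<and> p ` L \<subseteq> L2" by blast
    obtain L where "L \<in> Lat K S R" "L2 \<subseteq> L" "S \<subseteq> L" using above[OF L] by blast
    moreover from this have "p ` L1 \<subseteq> L" using p(2) Lat_sub[OF mR L(1)] R by auto
    ultimately show "\<exists>L\<in>Lat K S R. L2 \<subseteq> L \<and> p ` L1 \<subseteq> L" by blast
  qed
  have q0: "q x = \<zero>\<^bsub>R\<^esub>" if "x \<in> S" for x
    using p(3)[OF that] S_closed(1)[OF that] by (simp add: q_def R a_minus_def K.r_neg)
  have refq: "refinable R R q"
  proof (rule refinableI)
    fix L1 L2 assume L: "L1 \<in> Lat K S R" "L2 \<in> Lat K S R"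
    obtain L where "L \<in> Lat K S R" "L \<subseteq> L1" "L \<subseteq> L2" "L \<subseteq> S" using below[OF L] by blast
    moreover from this have "q ` L \<subseteq> L2" using q0 Lat_zero[OF mR L(2)] by auto
    ultimately show "\<exists>L\<in>Lat K S R. L \<subseteq> L1 \<and> q ` L \<subseteq> L2" by blast
    obtain L where L': "L \<in> Lat K S R" "L1 \<subseteq> L" "L2 \<subseteq> L" "S \<subseteq> L" using above[OF L] by blast
    have "q x \<in> L" if x: "x \<in> L1" for x
    proof -
      have xK: "x \<in> carrier K" using Lat_sub[OF mR L(1) x] R by simp
      have "x \<ominus>\<^bsub>R\<^esub> p x \<in> L" using x L' p(2)[OF xK] by (intro Lat_diff[OF mR L'(1)]) auto
      moreover have "x \<ominus>\<^bsub>R\<^esub> p x = q x"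
        using xK pK[OF xK] a_inv_ring_module[OF K.cring_axioms] by (simp add: q_def a_minus_def R_def)
      ultimately show ?thesis by simp
    qed
    then show "\<exists>L\<in>Lat K S R. L2 \<subseteq> L \<and> q ` L1 \<subseteq> L" using L' by blast
  qed
  have "p \<in> bounded_ops (lift B) R R"
    using p(2) R by (intro bounded_opsI[of _ "lift B" R R, OF lift_\<kappa>_linear[OF F mR mR p(1) refp] SR]) simp
  moreover have "q \<in> discrete_ops (lift B) R R"
    using q0 by (intro discrete_opsI[of _ "lift B" R R, OF lift_\<kappa>_linear[OF F mR mR q refq] SR])
  moreover have "p x \<oplus> q x = x" if "x \<in> carrier K" for x
    using that pK[OF that] by (simp add: q_def a_minus_def K.a_comm[of x] K.r_neg2)
  ultimately show ?thesis by blast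
qed

subsection \<open>Digit expansions\<close>

text \<open>Congruence modulo \<open>\<pi>^i\<close>, stated by divisibility to match the form of
  \<open>complete\<close>.\<close>

definition pcong :: "nat \<Rightarrow> 'a \<Rightarrow> 'a \<Rightarrow> bool" where
  "pcong i x y \<longleftrightarrow> (\<exists>z\<in>S. x \<ominus> y = \<pi> [^] i \<otimes> z)"

lemma pcong_zero: "x \<in> S \<Longrightarrow> y \<in> S \<Longrightarrow> pcong 0 x y"
  unfolding pcong_def using S_closed by (intro bexI[of _ "x \<ominus> y"]) auto

lemma pcong_add:
  assumes "pcong i x y" "pcong i u v" "x \<in> S" "y \<in> S" "u \<in> S" "v \<in> S"
  shows "pcong i (x \<oplus> u) (y \<oplus> v)"
proof -
  obtain z w where zw: "z \<in> S" "x \<ominus> y = \<pi> [^] i \<otimes> z" "w \<in> S" "u \<ominus> v = \<pi> [^] i \<otimes> w"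
    using assms unfolding pcong_def by blast
  have c: "x \<in> carrier K" "y \<in> carrier K" "u \<in> carrier K" "v \<in> carrier K" "z \<in> carrier K" "w \<in> carrier K"
    using assms zw S_closed(1) by auto
  have "(x \<oplus> u) \<ominus> (y \<oplus> v) = (x \<ominus> y) \<oplus> (u \<ominus> v)"
    using c by (simp add: a_minus_def K.minus_add K.a_ac)
  also have "\<dots> = \<pi> [^] i \<otimes> (z \<oplus> w)" using zw c by (simp add: K.r_distr)
  finally show ?thesis unfolding pcong_def using zw S_closed(4) by blast
qed

lemma pcong_mult:
  assumes "pcong i x y" "a \<in> S" "x \<in> S" "y \<in> S"
  shows "pcong i (a \<otimes> x) (a \<otimes> y)" "pcong (Suc i) (\<pi> \<otimes> x) (\<pi> \<otimes> y)"
proof -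
  obtain z where z: "z \<in> S" "x \<ominus> y = \<pi> [^] i \<otimes> z"
    using assms unfolding pcong_def by blast
  have c: "x \<in> carrier K" "y \<in> carrier K" "z \<in> carrier K" "a \<in> carrier K" using assms z S_closed(1) by auto
  have d: "b \<otimes> x \<ominus> b \<otimes> y = b \<otimes> (x \<ominus> y)" if "b \<in> carrier K" for b
    using c that by (simp add: a_minus_def K.r_distr K.r_minus)
  have "a \<otimes> x \<ominus> a \<otimes> y = \<pi> [^] i \<otimes> (a \<otimes> z)"
    using d[OF c(4)] z c by (simp add: K.m_lcomm)
  then show "pcong i (a \<otimes> x) (a \<otimes> y)" unfolding pcong_def using S_closed(5)[OF assms(2) z(1)] by blast
  have "\<pi> \<otimes> x \<ominus> \<pi> \<otimes> y = \<pi> [^] Suc i \<otimes> z"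
    using d[OF \<pi>_K] z c by (simp add: K.m_ac)
  then show "pcong (Suc i) (\<pi> \<otimes> x) (\<pi> \<otimes> y)" unfolding pcong_def using z(1) by blast
qed

lemma \<sigma>_zero: "\<sigma> \<zero>\<^bsub>\<kappa>\<^esub> = \<zero>"
  using \<sigma>_props(2,3)[OF \<kappa>.zero_closed] \<kappa>.zero_closed
  by (metis K.add.r_cancel_one' K.zero_closed \<kappa>.l_zero)

lemma inv_pow:
  "inv\<^bsub>K\<^esub> (\<pi> [^] (n::nat)) \<in> carrier K" "\<pi> [^] n \<otimes> inv\<^bsub>K\<^esub> (\<pi> [^] n) = \<one>"
  "inv\<^bsub>K\<^esub> (\<pi> [^] n) \<noteq> \<zero>"
proof -
  have "\<pi> [^] n \<in> Units K" using pow_nz[of n] pow_K[of n] K.field_Units by simp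
  then show "inv\<^bsub>K\<^esub> (\<pi> [^] n) \<in> carrier K" "\<pi> [^] n \<otimes> inv\<^bsub>K\<^esub> (\<pi> [^] n) = \<one>" by simp_all
  then show "inv\<^bsub>K\<^esub> (\<pi> [^] n) \<noteq> \<zero>" by auto
qed

lemma pow_cancel: "x \<in> carrier K \<Longrightarrow> y \<in> carrier K \<Longrightarrow> \<pi> [^] (n::nat) \<otimes> x = \<pi> [^] n \<otimes> y \<longleftrightarrow> x = y"
  using pow_nz by (simp add: K.m_lcancel)

lemma common_pow:
  assumes "x \<in> carrier K" "y \<in> carrier K"
  shows "\<exists>n::nat. \<pi> [^] n \<otimes> x \<in> S \<and> \<pi> [^] n \<otimes> y \<in> S"
proof -
  obtain n m :: nat where nm: "\<pi> [^] n \<otimes> x \<in> S" "\<pi> [^] m \<otimes> y \<in> S" using exhaust assms by blast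
  have "\<pi> [^] (n + m) \<otimes> x = \<pi> [^] m \<otimes> (\<pi> [^] n \<otimes> x)"
    "\<pi> [^] (n + m) \<otimes> y = \<pi> [^] n \<otimes> (\<pi> [^] m \<otimes> y)"
    using assms by (simp_all add: K.nat_pow_mult[symmetric] K.m_ac)
  then show ?thesis using nm pow_S S_closed(5) by metis
qed

text \<open>
  \<open>shift\<close> maps \<open>\<sigma>(a\<^sub>0) + \<sigma>(a\<^sub>1) \<pi> + \<sigma>(a\<^sub>2) \<pi>\<^sup>2 + \<dots>\<close> to \<open>\<sigma>(a\<^sub>1) + \<sigma>(a\<^sub>2) \<pi> + \<dots>\<close>.
\<close>

definition shift :: "'a \<Rightarrow> 'a" where
  "shift x = (SOME y. y \<in> S \<and> x = \<sigma> (r x) \<oplus> \<pi> \<otimes> y)"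

lemma shift:
  assumes x: "x \<in> S"
  shows "shift x \<in> S" "x = \<sigma> (r x) \<oplus> \<pi> \<otimes> shift x"
proof -
  have sr: "r x \<in> carrier \<kappa>" "\<sigma> (r x) \<in> S" using x r_props \<sigma>_props by auto
  have "r (x \<ominus> \<sigma> (r x)) = \<zero>\<^bsub>\<kappa>\<^esub>" using x sr by (simp add: r_minus r_\<sigma> \<kappa>.minus_eq_zero_iff)
  then obtain b where b: "b \<in> S" "x \<ominus> \<sigma> (r x) = \<pi> \<otimes> b"
    using r_kernel[OF S_closed(7)[OF x sr(2)]] by blast
  have "x = \<sigma> (r x) \<oplus> \<pi> \<otimes> b"
    unfolding b(2)[symmetric] using S_closed(1) x sr by (simp add: a_minus_def K.a_comm[of x] K.r_neg2)
  then have "\<exists>y. y \<in> S \<and> x = \<sigma> (r x) \<oplus> \<pi> \<otimes> y" using b(1) by blast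
  then have "shift x \<in> S \<and> x = \<sigma> (r x) \<oplus> \<pi> \<otimes> shift x" unfolding shift_def by (rule someI_ex)
  then show "shift x \<in> S" "x = \<sigma> (r x) \<oplus> \<pi> \<otimes> shift x" by blast+
qed

text \<open>\<open>r\<close> recovers the leading digit, and then \<open>\<pi>\<close> can be
  cancelled. Every rule for \<open>shift\<close> is obtained by exhibiting such a
  decomposition.\<close>

lemma shift_unique:
  assumes "a \<in> carrier \<kappa>" "y \<in> S" "x = \<sigma> a \<oplus> \<pi> \<otimes> y"
  shows "r x = a" "shift x = y"
proof -
  have xS: "x \<in> S" using assms \<sigma>_props(1) S_closed \<pi>_S by simp
  show rx: "r x = a"
    using assms \<sigma>_props(1) S_closed \<pi>_S r_props(1) by (simp add: r_props r_\<sigma> r_\<pi>)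
  have "\<sigma> a \<oplus> \<pi> \<otimes> shift x = \<sigma> a \<oplus> \<pi> \<otimes> y" using shift(2)[OF xS] rx assms(3) by simp
  then have "\<pi> \<otimes> shift x = \<pi> \<otimes> y"
    using \<sigma>_props(2)[OF assms(1)] S_closed(1)[OF shift(1)[OF xS]] S_closed(1)[OF assms(2)]
    by (simp add: K.add.l_cancel)
  then show "shift x = y" using \<pi>_nz shift(1)[OF xS] assms(2) S_closed(1) by (simp add: K.m_lcancel)
qed

lemma shift_add:
  assumes "x \<in> S" "y \<in> S"
  shows "shift (x \<oplus> y) = shift x \<oplus> shift y"
proof (rule shift_unique(2))
  have c: "shift x \<in> carrier K" "shift y \<in> carrier K" "\<sigma> (r x) \<in> carrier K" "\<sigma> (r y) \<in> carrier K"
    using shift(1) assms S_closed(1) \<sigma>_props(2) r_props(1) by auto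
  have "x \<oplus> y = (\<sigma> (r x) \<oplus> \<pi> \<otimes> shift x) \<oplus> (\<sigma> (r y) \<oplus> \<pi> \<otimes> shift y)"
    using shift(2)[OF assms(1)] shift(2)[OF assms(2)] by simp
  also have "\<dots> = (\<sigma> (r x) \<oplus> \<sigma> (r y)) \<oplus> \<pi> \<otimes> (shift x \<oplus> shift y)"
    using c by (simp add: K.r_distr K.a_ac)
  finally show "x \<oplus> y = \<sigma> (r x \<oplus>\<^bsub>\<kappa>\<^esub> r y) \<oplus> \<pi> \<otimes> (shift x \<oplus> shift y)"
    using \<sigma>_props(3) r_props(1) assms by simp
qed (use assms r_props(1) shift(1) S_closed(4) in auto)

lemma shift_smult:
  assumes "x \<in> S" "a \<in> carrier \<kappa>"
  shows "shift (\<sigma> a \<otimes> x) = \<sigma> a \<otimes> shift x"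
proof (rule shift_unique(2))
  have c: "shift x \<in> carrier K" "\<sigma> (r x) \<in> carrier K" "\<sigma> a \<in> carrier K"
    using shift(1) assms S_closed(1) \<sigma>_props(2) r_props(1) by auto
  have "\<sigma> a \<otimes> x = \<sigma> a \<otimes> (\<sigma> (r x) \<oplus> \<pi> \<otimes> shift x)" using shift(2)[OF assms(1)] by simp
  also have "\<dots> = \<sigma> a \<otimes> \<sigma> (r x) \<oplus> \<pi> \<otimes> (\<sigma> a \<otimes> shift x)"
    using c by (simp add: K.r_distr K.m_lcomm)
  finally show "\<sigma> a \<otimes> x = \<sigma> (a \<otimes>\<^bsub>\<kappa>\<^esub> r x) \<oplus> \<pi> \<otimes> (\<sigma> a \<otimes> shift x)"
    using \<sigma>_props(4) r_props(1) assms by simp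
qed (use assms r_props(1) shift(1) S_closed(5) \<sigma>_props(1) in auto)

lemma shift_\<pi>:
  assumes "x \<in> S"
  shows "shift (\<pi> \<otimes> x) = x" "r (\<pi> \<otimes> x) = \<zero>\<^bsub>\<kappa>\<^esub>"
proof -
  have "\<pi> \<otimes> x = \<sigma> \<zero>\<^bsub>\<kappa>\<^esub> \<oplus> \<pi> \<otimes> x" using assms S_closed(1) by (simp add: \<sigma>_zero)
  then show "shift (\<pi> \<otimes> x) = x" "r (\<pi> \<otimes> x) = \<zero>\<^bsub>\<kappa>\<^esub>"
    using shift_unique[OF \<kappa>.zero_closed assms] by auto
qed

lemma iter_S: "x \<in> S \<Longrightarrow> (shift ^^ n) x \<in> S"
  by (induction n) (auto simp: shift(1))

lemma iter_add: "x \<in> S \<Longrightarrow> y \<in> S \<Longrightarrow> (shift ^^ n) (x \<oplus> y) = (shift ^^ n) x \<oplus> (shift ^^ n) y"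
  by (induction n) (auto simp: shift_add iter_S)

lemma iter_smult: "x \<in> S \<Longrightarrow> a \<in> carrier \<kappa> \<Longrightarrow> (shift ^^ n) (\<sigma> a \<otimes> x) = \<sigma> a \<otimes> (shift ^^ n) x"
  by (induction n) (auto simp: shift_smult iter_S)

lemma iter_\<pi>: "x \<in> S \<Longrightarrow> (shift ^^ Suc n) (\<pi> \<otimes> x) = (shift ^^ n) x"
  by (simp add: funpow_swap1 shift_\<pi>)

definition digit :: "nat \<Rightarrow> 'a \<Rightarrow> 'a" where
  "digit n x = r ((shift ^^ n) x)"

lemma digit_closed: "x \<in> S \<Longrightarrow> digit n x \<in> carrier \<kappa>"
  by (simp add: digit_def r_props iter_S)

lemma digit_add: "x \<in> S \<Longrightarrow> y \<in> S \<Longrightarrow> digit n (x \<oplus> y) = digit n x \<oplus>\<^bsub>\<kappa>\<^esub> digit n y"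
  by (simp add: digit_def r_props iter_S iter_add)

text \<open>Multiplicativity of \<open>\<sigma>\<close> makes scalars from the residue field act
  digit by digit, without carries. Together with additivity, reading off a digit is linear over the
  residue field.\<close>

lemma digit_smult: "x \<in> S \<Longrightarrow> a \<in> carrier \<kappa> \<Longrightarrow> digit n (\<sigma> a \<otimes> x) = a \<otimes>\<^bsub>\<kappa>\<^esub> digit n x"
  by (simp add: digit_def r_props iter_S iter_smult \<sigma>_props r_\<sigma>)

lemma digit_\<pi>: "x \<in> S \<Longrightarrow> digit 0 (\<pi> \<otimes> x) = \<zero>\<^bsub>\<kappa>\<^esub>" "x \<in> S \<Longrightarrow> digit (Suc n) (\<pi> \<otimes> x) = digit n x"
  using iter_\<pi> by (simp_all add: digit_def shift_\<pi>)

lemma digit_pow: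
  assumes "x \<in> S" "i < n"
  shows "digit i (\<pi> [^] n \<otimes> x) = \<zero>\<^bsub>\<kappa>\<^esub>"
  using assms(2)
proof (induction n arbitrary: i)
  case (Suc n)
  have c: "\<pi> [^] n \<otimes> x \<in> S" using pow_S assms(1) S_closed(5) by blast
  have "\<pi> [^] Suc n \<otimes> x = \<pi> \<otimes> (\<pi> [^] n \<otimes> x)"
    using assms(1) S_closed(1) by (simp add: K.m_ac)
  then show ?case using Suc digit_\<pi>[OF c] by (cases i) auto
qed simp

section \<open>Applying an operator on the residue field to every digit\<close>

primrec digit_sum :: "('a \<Rightarrow> 'a) \<Rightarrow> nat \<Rightarrow> 'a \<Rightarrow> 'a" where
  "digit_sum e 0 x = \<zero>"
| "digit_sum e (Suc n) x = digit_sum e n x \<oplus> \<pi> [^] n \<otimes> \<sigma> (e (digit n x))"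

text \<open>The limit of the partial sums, characterized by congruences; the sum of the first
  \<open>i\<close> terms determines it modulo \<open>\<pi>^i\<close>.\<close>

definition digitwise_int :: "('a \<Rightarrow> 'a) \<Rightarrow> 'a \<Rightarrow> 'a" where
  "digitwise_int e x = (THE z. z \<in> S \<and> (\<forall>i. pcong i z (digit_sum e i x)))"

context
  fixes e :: "'a \<Rightarrow> 'a"
  assumes e: "e \<in> Hom_mod k (rest \<iota>' (ring_module \<kappa>)) (rest \<iota>' (ring_module \<kappa>))"
begin

lemma e_props:
  "a \<in> carrier \<kappa> \<Longrightarrow> e a \<in> carrier \<kappa>"
  "a \<in> carrier \<kappa> \<Longrightarrow> b \<in> carrier \<kappa> \<Longrightarrow> e (a \<oplus>\<^bsub>\<kappa>\<^esub> b) = e a \<oplus>\<^bsub>\<kappa>\<^esub> e b"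
  "c \<in> carrier k \<Longrightarrow> a \<in> carrier \<kappa> \<Longrightarrow> e (\<iota>' c \<otimes>\<^bsub>\<kappa>\<^esub> a) = \<iota>' c \<otimes>\<^bsub>\<kappa>\<^esub> e a"
  "e \<zero>\<^bsub>\<kappa>\<^esub> = \<zero>\<^bsub>\<kappa>\<^esub>"
proof -
  note h = Hom_modD[OF e]
  show "a \<in> carrier \<kappa> \<Longrightarrow> e a \<in> carrier \<kappa>" for a using h(1) by simp
  show 2: "a \<in> carrier \<kappa> \<Longrightarrow> b \<in> carrier \<kappa> \<Longrightarrow> e (a \<oplus>\<^bsub>\<kappa>\<^esub> b) = e a \<oplus>\<^bsub>\<kappa>\<^esub> e b" for a b using h(2) by simp
  show "c \<in> carrier k \<Longrightarrow> a \<in> carrier \<kappa> \<Longrightarrow> e (\<iota>' c \<otimes>\<^bsub>\<kappa>\<^esub> a) = \<iota>' c \<otimes>\<^bsub>\<kappa>\<^esub> e a" using h(3) by simp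
  have "e \<zero>\<^bsub>\<kappa>\<^esub> \<oplus>\<^bsub>\<kappa>\<^esub> e \<zero>\<^bsub>\<kappa>\<^esub> = e \<zero>\<^bsub>\<kappa>\<^esub>" "e \<zero>\<^bsub>\<kappa>\<^esub> \<in> carrier \<kappa>"
    using 2[of "\<zero>\<^bsub>\<kappa>\<^esub>" "\<zero>\<^bsub>\<kappa>\<^esub>"] h(1) by simp_all
  then show "e \<zero>\<^bsub>\<kappa>\<^esub> = \<zero>\<^bsub>\<kappa>\<^esub>" by (metis \<kappa>.add.r_cancel_one')
qed

lemma digit_sum_S: "x \<in> S \<Longrightarrow> digit_sum e n x \<in> S"
  by (induction n) (auto simp: S_closed pow_S \<sigma>_props e_props digit_closed)

lemma digit_sum_K: "x \<in> S \<Longrightarrow> digit_sum e n x \<in> carrier K"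
  using digit_sum_S S_closed(1) by blast

lemma term_S: "x \<in> S \<Longrightarrow> \<sigma> (e (digit n x)) \<in> S" "x \<in> S \<Longrightarrow> \<sigma> (e (digit n x)) \<in> carrier K"
  by (auto simp: \<sigma>_props e_props digit_closed)

lemma digit_sum_add: "x \<in> S \<Longrightarrow> y \<in> S \<Longrightarrow> digit_sum e n (x \<oplus> y) = digit_sum e n x \<oplus> digit_sum e n y"
proof (induction n)
  case (Suc n)
  then show ?case
    using digit_sum_K[of x n] digit_sum_K[of y n] term_S(2)[of x n] term_S(2)[of y n]
    by (simp add: digit_add e_props digit_closed \<sigma>_props K.r_distr K.a_ac)
qed simp

text \<open>Scalars from \<open>k\<close> are their own lifts, so they act on each digit through the
  residue field, and \<open>e\<close> commutes with them.\<close>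

lemma digit_sum_smult: "x \<in> S \<Longrightarrow> c \<in> carrier k \<Longrightarrow> digit_sum e n (\<iota> c \<otimes> x) = \<iota> c \<otimes> digit_sum e n x"
proof (induction n)
  case 0
  then show ?case using \<iota>_S S_closed(1) by simp
next
  case (Suc n)
  have c: "\<iota>' c \<in> carrier \<kappa>" "\<sigma> (\<iota>' c) = \<iota> c" "\<iota> c \<in> carrier K"
    using Suc.prems ring_hom_closed[OF \<iota>'_hom] \<sigma>_r_\<iota> \<iota>_S S_closed(1) by auto
  have "\<sigma> (e (digit n (\<iota> c \<otimes> x))) = \<iota> c \<otimes> \<sigma> (e (digit n x))"
    using digit_smult[OF Suc.prems(1) c(1), of n] e_props(3)[OF Suc.prems(2) digit_closed[OF Suc.prems(1)], of n]
      \<sigma>_props(4)[OF c(1) e_props(1)[OF digit_closed[OF Suc.prems(1)]], of n] c(2) by simp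
  then show ?case
    using Suc digit_sum_K[of x n] term_S(2)[of x n] c(3) by (simp add: K.r_distr K.m_lcomm)
qed

text \<open>Multiplication by \<open>\<pi>\<close> moves the digits one place up and inserts the
  digit zero, which \<open>e\<close> fixes. This shift is why the index grows by one.\<close>

lemma digit_sum_\<pi>: "x \<in> S \<Longrightarrow> digit_sum e (Suc n) (\<pi> \<otimes> x) = \<pi> \<otimes> digit_sum e n x"
proof (induction n)
  case 0
  then show ?case by (simp add: digit_\<pi> e_props \<sigma>_zero)
next
  case (Suc n)
  have "digit_sum e (Suc (Suc n)) (\<pi> \<otimes> x) =
      \<pi> \<otimes> digit_sum e n x \<oplus> \<pi> [^] Suc n \<otimes> \<sigma> (e (digit n x))"
    using Suc digit_\<pi>(2)[of x n] by (simp del: K.nat_pow_Suc)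
  also have "\<dots> = \<pi> \<otimes> digit_sum e (Suc n) x"
    using digit_sum_K[of x n] term_S(2)[of x n] Suc.prems by (simp add: K.r_distr K.m_ac)
  finally show ?case .
qed

text \<open>Consecutive partial sums differ by a multiple of \<open>\<pi>^i\<close>, so completeness
  gives a unique limit. The uniqueness in the last claim is the device for proving identities of
  limits: it suffices to compare partial sums.\<close>

lemma digitwise_int:
  assumes x: "x \<in> S"
  shows "digitwise_int e x \<in> S" "pcong i (digitwise_int e x) (digit_sum e i x)"
    "z \<in> S \<Longrightarrow> (\<And>i. pcong i z (digit_sum e i x)) \<Longrightarrow> digitwise_int e x = z"
proof -
  have "\<exists>!z. z \<in> S \<and> (\<forall>i. pcong i z (digit_sum e i x))"
    unfolding pcong_def
  proof (rule complete)
    fix i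
    show "digit_sum e i x \<in> S" by (rule digit_sum_S[OF x])
    have "digit_sum e (Suc i) x \<ominus> digit_sum e i x = \<pi> [^] i \<otimes> \<sigma> (e (digit i x))"
      using digit_sum_K[OF x, of i] term_S(2)[OF x, of i]
      by (simp add: a_minus_def K.a_comm[of "digit_sum e i x"] K.a_assoc K.r_neg)
    then show "\<exists>y\<in>S. digit_sum e (Suc i) x \<ominus> digit_sum e i x = \<pi> [^] i \<otimes> y"
      using term_S(1)[OF x] by blast
  qed
  from theI'[OF this] the1_equality[OF this]
  show "digitwise_int e x \<in> S" "pcong i (digitwise_int e x) (digit_sum e i x)"
    "z \<in> S \<Longrightarrow> (\<And>i. pcong i z (digit_sum e i x)) \<Longrightarrow> digitwise_int e x = z"
    unfolding digitwise_int_def by blast+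
qed

lemma digitwise_int_add:
  assumes "x \<in> S" "y \<in> S"
  shows "digitwise_int e (x \<oplus> y) = digitwise_int e x \<oplus> digitwise_int e y"
  using assms
  by (intro digitwise_int(3)) (auto simp: S_closed digitwise_int(1) digit_sum_add intro!: pcong_add digitwise_int(2) digit_sum_S)

lemma digitwise_int_smult:
  assumes "x \<in> S" "c \<in> carrier k"
  shows "digitwise_int e (\<iota> c \<otimes> x) = \<iota> c \<otimes> digitwise_int e x"
  using assms \<iota>_S
  by (intro digitwise_int(3)) (auto simp: S_closed digitwise_int(1) digit_sum_smult intro!: pcong_mult(1) digitwise_int(2) digit_sum_S)

lemma digitwise_int_\<pi>:
  assumes "x \<in> S"
  shows "digitwise_int e (\<pi> \<otimes> x) = \<pi> \<otimes> digitwise_int e x"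
proof (rule digitwise_int(3))
  fix i
  show "pcong i (\<pi> \<otimes> digitwise_int e x) (digit_sum e i (\<pi> \<otimes> x))"
  \<comment> \<open>\<open>digit_sum_\<pi>\<close> speaks about successor indices only; a congruence
    modulo \<open>\<pi>^0\<close> holds for any two elements of \<open>S\<close>.\<close>
  proof (cases i)
    case 0
    then show ?thesis using assms digitwise_int(1) \<pi>_S S_closed by (auto intro!: pcong_zero digit_sum_S)
  next
    case (Suc j)
    then show ?thesis using pcong_mult(2)[OF digitwise_int(2)[OF assms, of j] \<pi>_S digitwise_int(1)[OF assms] digit_sum_S[OF assms]]
      by (simp only: digit_sum_\<pi>[OF assms])
  qed
qed (use assms digitwise_int(1) \<pi>_S S_closed in auto)

lemma digitwise_int_pow:
  assumes "x \<in> S"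
  shows "digitwise_int e (\<pi> [^] (n::nat) \<otimes> x) = \<pi> [^] n \<otimes> digitwise_int e x"
proof (induction n)
  case 0
  then show ?case using assms digitwise_int(1)[OF assms] S_closed(1) by simp
next
  case (Suc n)
  have c: "\<pi> [^] n \<otimes> x \<in> S" using pow_S assms S_closed(5) by blast
  have x: "x \<in> carrier K" "digitwise_int e x \<in> carrier K" using assms digitwise_int(1)[OF assms] S_closed(1) by auto
  have "\<pi> [^] Suc n \<otimes> x = \<pi> \<otimes> (\<pi> [^] n \<otimes> x)" using x by (simp add: K.m_ac)
  then show ?case using digitwise_int_\<pi>[OF c] Suc x by (simp add: K.m_ac)
qed

text \<open>Elements of \<open>K\<close> are moved into \<open>S\<close> by a power of
  \<open>\<pi>\<close> and back. Since the operator on \<open>S\<close> commutes with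
  \<open>\<pi>\<close>, the arbitrary exponent has no influence.\<close>

definition digitwise :: "'a \<Rightarrow> 'a" where
  "digitwise = (\<lambda>x\<in>carrier K. let n = (SOME n::nat. \<pi> [^] n \<otimes> x \<in> S) in
     inv\<^bsub>K\<^esub> (\<pi> [^] n) \<otimes> digitwise_int e (\<pi> [^] n \<otimes> x))"

text \<open>Both the chosen exponent and \<open>m\<close> can be pulled through the operator on
  \<open>S\<close>; comparing the two results and cancelling a power of \<open>\<pi>\<close> frees
  the description from the choice.\<close>

lemma digitwise_char:
  assumes x: "x \<in> carrier K"
  shows "digitwise x \<in> carrier K" "\<pi> [^] (m::nat) \<otimes> x \<in> S \<Longrightarrow> \<pi> [^] m \<otimes> digitwise x = digitwise_int e (\<pi> [^] m \<otimes> x)"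
proof -
  define n where "n = (SOME n::nat. \<pi> [^] n \<otimes> x \<in> S)"
  have n: "\<pi> [^] n \<otimes> x \<in> S" unfolding n_def by (rule someI_ex[OF exhaust[OF x]])
  have e0: "digitwise_int e (\<pi> [^] n \<otimes> x) \<in> carrier K" using digitwise_int(1)[OF n] S_closed(1) by blast
  have eq: "digitwise x = inv\<^bsub>K\<^esub> (\<pi> [^] n) \<otimes> digitwise_int e (\<pi> [^] n \<otimes> x)"
    using x by (simp add: digitwise_def n_def Let_def)
  show c: "digitwise x \<in> carrier K" unfolding eq using inv_pow(1) e0 by simp
  have n': "\<pi> [^] n \<otimes> digitwise x = digitwise_int e (\<pi> [^] n \<otimes> x)"
    unfolding eq using inv_pow e0 by (simp add: K.m_assoc[symmetric])
  assume m: "\<pi> [^] m \<otimes> x \<in> S"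
  have "\<pi> [^] n \<otimes> (\<pi> [^] m \<otimes> digitwise x) = \<pi> [^] m \<otimes> (\<pi> [^] n \<otimes> digitwise x)"
    using c by (simp add: K.m_lcomm)
  also have "\<dots> = digitwise_int e (\<pi> [^] m \<otimes> (\<pi> [^] n \<otimes> x))" using n' digitwise_int_pow[OF n] by simp
  also have "\<pi> [^] m \<otimes> (\<pi> [^] n \<otimes> x) = \<pi> [^] n \<otimes> (\<pi> [^] m \<otimes> x)"
    using x by (simp add: K.m_lcomm)
  finally have "\<pi> [^] n \<otimes> (\<pi> [^] m \<otimes> digitwise x) = \<pi> [^] n \<otimes> digitwise_int e (\<pi> [^] m \<otimes> x)"
    by (simp only: digitwise_int_pow[OF m])
  then show "\<pi> [^] m \<otimes> digitwise x = digitwise_int e (\<pi> [^] m \<otimes> x)"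
    using pow_cancel c digitwise_int(1)[OF m] S_closed(1) by simp
qed

lemma digitwise_hom: "digitwise \<in> Hom_mod k (rest \<iota> (ring_module K)) (rest \<iota> (ring_module K))"
proof (rule Hom_modI)
  fix x y assume "x \<in> carrier (rest \<iota> (ring_module K))" "y \<in> carrier (rest \<iota> (ring_module K))"
  then have xy: "x \<in> carrier K" "y \<in> carrier K" by simp_all
  obtain n :: nat where n: "\<pi> [^] n \<otimes> x \<in> S" "\<pi> [^] n \<otimes> y \<in> S" using common_pow[OF xy] by blast
  have s: "\<pi> [^] n \<otimes> (x \<oplus> y) = \<pi> [^] n \<otimes> x \<oplus> \<pi> [^] n \<otimes> y"
    using xy by (simp add: K.r_distr)
  then have "\<pi> [^] n \<otimes> digitwise (x \<oplus> y) = digitwise_int e (\<pi> [^] n \<otimes> (x \<oplus> y))"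
    using n S_closed(4) xy by (intro digitwise_char(2)) auto
  also have "\<dots> = \<pi> [^] n \<otimes> digitwise x \<oplus> \<pi> [^] n \<otimes> digitwise y"
    unfolding s using digitwise_int_add[OF n] digitwise_char(2)[OF xy(1) n(1)] digitwise_char(2)[OF xy(2) n(2)] by simp
  also have "\<dots> = \<pi> [^] n \<otimes> (digitwise x \<oplus> digitwise y)"
    using xy digitwise_char(1) by (simp add: K.r_distr)
  finally show "digitwise (x \<oplus>\<^bsub>rest \<iota> (ring_module K)\<^esub> y) = digitwise x \<oplus>\<^bsub>rest \<iota> (ring_module K)\<^esub> digitwise y"
    using pow_cancel xy digitwise_char(1) by simp
next
  fix c x assume c: "c \<in> carrier k" and "x \<in> carrier (rest \<iota> (ring_module K))"
  then have x: "x \<in> carrier K" by simp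
  have cK: "\<iota> c \<in> carrier K" using \<iota>_S[OF c] S_closed(1) by blast
  obtain n :: nat where n: "\<pi> [^] n \<otimes> x \<in> S" using exhaust[OF x] by blast
  have s: "\<pi> [^] n \<otimes> (\<iota> c \<otimes> x) = \<iota> c \<otimes> (\<pi> [^] n \<otimes> x)"
    using x cK by (simp add: K.m_lcomm)
  then have "\<pi> [^] n \<otimes> digitwise (\<iota> c \<otimes> x) = digitwise_int e (\<pi> [^] n \<otimes> (\<iota> c \<otimes> x))"
    using n S_closed(5)[OF \<iota>_S[OF c]] x cK by (intro digitwise_char(2)) auto
  also have "\<dots> = \<iota> c \<otimes> (\<pi> [^] n \<otimes> digitwise x)"
    unfolding s using digitwise_int_smult[OF n c] digitwise_char(2)[OF x n] by simp
  also have "\<dots> = \<pi> [^] n \<otimes> (\<iota> c \<otimes> digitwise x)"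
    using x cK digitwise_char(1) by (simp add: K.m_lcomm)
  finally show "digitwise (c \<odot>\<^bsub>rest \<iota> (ring_module K)\<^esub> x) = c \<odot>\<^bsub>rest \<iota> (ring_module K)\<^esub> digitwise x"
    using pow_cancel x cK digitwise_char(1) by simp
next
  show "digitwise \<in> extensional (carrier (rest \<iota> (ring_module K)))" by (simp add: digitwise_def)
qed (simp add: digitwise_char(1))

end

subsection \<open>Balls\<close>

text \<open>The ball \<open>\<pi>^-n O\<close>, written without an inverse because the digits of its
  elements are read from \<open>\<pi>^n x\<close>.\<close>

definition outer :: "nat \<Rightarrow> 'a set" where
  "outer n = {x \<in> carrier K. \<pi> [^] n \<otimes> x \<in> S}"

definition inner :: "nat \<Rightarrow> 'a set" where
  "inner n = (\<lambda>x. \<pi> [^] n \<otimes> x) ` S"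

lemma outer_eq: "outer n = (\<lambda>x. inv\<^bsub>K\<^esub> (\<pi> [^] n) \<otimes> x) ` S"
proof
  note i = inv_pow[of n]
  show "outer n \<subseteq> (\<lambda>x. inv\<^bsub>K\<^esub> (\<pi> [^] n) \<otimes> x) ` S"
  proof
    fix x assume x: "x \<in> outer n"
    then have "x = inv\<^bsub>K\<^esub> (\<pi> [^] n) \<otimes> (\<pi> [^] n \<otimes> x)"
      using i by (simp add: outer_def K.m_assoc[symmetric] K.m_comm[of "inv\<^bsub>K\<^esub> (\<pi> [^] n)"])
    then show "x \<in> (\<lambda>x. inv\<^bsub>K\<^esub> (\<pi> [^] n) \<otimes> x) ` S" using x unfolding outer_def by blast
  qed
  show "(\<lambda>x. inv\<^bsub>K\<^esub> (\<pi> [^] n) \<otimes> x) ` S \<subseteq> outer n"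
    using i S_closed(1) by (auto simp: outer_def K.m_assoc[symmetric])
qed

lemma outer_Lat: "outer n \<in> Lat K S (ring_module K)"
  using Lat_scale[OF module_K S_Lat inv_pow(1,3)[of n]] by (simp add: outer_eq)

lemma inner_Lat: "inner n \<in> Lat K S (ring_module K)"
  using Lat_scale[OF module_K S_Lat pow_K pow_nz, of n] by (simp add: inner_def)

lemma inner_outer: "inner n \<subseteq> outer m"
  using pow_S[of n] pow_S[of m] S_closed by (auto simp: inner_def outer_def)

text \<open>Balls are cofinal among lattices in both directions. The claim is made for all large
  \<open>n\<close>, so that one radius serves several lattices.\<close>

lemma Lat_sandwich:
  assumes "L \<in> Lat K S (ring_module K)"
  shows "\<exists>N. \<forall>n\<ge>N. inner n \<subseteq> L \<and> L \<subseteq> outer n"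
proof -
  interpret OR: module \<O> "ring_module K" by (rule module_O[OF module_K])
  note l = OR.submoduleD[OF Lat_submodule[OF assms]]
  obtain n :: nat where n: "\<forall>x\<in>S. \<pi> [^] n \<otimes> x \<in> L"
    using Lat_absorb[OF module_K module_K Hom_mod_id[OF module_K] S_Lat assms] S_closed(1) by auto
  obtain m :: nat where m: "\<forall>x\<in>L. \<pi> [^] m \<otimes> x \<in> S"
    using Lat_absorb[OF module_K module_K Hom_mod_id[OF module_K] assms S_Lat] l(1) by (auto simp: subset_iff)
  have "inner i \<subseteq> L \<and> L \<subseteq> outer i" if i: "i \<ge> n + m" for i
  proof
    show "inner i \<subseteq> L"
    proof
      fix x assume "x \<in> inner i"
      then obtain s where s: "s \<in> S" "x = \<pi> [^] i \<otimes> s" by (auto simp: inner_def)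
      have "\<pi> [^] i = \<pi> [^] n \<otimes> \<pi> [^] (i - n)" using i by (simp add: K.nat_pow_mult)
      then have "x = \<pi> [^] n \<otimes> (\<pi> [^] (i - n) \<otimes> s)" using s S_closed(1) by (simp add: K.m_assoc)
      then show "x \<in> L" using n S_closed(5)[OF pow_S s(1)] by simp
    qed
    show "L \<subseteq> outer i"
    proof
      fix x assume x: "x \<in> L"
      have xK: "x \<in> carrier K" using x l(1) by auto
      have "\<pi> [^] i = \<pi> [^] (i - m) \<otimes> \<pi> [^] m" using i by (simp add: K.nat_pow_mult)
      then have "\<pi> [^] i \<otimes> x = \<pi> [^] (i - m) \<otimes> (\<pi> [^] m \<otimes> x)" using xK by (simp add: K.m_assoc)
      then show "x \<in> outer i" using m x xK S_closed(5)[OF pow_S] by (simp add: outer_def)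
    qed
  qed
  then show ?thesis by blast
qed

subsection \<open>Digitwise operators\<close>

lemma digitwise_balls:
  assumes "e \<in> Hom_mod k (rest \<iota>' (ring_module \<kappa>)) (rest \<iota>' (ring_module \<kappa>))"
  shows "x \<in> outer n \<Longrightarrow> digitwise e x \<in> outer n" "x \<in> inner n \<Longrightarrow> digitwise e x \<in> inner n"
proof -
  assume "x \<in> outer n"
  then show "digitwise e x \<in> outer n"
    using digitwise_char[OF assms] digitwise_int(1)[OF assms] by (simp add: outer_def)
next
  assume "x \<in> inner n"
  then obtain s where s: "s \<in> S" "x = \<pi> [^] n \<otimes> s" by (auto simp: inner_def)
  have xS: "x \<in> S" using s pow_S S_closed(5) by simp
  have "digitwise e x = digitwise_int e x"
    using digitwise_char(2)[OF assms S_closed(1)[OF xS], of 0]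
      digitwise_char(1)[OF assms S_closed(1)[OF xS]] xS S_closed(1)[OF xS] by simp
  also have "\<dots> = \<pi> [^] n \<otimes> digitwise_int e s" using digitwise_int_pow[OF assms s(1)] s(2) by simp
  finally show "digitwise e x \<in> inner n" using digitwise_int(1)[OF assms s(1)] by (simp add: inner_def)
qed

text \<open>Balls are preserved, so by \<open>Lat_sandwich\<close> only the quotients
  \<open>outer n / inner n\<close> have to be examined. There the operator involves 2 n digits and
  is a finite sum of composites through the residue field, with \<open>e\<close> in the
  middle.\<close>

lemma digitwise_lift:
  assumes F: "bt_family k \<kappa> \<iota>' B Y" and eY: "e \<in> Y (ring_module \<kappa>) (ring_module \<kappa>)"
  defines "R \<equiv> ring_module K"
  shows "digitwise e \<in> lift Y R R"
proof -
  note fin\<kappa> = finite_ring_module[OF field_\<kappa>]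
  have R: "carrier R = carrier K" "add R = add K" "smult R = monoid.mult K" "\<zero>\<^bsub>R\<^esub> = \<zero>" by (simp_all add: R_def)
  note mR = module_K[folded R_def] and oL = outer_Lat[folded R_def] and iL = inner_Lat[folded R_def]
  note D = bt_familyD[OF F]
  have e: "e \<in> Hom_mod k (rest \<iota>' (ring_module \<kappa>)) (rest \<iota>' (ring_module \<kappa>))"
    using D(1,2)[OF fin\<kappa> fin\<kappa>] eY by blast
  note balls = digitwise_balls[OF e]
  note hom = digitwise_hom[OF e, folded R_def]
  have r: "refines R R (digitwise e) (inner n) (outer n) (outer n) (inner n)" for n
    by (rule refinesI[OF mR mR hom iL oL oL iL inner_outer inner_outer balls(2,1)])
  have key: "induced_map R R (digitwise e) (inner n, outer n) (outer n, inner n) \<in>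
    Y (lattice_quot \<sigma> R (outer n) (inner n)) (lattice_quot \<sigma> R (outer n) (inner n))" for n
  proof -
    let ?V = "lattice_quot \<sigma> R (outer n) (inner n)" and ?p = "quot_module_proj R (inner n)"
    let ?i = "inv\<^bsub>K\<^esub> (\<pi> [^] n)"
    note i = inv_pow[of n]
    have i': "?i \<otimes> (\<pi> [^] n \<otimes> x) = x" if "x \<in> carrier K" for x
      using i that by (simp add: K.m_assoc[symmetric] K.m_comm[of ?i])
    note q = quot_ops[OF mR oL[of n] iL[of n] inner_outer[of n n], unfolded R]
    note finV = refines_quot(1)[OF r[of n]]
    have V: "v \<in> outer n" "v \<in> carrier K" "\<pi> [^] n \<otimes> v \<in> S" if "v \<in> carrier ?V" for v
    proof -
      show "v \<in> outer n" using that q(3) by auto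
      then show "v \<in> carrier K" "\<pi> [^] n \<otimes> v \<in> S" by (simp_all add: outer_def)
    qed
    have iS: "?i \<otimes> s \<in> outer n" if "s \<in> S" for s using that outer_eq by blast
    \<comment> \<open>The truncation to the first \<open>m\<close> digits. Each summand is added
      within the ideal, up to the 2 n digits that determine a class.\<close>
    define T where "T m = (\<lambda>v\<in>carrier ?V. ?p (?i \<otimes> digit_sum e m (\<pi> [^] n \<otimes> v)))" for m
    have "T m \<in> Y ?V ?V" if "m \<le> 2 * n" for m
      using that
    proof (induction m)
      case 0
      have "T 0 = (\<lambda>v\<in>carrier ?V. \<zero>\<^bsub>?V\<^esub>)" using i(1) by (simp add: T_def R cong: restrict_cong)
      then show ?case using D(4)[OF finV finV] by (simp only:)
    next
      case (Suc m)
      \<comment> \<open>\<open>d\<close> reads the digit number \<open>m\<close> of an element of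
        the quotient and \<open>j\<close> inserts a digit at that place; with them the new summand
        is \<open>j\<close>, \<open>e\<close>, \<open>d\<close> composed.\<close>
      define d where "d = (\<lambda>v\<in>carrier ?V. digit m (\<pi> [^] n \<otimes> v))"
      define j where "j = (\<lambda>a\<in>carrier \<kappa>. ?p (?i \<otimes> (\<pi> [^] m \<otimes> \<sigma> a)))"
      \<comment> \<open>Changing \<open>x\<close> by \<open>\<pi>^n s\<close> changes
        \<open>\<pi>^n x\<close> by \<open>\<pi>^(2 n) s\<close>, which leaves the digits below 2 n
        alone. Hence \<open>d\<close> respects the quotient.\<close>
      have dp: "digit m (\<pi> [^] n \<otimes> ?p x) = digit m (\<pi> [^] n \<otimes> x)" if x: "x \<in> outer n" for x
      proof -
        have c: "x \<in> carrier K" "?p x \<in> carrier K" using x q(3)[OF x] by (auto simp: outer_def)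
        have "?p x \<ominus>\<^bsub>R\<^esub> x = ?p x \<ominus> x"
          using a_inv_ring_module[OF K.cring_axioms c(1)] by (simp add: a_minus_def R_def)
        then have "?p x \<ominus> x \<in> inner n" using q(7)[OF x] by simp
        then obtain s where s: "s \<in> S" "?p x \<ominus> x = \<pi> [^] n \<otimes> s" by (auto simp: inner_def)
        have sK: "s \<in> carrier K" using s S_closed(1) by blast
        have "?p x = x \<oplus> (?p x \<ominus> x)" using c by (simp add: a_minus_def K.a_comm[of "?p x"] K.r_neg2)
        then have "\<pi> [^] n \<otimes> ?p x = \<pi> [^] n \<otimes> (x \<oplus> \<pi> [^] n \<otimes> s)" using s(2) by simp
        also have "\<dots> = \<pi> [^] n \<otimes> x \<oplus> \<pi> [^] (2 * n) \<otimes> s"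
          using c sK by (simp add: K.r_distr K.m_assoc[symmetric] K.nat_pow_mult mult_2)
        finally have "digit m (\<pi> [^] n \<otimes> ?p x) =
            digit m (\<pi> [^] n \<otimes> x) \<oplus>\<^bsub>\<kappa>\<^esub> digit m (\<pi> [^] (2 * n) \<otimes> s)"
          using digit_add[OF _ S_closed(5)[OF pow_S s(1)]] x by (simp add: outer_def)
        then show ?thesis
          using digit_pow[OF s(1), of m "2 * n"] Suc.prems digit_closed x by (simp add: outer_def)
      qed
      have d: "d \<in> Hom_mod \<kappa> ?V (ring_module \<kappa>)"
      proof (rule Hom_modI)
        fix x y assume xy: "x \<in> carrier ?V" "y \<in> carrier ?V"
        have s: "x \<oplus> y \<in> outer n" using q(5) V(1) xy by blast
        then show "d (x \<oplus>\<^bsub>?V\<^esub> y) = d x \<oplus>\<^bsub>ring_module \<kappa>\<^esub> d y"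
          using xy V[OF xy(1)] V[OF xy(2)] by (simp add: d_def R dp K.r_distr digit_add)
      next
        fix a x assume a: "a \<in> carrier \<kappa>" and x: "x \<in> carrier ?V"
        have s: "\<sigma> a \<otimes> x \<in> outer n" using q(6) V(1)[OF x] \<sigma>_props(1)[OF a] by blast
        have "\<pi> [^] n \<otimes> (\<sigma> a \<otimes> x) = \<sigma> a \<otimes> (\<pi> [^] n \<otimes> x)"
          using V[OF x] \<sigma>_props(2)[OF a] by (simp add: K.m_lcomm)
        then show "d (a \<odot>\<^bsub>?V\<^esub> x) = a \<odot>\<^bsub>ring_module \<kappa>\<^esub> d x"
          using x s V[OF x] a by (simp add: d_def R dp digit_smult)
      next
        show "d v \<in> carrier (ring_module \<kappa>)" if "v \<in> carrier ?V" for v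
          using that V digit_closed by (simp add: d_def)
        show "d \<in> extensional (carrier ?V)" by (simp add: d_def)
      qed
      have ja: "?i \<otimes> (\<pi> [^] m \<otimes> \<sigma> a) \<in> outer n" if "a \<in> carrier \<kappa>" for a
        using iS S_closed(5)[OF pow_S \<sigma>_props(1)[OF that]] by blast
      have j: "j \<in> Hom_mod \<kappa> (ring_module \<kappa>) ?V"
      proof (rule Hom_modI)
        fix a b assume ab: "a \<in> carrier (ring_module \<kappa>)" "b \<in> carrier (ring_module \<kappa>)"
        then have "?i \<otimes> (\<pi> [^] m \<otimes> \<sigma> (a \<oplus>\<^bsub>\<kappa>\<^esub> b)) =
          ?i \<otimes> (\<pi> [^] m \<otimes> \<sigma> a) \<oplus> ?i \<otimes> (\<pi> [^] m \<otimes> \<sigma> b)"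
          using i \<sigma>_props by (simp add: K.r_distr)
        then show "j (a \<oplus>\<^bsub>ring_module \<kappa>\<^esub> b) = j a \<oplus>\<^bsub>?V\<^esub> j b"
          using ab q(1)[OF ja ja] by (simp add: j_def R)
      next
        fix a b assume ab: "a \<in> carrier \<kappa>" "b \<in> carrier (ring_module \<kappa>)"
        then have "?i \<otimes> (\<pi> [^] m \<otimes> \<sigma> (a \<otimes>\<^bsub>\<kappa>\<^esub> b)) =
          \<sigma> a \<otimes> (?i \<otimes> (\<pi> [^] m \<otimes> \<sigma> b))"
          using i \<sigma>_props by (simp add: K.m_ac)
        then show "j (a \<odot>\<^bsub>ring_module \<kappa>\<^esub> b) = a \<odot>\<^bsub>?V\<^esub> j b"
          using ab q(2)[OF _ ja] by (simp add: j_def R)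
      next
        show "j a \<in> carrier ?V" if "a \<in> carrier (ring_module \<kappa>)" for a using that ja by (simp add: j_def)
        show "j \<in> extensional (carrier (ring_module \<kappa>))" by (simp add: j_def)
      qed
      have "compose (carrier ?V) e d \<in> Y ?V (ring_module \<kappa>)"
        using D(7)[OF finV fin\<kappa> fin\<kappa> D(3)[OF finV fin\<kappa> d] eY] .
      then have "compose (carrier ?V) j (compose (carrier ?V) e d) \<in> Y ?V ?V"
        using D(6)[OF finV fin\<kappa> finV _ D(3)[OF fin\<kappa> finV j]] by blast
      then have "(\<lambda>v\<in>carrier ?V. T m v \<oplus>\<^bsub>?V\<^esub> compose (carrier ?V) j (compose (carrier ?V) e d) v) \<in> Y ?V ?V"
        using D(5)[OF finV finV Suc.IH] Suc.prems by simp
      also have "(\<lambda>v\<in>carrier ?V. T m v \<oplus>\<^bsub>?V\<^esub> compose (carrier ?V) j (compose (carrier ?V) e d) v) = T (Suc m)"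
        unfolding T_def
      proof (rule restrict_ext)
        fix v assume v: "v \<in> carrier ?V"
        let ?a = "e (digit m (\<pi> [^] n \<otimes> v))"
        have a: "?a \<in> carrier \<kappa>" using e_props(1)[OF e] digit_closed V(3)[OF v] by blast
        have "compose (carrier ?V) j (compose (carrier ?V) e d) v = ?p (?i \<otimes> (\<pi> [^] m \<otimes> \<sigma> ?a))"
          using v a by (simp add: compose_eq d_def j_def)
        moreover have "?i \<otimes> digit_sum e (Suc m) (\<pi> [^] n \<otimes> v) =
          ?i \<otimes> digit_sum e m (\<pi> [^] n \<otimes> v) \<oplus> ?i \<otimes> (\<pi> [^] m \<otimes> \<sigma> ?a)"
          using i digit_sum_K[OF e V(3)[OF v], of m] \<sigma>_props(2)[OF a] by (simp add: K.r_distr)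
        ultimately show "(\<lambda>v\<in>carrier ?V. ?p (?i \<otimes> digit_sum e m (\<pi> [^] n \<otimes> v))) v \<oplus>\<^bsub>?V\<^esub>
            compose (carrier ?V) j (compose (carrier ?V) e d) v =
          ?p (?i \<otimes> digit_sum e (Suc m) (\<pi> [^] n \<otimes> v))"
          using v q(1)[OF iS[OF digit_sum_S[OF e V(3)[OF v]]] ja[OF a]] by (simp add: R)
      qed
      finally show ?case .
    qed
    then have "T (2 * n) \<in> Y ?V ?V" by simp
    moreover have "induced_map R R (digitwise e) (inner n, outer n) (outer n, inner n) = T (2 * n)"
      unfolding T_def induced_map_eq lattice_quot_simps(1)
    proof (rule restrict_ext)
      fix v assume "v \<in> ?p ` outer n"
      then have v: "v \<in> carrier ?V" by simp
      note c = V[OF v]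
      let ?s = "digit_sum e (2 * n) (\<pi> [^] n \<otimes> v)"
      have sS: "?s \<in> S" by (rule digit_sum_S[OF e c(3)])
      have sK: "?s \<in> carrier K" using sS S_closed(1) by blast
      have eK: "digitwise e v \<in> carrier K" by (rule digitwise_char(1)[OF e c(2)])
      \<comment> \<open>The tail beyond 2 n digits is divisible by \<open>\<pi>^(2 n)\<close>; after
        division by \<open>\<pi>^n\<close> it lies in the inner ball, so its class is zero.\<close>
      obtain z where z: "z \<in> S" "digitwise_int e (\<pi> [^] n \<otimes> v) \<ominus> ?s = \<pi> [^] (2 * n) \<otimes> z"
        using digitwise_int(2)[OF e c(3), of "2 * n"] unfolding pcong_def by blast
      have zK: "z \<in> carrier K" using z(1) S_closed(1) by blast
      have "digitwise e v \<ominus> ?i \<otimes> ?s = ?i \<otimes> (\<pi> [^] n \<otimes> digitwise e v \<ominus> ?s)"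
        using i i'[OF eK] eK sK by (simp add: a_minus_def K.r_distr K.r_minus)
      also have "\<dots> = ?i \<otimes> (\<pi> [^] n \<otimes> (\<pi> [^] n \<otimes> z))"
        using digitwise_char(2)[OF e c(2,3)] z(2) zK by (simp add: K.m_assoc[symmetric] K.nat_pow_mult mult_2)
      also have "\<dots> = \<pi> [^] n \<otimes> z" using i'[of "\<pi> [^] n \<otimes> z"] zK by simp
      finally have "digitwise e v \<ominus> ?i \<otimes> ?s \<in> inner n" using z(1) by (simp add: inner_def)
      moreover have "digitwise e v \<ominus>\<^bsub>R\<^esub> ?i \<otimes> ?s = digitwise e v \<ominus> ?i \<otimes> ?s"
        using a_inv_ring_module[OF K.cring_axioms, of "?i \<otimes> ?s"] i(1) sK by (simp add: a_minus_def R_def)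
      ultimately show "?p (digitwise e v) = ?p (?i \<otimes> ?s)"
        using q(4)[OF balls(1)[OF c(1)] iS[OF sS]] by simp
    qed
    ultimately show ?thesis by simp
  qed
  have ref: "refinable R R (digitwise e)"
  proof (rule refinableI)
    fix L1 L2 assume L: "L1 \<in> Lat K S R" "L2 \<in> Lat K S R"
    obtain N1 N2 where N: "\<forall>n\<ge>N1. inner n \<subseteq> L1 \<and> L1 \<subseteq> outer n" "\<forall>n\<ge>N2. inner n \<subseteq> L2 \<and> L2 \<subseteq> outer n"
      using Lat_sandwich[OF L(1)[unfolded R_def]] Lat_sandwich[OF L(2)[unfolded R_def]] by (elim exE)
    \<comment> \<open>A sum is used as a convenient common upper bound of the two radii.\<close>
    define n where "n = N1 + N2"
    have n: "inner n \<subseteq> L1" "L1 \<subseteq> outer n" "inner n \<subseteq> L2" "L2 \<subseteq> outer n" using N by (auto simp: n_def)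
    show "\<exists>L\<in>Lat K S R. L \<subseteq> L1 \<and> digitwise e ` L \<subseteq> L2"
      using n balls(2) by (intro bexI[OF _ iL[of n]]) auto
    show "\<exists>L\<in>Lat K S R. L2 \<subseteq> L \<and> digitwise e ` L1 \<subseteq> L"
      using n balls(1) by (intro bexI[OF _ oL[of n]]) auto
  qed
  show ?thesis
  proof (rule liftI_fine[OF F mR mR hom ref])
    fix L1' L2' L1 L2 assume c: "refines R R (digitwise e) L1' L2' L1 L2"
    note d = refinesD[OF c]
    obtain N1 N2 N3 N4 where N: "\<forall>n\<ge>N1. inner n \<subseteq> L1' \<and> L1' \<subseteq> outer n" "\<forall>n\<ge>N2. inner n \<subseteq> L1 \<and> L1 \<subseteq> outer n"
      "\<forall>n\<ge>N3. inner n \<subseteq> L2' \<and> L2' \<subseteq> outer n" "\<forall>n\<ge>N4. inner n \<subseteq> L2 \<and> L2 \<subseteq> outer n"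
      using Lat_sandwich[OF d(4)[unfolded R_def]] Lat_sandwich[OF d(5)[unfolded R_def]]
        Lat_sandwich[OF d(6)[unfolded R_def]] Lat_sandwich[OF d(7)[unfolded R_def]] by (elim exE)
    define n where "n = N1 + N2 + N3 + N4"
    have n: "inner n \<subseteq> L1'" "L1 \<subseteq> outer n" "inner n \<subseteq> L2" "L2' \<subseteq> outer n" using N by (auto simp: n_def)
    show "\<exists>U1' U2' U1 U2. refines R R (digitwise e) U1' U2' U1 U2 \<and> U1' \<subseteq> L1' \<and> L1 \<subseteq> U1 \<and> U2 \<subseteq> L2 \<and> L2' \<subseteq> U2' \<and>
       induced_map R R (digitwise e) (U1', U2') (U1, U2) \<in> Y (lattice_quot \<sigma> R U1 U1') (lattice_quot \<sigma> R U2' U2)"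
      using r[of n] key[of n] n by blast
  qed
qed

text \<open>Applying the identity to all digits returns the element itself, because the remainder
  after \<open>n\<close> digits is \<open>\<pi>^n\<close> times an iterated shift. Additivity of
  \<open>\<sigma>\<close> splits this digit by digit, and a power of \<open>\<pi>\<close> reduces
  \<open>K\<close> to \<open>S\<close>.\<close>

lemma digitwise_decomposition:
  assumes e1: "e1 \<in> Hom_mod k (rest \<iota>' (ring_module \<kappa>)) (rest \<iota>' (ring_module \<kappa>))"
    and e2: "e2 \<in> Hom_mod k (rest \<iota>' (ring_module \<kappa>)) (rest \<iota>' (ring_module \<kappa>))"
    and sum: "\<And>a. a \<in> carrier \<kappa> \<Longrightarrow> e1 a \<oplus>\<^bsub>\<kappa>\<^esub> e2 a = a" and x: "x \<in> carrier K"
  shows "digitwise e1 x \<oplus> digitwise e2 x = x"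
proof -
  have digitwise_int_sum: "digitwise_int e1 x \<oplus> digitwise_int e2 x = x" if x: "x \<in> S" for x
  proof -
    define f where "f = (\<lambda>a\<in>carrier \<kappa>. a)"
    have f: "f \<in> Hom_mod k (rest \<iota>' (ring_module \<kappa>)) (rest \<iota>' (ring_module \<kappa>))"
      using Hom_mod_id[OF module_k'[OF module_ring_module[OF \<kappa>.cring_axioms]]] by (simp add: f_def)
    have 1: "digit_sum f n x = digit_sum e1 n x \<oplus> digit_sum e2 n x" for n
    proof (induction n)
      case (Suc n)
      let ?d = "digit n x"
      have d: "?d \<in> carrier \<kappa>" "e1 ?d \<in> carrier \<kappa>" "e2 ?d \<in> carrier \<kappa>"
        using digit_closed[OF x] e_props(1)[OF e1] e_props(1)[OF e2] by auto
      have "\<sigma> (f ?d) = \<sigma> (e1 ?d) \<oplus> \<sigma> (e2 ?d)"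
        using sum[OF d(1)] d \<sigma>_props(3)[OF d(2,3)] by (simp add: f_def)
      then show ?case
        using Suc digit_sum_K[OF e1 x, of n] digit_sum_K[OF e2 x, of n] \<sigma>_props(2)[OF d(2)] \<sigma>_props(2)[OF d(3)]
        by (simp add: K.r_distr K.a_ac)
    qed simp
    have 2: "x = digit_sum f n x \<oplus> \<pi> [^] n \<otimes> (shift ^^ n) x" for n
    proof (induction n)
      case 0
      then show ?case using x S_closed(1) by simp
    next
      case (Suc n)
      let ?y = "(shift ^^ n) x"
      have y: "?y \<in> S" "shift ?y \<in> carrier K" "\<sigma> (r ?y) \<in> carrier K" "f (digit n x) = r ?y"
        using iter_S[OF x] shift(1) S_closed(1) r_props(1) \<sigma>_props(2) by (auto simp: f_def digit_def)
      have "\<pi> [^] n \<otimes> ?y = \<pi> [^] n \<otimes> (\<sigma> (r ?y) \<oplus> \<pi> \<otimes> shift ?y)" using shift(2)[OF y(1)] by simp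
      also have "\<dots> = \<pi> [^] n \<otimes> \<sigma> (r ?y) \<oplus> \<pi> [^] Suc n \<otimes> shift ?y"
        using y by (simp add: K.r_distr K.m_assoc)
      finally have "digit_sum f n x \<oplus> \<pi> [^] n \<otimes> ?y = digit_sum f (Suc n) x \<oplus> \<pi> [^] Suc n \<otimes> shift ?y"
        using y digit_sum_K[OF f x, of n] by (simp add: K.a_assoc del: K.nat_pow_Suc)
      then show ?case using Suc by simp
    qed
    have "pcong n x (digit_sum f n x)" for n
    proof -
      have "x \<ominus> digit_sum f n x = \<pi> [^] n \<otimes> (shift ^^ n) x"
        using digit_sum_K[OF f x, of n] S_closed(1)[OF iter_S[OF x, of n]]
        by (subst 2[of n]) (simp add: a_minus_def K.a_comm[of "digit_sum f n x"] K.a_assoc K.r_neg)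
      then show ?thesis unfolding pcong_def using iter_S[OF x] by blast
    qed
    then have "digitwise_int f x = x" by (rule digitwise_int(3)[OF f x x])
    moreover have "digitwise_int f x = digitwise_int e1 x \<oplus> digitwise_int e2 x"
      unfolding 1 using x digitwise_int(1)[OF e1 x] digitwise_int(1)[OF e2 x]
      by (intro digitwise_int(3)[OF f x])
        (auto simp: 1 S_closed intro!: pcong_add digitwise_int(2)[OF e1] digitwise_int(2)[OF e2] digit_sum_S[OF e1] digit_sum_S[OF e2])
    ultimately show ?thesis by simp
  qed
  obtain n :: nat where n: "\<pi> [^] n \<otimes> x \<in> S" using exhaust[OF x] by blast
  note c = digitwise_char(1)[OF e1 x] digitwise_char(1)[OF e2 x]
  have "\<pi> [^] n \<otimes> (digitwise e1 x \<oplus> digitwise e2 x) = \<pi> [^] n \<otimes> x"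
    using digitwise_int_sum[OF n] digitwise_char(2)[OF e1 x n] digitwise_char(2)[OF e2 x n] c by (simp add: K.r_distr)
  then show ?thesis using pow_cancel[of "digitwise e1 x \<oplus> digitwise e2 x" x n] c x by simp
qed

end

section \<open>Complete discrete valuation rings\<close>

lemma coset_rep_inj: "pairwise disjnt \<C> \<Longrightarrow> (\<And>C. C \<in> \<C> \<Longrightarrow> C \<noteq> {}) \<Longrightarrow> inj_on coset_rep \<C>"
proof (rule inj_onI)
  fix C D assume *: "pairwise disjnt \<C>" "\<And>C. C \<in> \<C> \<Longrightarrow> C \<noteq> {}" "C \<in> \<C>" "D \<in> \<C>" "coset_rep C = coset_rep D"
  have "coset_rep E \<in> E" if "E \<in> \<C>" for E
    using *(2)[OF that] by (simp add: coset_rep_def some_in_eq)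
  then have "coset_rep C \<in> C" "coset_rep D \<in> D" using *(3,4) by blast+
  then show "C = D" using *(1,3-5) unfolding pairwise_def disjnt_def by (metis disjoint_iff)
qed

text \<open>Cosets are nonempty and disjoint, so choosing representatives is injective and
  everything is transported from the factor ring.\<close>

lemma quot_ring_hom:
  assumes "ideal I R" "cring R"
  shows "quot_ring_proj R I \<in> ring_hom R (quot_ring R I)"
    "x \<in> carrier R \<Longrightarrow> quot_ring_proj R I x = \<zero>\<^bsub>quot_ring R I\<^esub> \<longleftrightarrow> x \<in> I"
    "field (R Quot I) \<Longrightarrow> field (quot_ring R I)"
proof -
  interpret I: ideal I R by fact
  have ne: "C \<noteq> {}" if "C \<in> a_rcosets\<^bsub>R\<^esub> I" for C
    using that I.a_rcos_self by (auto simp: A_RCOSETS_def')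
  have inj: "inj_on coset_rep (carrier (R Quot I))"
    using coset_rep_inj[OF I.a_rcos_disjoint ne] by (simp add: FactRing_def)
  note iso = inj_imp_image_ring_iso[OF inj, folded quot_ring_def]
  have proj: "quot_ring_proj R I = coset_rep \<circ> (+>\<^bsub>R\<^esub>) I" by (simp add: quot_ring_proj_def fun_eq_iff)
  show "quot_ring_proj R I \<in> ring_hom R (quot_ring R I)"
    unfolding proj using ring_hom_trans[OF I.rcos_ring_hom] iso by (auto simp: ring_iso_def)
  have z: "\<zero>\<^bsub>quot_ring R I\<^esub> = coset_rep I" by (simp add: quot_ring_def image_ring_zero FactRing_def)
  show "quot_ring_proj R I x = \<zero>\<^bsub>quot_ring R I\<^esub> \<longleftrightarrow> x \<in> I" if x: "x \<in> carrier R"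
  proof -
    have c: "I +>\<^bsub>R\<^esub> x \<in> carrier (R Quot I)" "I \<in> carrier (R Quot I)"
      using x ideal.quotient_is_ring[OF assms(1)] ring.ring_simprules(2)
      by (fastforce simp: FactRing_def A_RCOSETS_def')+
    have "quot_ring_proj R I x = \<zero>\<^bsub>quot_ring R I\<^esub> \<longleftrightarrow> I +>\<^bsub>R\<^esub> x = I"
      using inj_on_eq_iff[OF inj c] by (simp add: z quot_ring_proj_def)
    then show ?thesis using I.rcos_const_imp_mem[OF x] I.a_rcos_const by blast
  qed
  show "field (quot_ring R I)" if "field (R Quot I)"
    unfolding quot_ring_def by (rule field.inj_imp_image_ring_is_field[OF that inj])
qed

section \<open>Powers of principal ideals\<close>

lemma (in cring) PIdl_prod:
  assumes "a \<in> carrier R" "b \<in> carrier R"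
  shows "ideal_prod R (PIdl a) (PIdl b) = PIdl (a \<otimes> b)"
proof -
  have i: "ideal (PIdl (a \<otimes> b)) R" using assms by (simp add: cgenideal_ideal)
  have "ideal_prod R (PIdl a) (PIdl b) = Idl (PIdl (a \<otimes> b))"
    using ideal_prod_eq_genideal[OF cgenideal_ideal cgenideal_ideal] cgenideal_prod assms by simp
  also have "\<dots> = PIdl (a \<otimes> b)"
    using genideal_minimal[OF i subset_refl] genideal_self[of "PIdl (a \<otimes> b)"] i
    by (simp add: ideal.Icarr subset_antisym subset_iff)
  finally show ?thesis .
qed

text \<open>Turns the powers of the maximal ideal in the definition of completeness into
  divisibility by powers of a uniformizer.\<close>

lemma (in cring) PIdl_pow:
  assumes "a \<in> carrier R"
  shows "(PIdl a) [^]\<^bsub>ideals_set R\<^esub> (n::nat) = PIdl (a [^] n)"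
proof -
  interpret I: comm_monoid "ideals_set R" by (rule ideals_set_is_comm_monoid)
  show ?thesis
  proof (induction n)
    case 0
    have "PIdl \<one> = carrier R" by (auto simp: cgenideal_def intro!: exI[of _ "_ :: 'a"])
    then show ?case by (simp add: ideals_set_def)
  next
    case (Suc n)
    have mult: "I \<otimes>\<^bsub>ideals_set R\<^esub> J = ideal_prod R I J" for I J by (simp add: ideals_set_def)
    show ?case unfolding I.nat_pow_Suc mult Suc using PIdl_prod[of "a [^] n" a] assms by simp
  qed
qed

section \<open>Uniformizers and units of a discrete valuation ring\<close>

lemma maximal_ideal_of_dvr:
  assumes "discrete_valuation_ring R"
  shows "maximalideal (maximal_ideal_of R) R" "maximalideal m R \<Longrightarrow> m = maximal_ideal_of R"
  using assms theI'[of "\<lambda>m. maximalideal m R"] unfolding discrete_valuation_ring_def maximal_ideal_of_def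
  by (auto intro!: the_equality[symmetric])

text \<open>A generator of the maximal ideal; it is nonzero because a ring whose zero ideal is
  maximal is a field.\<close>

lemma dvr_uniformizer:
  assumes "discrete_valuation_ring R"
  obtains \<pi> where "\<pi> \<in> carrier R" "\<pi> \<noteq> \<zero>\<^bsub>R\<^esub>" "maximal_ideal_of R = PIdl\<^bsub>R\<^esub> \<pi>"
proof -
  interpret principal_domain R using assms by (simp add: discrete_valuation_ring_def)
  interpret m: maximalideal "maximal_ideal_of R" R by (rule maximal_ideal_of_dvr[OF assms])
  obtain \<pi> where p: "\<pi> \<in> carrier R" "maximal_ideal_of R = PIdl\<^bsub>R\<^esub> \<pi>" using exists_gen[OF m.is_ideal] by blast
  have "\<pi> \<noteq> \<zero>\<^bsub>R\<^esub>"
  proof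
    assume "\<pi> = \<zero>\<^bsub>R\<^esub>"
    moreover have "PIdl\<^bsub>R\<^esub> \<zero>\<^bsub>R\<^esub> = {\<zero>\<^bsub>R\<^esub>}" by (force simp: cgenideal_def)
    ultimately have "maximal_ideal_of R = {\<zero>\<^bsub>R\<^esub>}" using p(2) by (simp only:)
    then have "field R" using zeromaximalideal_fieldI m.is_maximalideal by simp
    then show False using assms by (simp add: discrete_valuation_ring_def)
  qed
  then show ?thesis using that p by blast
qed

text \<open>A nonzero nonunit has an irreducible divisor, which in a principal ideal domain
  generates a maximal ideal, and there is only one.\<close>

lemma dvr_unit:
  assumes "discrete_valuation_ring R" "x \<in> carrier R" "x \<notin> maximal_ideal_of R"
  shows "x \<in> Units R"
proof (rule ccontr)
  interpret principal_domain R using assms by (simp add: discrete_valuation_ring_def)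
  interpret m: maximalideal "maximal_ideal_of R" R by (rule maximal_ideal_of_dvr[OF assms(1)])
  assume u: "x \<notin> Units R"
  have "x \<noteq> \<zero>\<^bsub>R\<^esub>" using assms(3) m.zero_closed by blast
  then obtain b where b: "b \<in> carrier R" "ring_irreducible\<^bsub>R\<^esub> b" "b divides\<^bsub>R\<^esub> x"
    using exists_irreducible_divisor[of x] assms(2) u by blast
  have "PIdl\<^bsub>R\<^esub> b = maximal_ideal_of R"
    using maximal_ideal_of_dvr(2)[OF assms(1) irreducible_imp_maximalideal[OF b(1,2)]] .
  moreover have "x \<in> PIdl\<^bsub>R\<^esub> b" using b assms(2) cgenideal_self to_contain_is_to_divide by blast
  ultimately show False using assms(3) by simp
qed

text \<open>Translates ideals into divisibility by \<open>\<pi>\<close>. The substantial point is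
  that every element of \<open>K\<close> is moved into \<open>S\<close> by a power of
  \<open>\<pi>\<close>, which is drawn from the uniqueness half of completeness.\<close>

lemma bt_step_residue:
  fixes K :: "'a ring"
  assumes k: "field k" and frac: "is_fraction_field_of K S" and dvr: "complete_dvr (sub_ring K S)"
    and \<iota>: "\<iota> \<in> ring_hom k K" "\<And>c. c \<in> carrier k \<Longrightarrow> \<iota> c \<in> S"
    and \<sigma>: "\<sigma> \<in> ring_hom (residue_field K S) (sub_ring K S)"
      "\<forall>c\<in>carrier k. \<sigma> (residue_map K S (\<iota> c)) = \<iota> c"
      "\<forall>x\<in>carrier (residue_field K S). residue_map K S (\<sigma> x) = x"
  shows "\<exists>\<pi>. bt_step k K \<iota> S (residue_field K S) (residue_map K S) \<sigma> \<pi>"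
proof -
  let ?O = "sub_ring K S" and ?m = "maximal_ideal_of (sub_ring K S)"
  have d: "discrete_valuation_ring ?O" using dvr by (simp add: complete_dvr_def)
  interpret K: field K using frac by (simp add: is_fraction_field_of_def)
  have S: "subring S K" using frac by (simp add: is_fraction_field_of_def)
  note sE = subringE[OF S]
  interpret O: principal_domain ?O using d by (simp add: discrete_valuation_ring_def)
  interpret m: maximalideal ?m ?O by (rule maximal_ideal_of_dvr[OF d])
  obtain \<pi> where p: "\<pi> \<in> S" "\<pi> \<noteq> \<zero>\<^bsub>K\<^esub>" "?m = PIdl\<^bsub>?O\<^esub> \<pi>" using dvr_uniformizer[OF d] by auto
  have SK: "x \<in> carrier K" if "x \<in> S" for x using sE(1) that by blast
  have pK: "\<pi> \<in> carrier K" using p(1) SK by blast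
  \<comment> \<open>Negation is a description over the carrier, so the subring and \<open>K\<close>
    have to be shown to give the same element.\<close>
  have minus: "x \<ominus>\<^bsub>?O\<^esub> y = x \<ominus>\<^bsub>K\<^esub> y" if "x \<in> S" "y \<in> S" for x y
  proof -
    have "\<ominus>\<^bsub>?O\<^esub> y \<in> S" "\<ominus>\<^bsub>?O\<^esub> y \<oplus>\<^bsub>K\<^esub> y = \<zero>\<^bsub>K\<^esub>" using O.a_inv_closed[of y] O.l_neg[of y] that by auto
    then have "\<ominus>\<^bsub>K\<^esub> y = \<ominus>\<^bsub>?O\<^esub> y" using K.minus_equality[of "\<ominus>\<^bsub>?O\<^esub> y" y] SK that by blast
    then show ?thesis by (simp add: a_minus_def)
  qed
  have pow: "\<pi> [^]\<^bsub>?O\<^esub> (n::nat) = \<pi> [^]\<^bsub>K\<^esub> n" for n by (rule K.nat_pow_consistent[symmetric])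
  have powS: "\<pi> [^]\<^bsub>K\<^esub> (n::nat) \<in> S" for n using O.nat_pow_closed[of \<pi> n] p(1) by (simp add: pow)
  have PIdl: "x \<in> PIdl\<^bsub>?O\<^esub> a \<longleftrightarrow> (\<exists>y\<in>S. x = a \<otimes>\<^bsub>K\<^esub> y)" if "a \<in> S" for x a
    using that SK by (auto simp: cgenideal_def K.m_comm)
  have mpow: "x \<in> ?m [^]\<^bsub>ideals_set ?O\<^esub> (n::nat) \<longleftrightarrow> (\<exists>y\<in>S. x = \<pi> [^]\<^bsub>K\<^esub> n \<otimes>\<^bsub>K\<^esub> y)" for x n
    using O.PIdl_pow[of \<pi> n] PIdl[OF powS] p by (simp add: pow)
  have complete: "\<exists>!y. y \<in> S \<and> (\<forall>i. \<exists>z\<in>S. y \<ominus>\<^bsub>K\<^esub> x i = \<pi> [^]\<^bsub>K\<^esub> i \<otimes>\<^bsub>K\<^esub> z)"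
    if x: "\<And>i. x i \<in> S" "\<And>i. \<exists>z\<in>S. x (Suc i) \<ominus>\<^bsub>K\<^esub> x i = \<pi> [^]\<^bsub>K\<^esub> i \<otimes>\<^bsub>K\<^esub> z" for x :: "nat \<Rightarrow> 'a"
  proof -
    have "\<forall>i. x i \<in> carrier ?O \<and> x (Suc i) \<ominus>\<^bsub>?O\<^esub> x i \<in> ?m [^]\<^bsub>ideals_set ?O\<^esub> i"
      using x by (simp add: mpow minus)
    then have "\<exists>!y. y \<in> carrier ?O \<and> (\<forall>i. y \<ominus>\<^bsub>?O\<^esub> x i \<in> ?m [^]\<^bsub>ideals_set ?O\<^esub> i)"
      using dvr unfolding complete_dvr_def by blast
    then show ?thesis by (simp add: mpow minus x(1) cong: conj_cong)
  qed
  \<comment> \<open>Every nonzero \<open>b\<close> of \<open>S\<close> is a unit times a power of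
    \<open>\<pi>\<close>. An element divisible by all powers would be a second limit of the zero
    sequence, so there is a least power that does not divide \<open>b\<close>.\<close>
  have div: "\<exists>n::nat. \<exists>u\<in>S. \<pi> [^]\<^bsub>K\<^esub> n = b \<otimes>\<^bsub>K\<^esub> u" if b: "b \<in> S" "b \<noteq> \<zero>\<^bsub>K\<^esub>" for b
  proof -
    have z: "\<exists>!y. y \<in> S \<and> (\<forall>i::nat. \<exists>z\<in>S. y \<ominus>\<^bsub>K\<^esub> \<zero>\<^bsub>K\<^esub> = \<pi> [^]\<^bsub>K\<^esub> i \<otimes>\<^bsub>K\<^esub> z)"
    proof (rule complete[of "\<lambda>_. \<zero>\<^bsub>K\<^esub>"])
      show "\<exists>z\<in>S. \<zero>\<^bsub>K\<^esub> \<ominus>\<^bsub>K\<^esub> \<zero>\<^bsub>K\<^esub> = \<pi> [^]\<^bsub>K\<^esub> i \<otimes>\<^bsub>K\<^esub> z" for i :: nat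
        using sE(2) pK by (intro bexI[of _ "\<zero>\<^bsub>K\<^esub>"]) (auto simp: a_minus_def)
    qed (rule sE(2))
    have "\<exists>i::nat. \<not> (\<exists>z\<in>S. b = \<pi> [^]\<^bsub>K\<^esub> i \<otimes>\<^bsub>K\<^esub> z)"
    proof (rule ccontr)
      assume "\<not> ?thesis"
      then have 1: "b \<in> S \<and> (\<forall>i::nat. \<exists>z\<in>S. b \<ominus>\<^bsub>K\<^esub> \<zero>\<^bsub>K\<^esub> = \<pi> [^]\<^bsub>K\<^esub> i \<otimes>\<^bsub>K\<^esub> z)"
        using b(1) SK by (simp add: a_minus_def)
      have 2: "\<zero>\<^bsub>K\<^esub> \<in> S \<and> (\<forall>i::nat. \<exists>z\<in>S. \<zero>\<^bsub>K\<^esub> \<ominus>\<^bsub>K\<^esub> \<zero>\<^bsub>K\<^esub> = \<pi> [^]\<^bsub>K\<^esub> i \<otimes>\<^bsub>K\<^esub> z)"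
        using sE(2) pK by (auto intro!: bexI[of _ "\<zero>\<^bsub>K\<^esub>"] simp: a_minus_def)
      show False using ex1E[OF z] 1 2 b(2) by metis
    qed
    then have "\<exists>i::nat. \<not> (\<exists>z\<in>S. b = \<pi> [^]\<^bsub>K\<^esub> i \<otimes>\<^bsub>K\<^esub> z) \<and>
        (\<forall>j<i. \<not> \<not> (\<exists>z\<in>S. b = \<pi> [^]\<^bsub>K\<^esub> j \<otimes>\<^bsub>K\<^esub> z))"
      by (rule exists_least_iff[THEN iffD1])
    then obtain i :: nat where i: "\<not> (\<exists>z\<in>S. b = \<pi> [^]\<^bsub>K\<^esub> i \<otimes>\<^bsub>K\<^esub> z)"
      "\<And>j. j < i \<Longrightarrow> \<exists>z\<in>S. b = \<pi> [^]\<^bsub>K\<^esub> j \<otimes>\<^bsub>K\<^esub> z" by blast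
    \<comment> \<open>The power with exponent 0 divides everything. The cofactor \<open>u\<close> at
      the preceding exponent is not in the maximal ideal, by the choice of \<open>i\<close>, and is
      therefore a unit.\<close>
    have "i \<noteq> 0" using i(1) b(1) SK by (metis K.l_one K.nat_pow_0)
    then obtain j where j: "i = Suc j" using not0_implies_Suc by blast
    obtain u where u: "u \<in> S" "b = \<pi> [^]\<^bsub>K\<^esub> j \<otimes>\<^bsub>K\<^esub> u" using i(2)[of j] j by auto
    have "u \<notin> ?m"
    proof
      assume "u \<in> ?m"
      then obtain y where "y \<in> S" "u = \<pi> \<otimes>\<^bsub>K\<^esub> y" using PIdl[OF p(1)] p(3) by auto
      then have "b = \<pi> [^]\<^bsub>K\<^esub> i \<otimes>\<^bsub>K\<^esub> y" using u(2) pK SK by (simp add: j K.m_assoc)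
      then show False using i(1) \<open>y \<in> S\<close> by blast
    qed
    then have "u \<in> Units ?O" using dvr_unit[OF d] u(1) by simp
    then obtain v where v: "v \<in> S" "u \<otimes>\<^bsub>K\<^esub> v = \<one>\<^bsub>K\<^esub>" by (auto simp: Units_def)
    have "b \<otimes>\<^bsub>K\<^esub> v = \<pi> [^]\<^bsub>K\<^esub> j" using u v pK SK by (simp add: K.m_assoc)
    then show ?thesis using v(1) by metis
  qed
  note q = quot_ring_hom[OF m.is_ideal O.cring_axioms, folded residue_field_def residue_map_def]
  have "bt_step k K \<iota> S (residue_field K S) (residue_map K S) \<sigma> \<pi>"
  proof (rule bt_step.intro)
    show "field k" "subring S K" "\<iota> \<in> ring_hom k K" "\<sigma> \<in> ring_hom (residue_field K S) ?O" by fact+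
    show "field K" by (rule K.field_axioms)
    show "field (residue_field K S)" by (rule q(3)[OF m.quotient_is_field[OF O.cring_axioms]])
    show "residue_map K S \<in> ring_hom ?O (residue_field K S)" by (rule q(1))
    show "\<iota> c \<in> S" if "c \<in> carrier k" for c using \<iota>(2) that .
    show "residue_map K S (\<sigma> a) = a" if "a \<in> carrier (residue_field K S)" for a using \<sigma>(3) that by blast
    show "\<sigma> (residue_map K S (\<iota> c)) = \<iota> c" if "c \<in> carrier k" for c using \<sigma>(2) that by blast
    show "\<pi> \<in> S" "\<pi> \<noteq> \<zero>\<^bsub>K\<^esub>" by fact+
    show "residue_map K S \<pi> = \<zero>\<^bsub>residue_field K S\<^esub>"
      using q(2)[of \<pi>] p PIdl[OF p(1)] sE(3) pK by (auto intro!: bexI[of _ "\<one>\<^bsub>K\<^esub>"])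
    show "\<exists>y\<in>S. x = \<pi> \<otimes>\<^bsub>K\<^esub> y" if "x \<in> S" "residue_map K S x = \<zero>\<^bsub>residue_field K S\<^esub>" for x
      using q(2)[of x] that p PIdl[OF p(1)] by simp
    show "\<exists>n::nat. \<pi> [^]\<^bsub>K\<^esub> n \<otimes>\<^bsub>K\<^esub> x \<in> S" if x: "x \<in> carrier K" for x
    proof -
      obtain a b where ab: "a \<in> S" "b \<in> S" "b \<noteq> \<zero>\<^bsub>K\<^esub>" "x = a \<otimes>\<^bsub>K\<^esub> inv\<^bsub>K\<^esub> b"
        using frac x unfolding is_fraction_field_of_def by blast
      obtain n :: nat and u where u: "u \<in> S" "\<pi> [^]\<^bsub>K\<^esub> n = b \<otimes>\<^bsub>K\<^esub> u" using div[OF ab(2,3)] by blast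
      have b: "b \<in> Units K" using ab SK K.field_Units by blast
      have c: "a \<in> carrier K" "b \<in> carrier K" "u \<in> carrier K" "inv\<^bsub>K\<^esub> b \<in> carrier K" using ab u b SK by auto
      have "\<pi> [^]\<^bsub>K\<^esub> n \<otimes>\<^bsub>K\<^esub> x = (u \<otimes>\<^bsub>K\<^esub> a) \<otimes>\<^bsub>K\<^esub> (b \<otimes>\<^bsub>K\<^esub> inv\<^bsub>K\<^esub> b)"
        unfolding u(2) ab(4) using c by (simp add: K.m_ac)
      then have "\<pi> [^]\<^bsub>K\<^esub> n \<otimes>\<^bsub>K\<^esub> x = u \<otimes>\<^bsub>K\<^esub> a" using b c by simp
      then show ?thesis using sE(6)[OF u(1) ab(1)] by metis
    qed
    show "\<exists>!z. z \<in> S \<and> (\<forall>i. \<exists>y\<in>S. z \<ominus>\<^bsub>K\<^esub> x i = \<pi> [^]\<^bsub>K\<^esub> i \<otimes>\<^bsub>K\<^esub> y)"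
      if "\<And>i. x i \<in> S" "\<And>i. \<exists>y\<in>S. x (Suc i) \<ominus>\<^bsub>K\<^esub> x i = \<pi> [^]\<^bsub>K\<^esub> i \<otimes>\<^bsub>K\<^esub> y" for x :: "nat \<Rightarrow> 'a"
      using complete[of x] that by blast
  qed
  then show ?thesis by blast
qed

section \<open>Local Beilinson-Tate operators\<close>

lemma BT_ideal_subset: "BT_ideal k K \<iota> Os \<sigma>s M N i j \<subseteq> BT k K \<iota> Os \<sigma>s M N"
  by (cases "(k, K, \<iota>, Os, \<sigma>s, M, N, i, j)" rule: BT_ideal.cases) auto

lemma system_of_liftings_Nil: "system_of_liftings k K \<iota> T [] \<sigma>s \<Longrightarrow> \<sigma>s = []"
  by (cases \<sigma>s) auto

lemma system_of_liftings_Cons: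
  assumes "system_of_liftings k K \<iota> T (S # Os) \<sigma>s'"
  obtains \<sigma> \<sigma>s where "\<sigma>s' = \<sigma> # \<sigma>s" "\<sigma> \<in> ring_hom (residue_field K S) (sub_ring K S)"
    "\<forall>c\<in>carrier k. \<sigma> (residue_map K S (\<iota> c)) = \<iota> c"
    "\<forall>x\<in>carrier (residue_field K S). residue_map K S (\<sigma> x) = x"
    "system_of_liftings k (residue_field K S) (residue_map K S \<circ> \<iota>) (residue_topology K S T) Os \<sigma>s"
  using assms by (cases \<sigma>s') auto

text \<open>Dimension zero: the operators are all \<open>k\<close>-linear maps, and there are no
  ideals yet.\<close>

lemma bt_family_Hom:
  fixes K :: "'a ring"
  assumes "field K" "cring k" "\<iota> \<in> ring_hom k K"
  shows "bt_family k K \<iota> (\<lambda>(M :: ('a, 'b) module) N. Hom_mod k (rest \<iota> M) (rest \<iota> N)) (\<lambda>M N. Hom_mod k (rest \<iota> M) (rest \<iota> N))"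
proof -
  have m: "module k (rest \<iota> M)" if "finite_module K M" for M :: "('a, 'b) module"
    by (rule module_rest[OF finite_module_is_module[OF that] assms(2,3)])
  show ?thesis
    unfolding bt_family_def
  proof (intro conjI allI impI ballI subset_refl)
    show "Hom_mod K M N \<subseteq> Hom_mod k (rest \<iota> M) (rest \<iota> N)" for M N :: "('a, 'b) module"
      using Hom_mod_rest[OF _ assms(3)] by blast
    show "(\<lambda>x\<in>carrier M. \<zero>\<^bsub>N\<^esub>) \<in> Hom_mod k (rest \<iota> M) (rest \<iota> N)"
      if "finite_module K M" "finite_module K N" for M N :: "('a, 'b) module"
      using Hom_mod_zero_map[OF m m] that by simp
    show "(\<lambda>x\<in>carrier M. \<phi> x \<oplus>\<^bsub>N\<^esub> \<psi> x) \<in> Hom_mod k (rest \<iota> M) (rest \<iota> N)"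
      if "finite_module K M" "finite_module K N" "\<phi> \<in> Hom_mod k (rest \<iota> M) (rest \<iota> N)"
        "\<psi> \<in> Hom_mod k (rest \<iota> M) (rest \<iota> N)" for M N :: "('a, 'b) module" and \<phi> \<psi>
      using Hom_mod_add[OF that(3,4) m m] that by simp
  qed (use Hom_mod_compose m module.axioms(2) in fastforce)+
qed

text \<open>
  The last conjunct splits only the identity of \<open>K\<close> itself: for \<open>i > 1\<close> the splitting on \<open>K\<close> is
  obtained by applying the splitting on the residue field to the digits of the \<open>\<pi>\<close>-adic expansion,
  and the module \<open>K\<close> is all that is needed in the theorem.
\<close>

lemma BT_properties:
  fixes K :: "'a ring" and \<iota> :: "'k \<Rightarrow> 'a"
  assumes "field k" "local_field Os K" "\<iota> \<in> ring_hom k (sub_ring K (ring_of_integers Os K))"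
    "finite_module k (rest (last_residue_map Os K \<circ> \<iota>) (ring_module (last_residue_field Os K)))"
    "system_of_liftings k K \<iota> T Os \<sigma>s"
  defines "B \<equiv> (\<lambda>(M :: ('a, 'a) module) (N :: ('a, 'a) module). BT k K \<iota> Os \<sigma>s M N)"
    and "J \<equiv> (\<lambda>i j (M :: ('a, 'a) module) (N :: ('a, 'a) module). BT_ideal k K \<iota> Os \<sigma>s M N i j)"
    and "R \<equiv> ring_module K"
  shows "field K \<and> \<iota> \<in> ring_hom k K \<and> bt_family k K \<iota> B B \<and>
    (\<forall>i\<in>{1..length Os}. \<forall>j\<in>{1, 2}. bt_family k K \<iota> B (J i j)) \<and>
    (\<forall>M \<phi>. finite_module K M \<longrightarrow> \<phi> \<in> B M M \<longrightarrow> (\<forall>i\<in>{1..length Os}. \<forall>j\<in>{1, 2}. \<phi> \<in> J i j M M) \<longrightarrow>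
       finite_potent k (rest \<iota> M) \<phi>) \<and>
    (\<forall>i\<in>{1..length Os}. \<exists>e1\<in>J i 1 R R. \<exists>e2\<in>J i 2 R R. \<forall>x\<in>carrier K. e1 x \<oplus>\<^bsub>K\<^esub> e2 x = x)"
  using assms(2-5) unfolding B_def J_def R_def
proof (induction Os arbitrary: K \<iota> T \<sigma>s)
  case Nil
  have k: "cring k" using assms(1) by (simp add: field_def domain_def)
  have K: "field K" using Nil.prems(1) by simp
  have \<iota>: "\<iota> \<in> ring_hom k K" using Nil.prems(2) by simp
  have \<sigma>s: "\<sigma>s = []" using system_of_liftings_Nil[OF Nil.prems(4)] .
  have "last_residue_map [] K \<circ> \<iota> = \<iota>" by (simp add: fun_eq_iff)
  then have fin: "finite_module k (rest \<iota> (ring_module K))" using Nil.prems(3) by simp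
  \<comment> \<open>In dimension zero \<open>K\<close> is its own last residue field, hence finite
    over \<open>k\<close>; the first power already has finite rank.\<close>
  have "finite_potent k (rest \<iota> M) \<phi>" if M: "finite_module K M" and \<phi>: "\<phi> \<in> Hom_mod k (rest \<iota> M) (rest \<iota> M)"
    for M :: "('a, 'a) module" and \<phi>
  proof -
    have fM: "finite_module k (rest \<iota> M)" by (rule finite_module_trans[OF M k \<iota> fin])
    have "finite_module k ((rest \<iota> M)\<lparr>carrier := \<phi> ` carrier M\<rparr>)"
      using finite_module_image[OF fM finite_module_is_module[OF fM] \<phi>] by simp
    moreover have "(\<phi> [^]\<^bsub>End_ring k (rest \<iota> M)\<^esub> (1::nat)) x = \<phi> x" if "x \<in> carrier M" for x
      using End_ring_pow[of "rest \<iota> M" \<phi> x k 1] Hom_modD(1)[OF \<phi>] that by simp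
    ultimately show ?thesis unfolding finite_potent_def
      by (intro exI[of _ 1]) (simp cong: image_cong_simp)
  qed
  then show ?case using K \<iota> bt_family_Hom[OF K k \<iota>] by (simp add: \<sigma>s)
next
  case (Cons S Os)
  obtain \<sigma> \<tau>s where \<sigma>: "\<sigma>s = \<sigma> # \<tau>s" "\<sigma> \<in> ring_hom (residue_field K S) (sub_ring K S)"
    "\<forall>c\<in>carrier k. \<sigma> (residue_map K S (\<iota> c)) = \<iota> c"
    "\<forall>x\<in>carrier (residue_field K S). residue_map K S (\<sigma> x) = x"
    "system_of_liftings k (residue_field K S) (residue_map K S \<circ> \<iota>) (residue_topology K S T) Os \<tau>s"
    using system_of_liftings_Cons[OF Cons.prems(4)] .
  have lf: "is_fraction_field_of K S" "complete_dvr (sub_ring K S)" "local_field Os (residue_field K S)"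
    using Cons.prems(1) by simp_all
  have SK: "S \<subseteq> carrier K" using lf(1) subringE(1) unfolding is_fraction_field_of_def by blast
  have \<iota>c: "\<iota> c \<in> S" "residue_map K S (\<iota> c) \<in> ring_of_integers Os (residue_field K S)" if "c \<in> carrier k" for c
    using ring_hom_closed[OF Cons.prems(2) that] by auto
  have \<iota>: "\<iota> \<in> ring_hom k K"
    using Cons.prems(2) SK by (auto simp: ring_hom_def Pi_def)
  obtain \<pi> where "bt_step k K \<iota> S (residue_field K S) (residue_map K S) \<sigma> \<pi>"
    using bt_step_residue[OF assms(1) lf(1,2) \<iota> \<iota>c(1) \<sigma>(2-4)] by blast
  then interpret bt_step k K \<iota> S "residue_field K S" "residue_map K S" \<sigma> \<pi> .
  let ?\<kappa> = "residue_field K S"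
  have \<iota>'2: "\<iota>' \<in> ring_hom k (sub_ring ?\<kappa> (ring_of_integers Os ?\<kappa>))"
    using \<iota>'_hom \<iota>c(2) by (simp add: ring_hom_def)
  have fin: "finite_module k (rest (last_residue_map Os ?\<kappa> \<circ> \<iota>') (ring_module (last_residue_field Os ?\<kappa>)))"
    using Cons.prems(3) by (simp add: comp_def)
  define B' where "B' = (\<lambda>(M :: ('a, 'a) module) (N :: ('a, 'a) module). BT k ?\<kappa> \<iota>' Os \<tau>s M N)"
  define J' where "J' = (\<lambda>i j (M :: ('a, 'a) module) (N :: ('a, 'a) module). BT_ideal k ?\<kappa> \<iota>' Os \<tau>s M N i j)"
  note IH = Cons.IH[OF lf(3) \<iota>'2 fin \<sigma>(5)]
  have F': "bt_family k ?\<kappa> \<iota>' B' B'" unfolding B'_def using IH by blast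
  have J'F: "bt_family k ?\<kappa> \<iota>' B' (J' i j)" if "i \<in> {1..length Os}" "j \<in> {1, 2}" for i j
    unfolding B'_def J'_def using IH that by blast
  have potent': "finite_potent k (rest \<iota>' M) \<phi>" if "finite_module ?\<kappa> M" "\<phi> \<in> B' M M"
    "\<And>i j. i \<in> {1..length Os} \<Longrightarrow> j \<in> {1, 2} \<Longrightarrow> \<phi> \<in> J' i j M M" for M \<phi>
    using IH that unfolding B'_def J'_def by blast
  have dec': "\<exists>e1\<in>J' i 1 (ring_module ?\<kappa>) (ring_module ?\<kappa>). \<exists>e2\<in>J' i 2 (ring_module ?\<kappa>) (ring_module ?\<kappa>).
    \<forall>x\<in>carrier ?\<kappa>. e1 x \<oplus>\<^bsub>?\<kappa>\<^esub> e2 x = x" if "i \<in> {1..length Os}" for i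
    unfolding J'_def using IH that by blast
  let ?B = "\<lambda>(M :: ('a, 'a) module) (N :: ('a, 'a) module). BT k K \<iota> (S # Os) \<sigma>s M N"
  let ?J = "\<lambda>i j (M :: ('a, 'a) module) (N :: ('a, 'a) module). BT_ideal k K \<iota> (S # Os) \<sigma>s M N i j"
  \<comment> \<open>Restating the recursion equations through \<open>lift\<close>,
    \<open>bounded_ops\<close> and \<open>discrete_ops\<close> makes the results of the locale
    applicable.\<close>
  have B: "?B = lift B'"
    unfolding \<sigma>(1) B'_def by (intro ext) (auto simp: lift_def refinable_def)
  have J11: "?J 1 1 = bounded_ops (lift B')"
    unfolding B[symmetric] by (intro ext) (auto simp: bounded_ops_def \<sigma>(1))
  have J12: "?J 1 2 = discrete_ops (lift B')"
    unfolding B[symmetric] by (intro ext) (auto simp: discrete_ops_def \<sigma>(1))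
  have J: "?J (Suc i) j = lift (J' i j)" if "i \<ge> 1" for i j
  proof (intro ext Set.set_eqI)
    fix M N :: "('a, 'a) module" and \<phi>
    \<comment> \<open>\<open>BT_ideal\<close> tests the induced map both for the family and for the
      ideal; the second test implies the first.\<close>
    have J'B': "J' i j M N \<subseteq> B' M N" for M N unfolding J'_def B'_def by (rule BT_ideal_subset)
    have "\<phi> \<in> ?J (Suc i) j M N \<longleftrightarrow> \<phi> \<in> lift B' M N \<and> (\<forall>L1\<in>Lat K S M. \<forall>L2\<in>Lat K S N. \<forall>L1'\<in>Lat K S M. \<forall>L2'\<in>Lat K S N.
        refinement \<phi> (L1', L2') (L1, L2) \<longrightarrow> induced_map M N \<phi> (L1', L2') (L1, L2) \<in>
          J' i j (lattice_quot \<sigma> M L1 L1') (lattice_quot \<sigma> N L2' L2))"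
      unfolding B[symmetric] using that by (simp add: \<sigma>(1) J'_def del: BT.simps)
    also have "\<dots> \<longleftrightarrow> \<phi> \<in> lift (J' i j) M N"
      unfolding lift_def using J'B' by blast
    finally show "\<phi> \<in> ?J (Suc i) j M N \<longleftrightarrow> \<phi> \<in> lift (J' i j) M N" .
  qed
  note J11_at = fun_cong[OF fun_cong[OF J11]] and J12_at = fun_cong[OF fun_cong[OF J12]]
  have F: "bt_family k K \<iota> ?B ?B" unfolding B by (rule bt_family_lift[OF F'])
  have ref: "refinable M N \<phi>" if "\<phi> \<in> ?B M N" for M N \<phi> using that unfolding B by (rule liftD(2))
  have idx: "i = 1 \<or> (\<exists>i'\<in>{1..length Os}. i = Suc i')" if "i \<in> {1..length (S # Os)}" for i
    using that by (cases i) auto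
  have JF: "bt_family k K \<iota> ?B (?J i j)" if i: "i \<in> {1..length (S # Os)}" and j: "j \<in> {1, 2}" for i j
    using idx[OF i]
  proof (elim disjE bexE)
    assume i1: "i = 1"
    consider "j = 1" | "j = 2" using j by blast
    then show ?thesis
    proof cases
      case 1
      show ?thesis unfolding i1 1 J11 B by (rule bt_family_bounded[OF F[unfolded B] ref[unfolded B]])
    next
      case 2
      show ?thesis unfolding i1 2 J12 B by (rule bt_family_discrete[OF F[unfolded B] ref[unfolded B]])
    qed
  next
    fix i' assume i': "i' \<in> {1..length Os}" "i = Suc i'"
    have "1 \<le> i'" using i'(1) by simp
    show ?thesis unfolding i'(2) J[OF \<open>1 \<le> i'\<close>] B by (rule bt_family_lift[OF J'F[OF i'(1) j]])
  qed
  have potent: "finite_potent k (rest \<iota> M) \<phi>"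
    if M: "finite_module K M" and \<phi>: "\<phi> \<in> ?B M M" "\<forall>i\<in>{1..length (S # Os)}. \<forall>j\<in>{1, 2}. \<phi> \<in> ?J i j M M" for M \<phi>
  proof -
    have in_J: "\<phi> \<in> ?J i j M M" if "i \<in> {1..length (S # Os)}" "j \<in> {1, 2}" for i j using \<phi>(2) that by blast
    have "\<phi> \<in> ?J 1 1 M M" "\<phi> \<in> ?J 1 2 M M" by (rule in_J; simp)+
    then obtain L1 L2 where L: "L2 \<in> Lat K S M" "\<phi> ` carrier M \<subseteq> L2" "L1 \<in> Lat K S M" "\<forall>x\<in>L1. \<phi> x = \<zero>\<^bsub>M\<^esub>"
      unfolding J11_at J12_at bounded_ops_def discrete_ops_def by blast
    note l = liftD[OF \<phi>(1)[unfolded fun_cong[OF fun_cong[OF B]]]]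
    show ?thesis
    proof (rule finite_potent_step[OF finite_module_is_module[OF M] l(1) L])
      \<comment> \<open>For this pair source and target of the induced map are the same quotient
        \<open>L2/L1\<close>, so it is an endomorphism and the induction hypothesis on finite
        potency applies.\<close>
      fix L1 L2 assume r: "refines M M \<phi> L1 L2 L2 L1"
      show "finite_potent k (rest \<iota>' (lattice_quot \<sigma> M L2 L1)) (induced_map M M \<phi> (L1, L2) (L2, L1))"
      proof (rule potent'[OF refines_quot(1)[OF r] l(3)[OF r]])
        fix i j assume i: "i \<in> {1..length Os}" and j: "j \<in> {1, 2 :: nat}"
        have "\<phi> \<in> ?J (Suc i) j M M" using i j by (intro in_J) auto
        then have "\<phi> \<in> lift (J' i j) M M" using J[of i j, THEN fun_cong, THEN fun_cong] i by (simp del: BT_ideal.simps)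
        then show "induced_map M M \<phi> (L1, L2) (L2, L1) \<in> J' i j (lattice_quot \<sigma> M L2 L1) (lattice_quot \<sigma> M L2 L1)"
          using r by (rule liftD(3))
      qed
    qed
  qed
  let ?R = "ring_module K" and ?R\<kappa> = "ring_module ?\<kappa>"
  have dec: "\<exists>e1\<in>?J i 1 ?R ?R. \<exists>e2\<in>?J i 2 ?R ?R. \<forall>x\<in>carrier K. e1 x \<oplus>\<^bsub>K\<^esub> e2 x = x"
    if i: "i \<in> {1..length (S # Os)}" for i
    using idx[OF i]
  proof (elim disjE bexE)
    assume "i = 1"
    then show ?thesis using bounded_discrete_decomposition[OF F'] unfolding J11_at[symmetric] J12_at[symmetric] by simp
  next
    fix i' assume i': "i' \<in> {1..length Os}" "i = Suc i'"
    obtain e1 e2 where e: "e1 \<in> J' i' 1 ?R\<kappa> ?R\<kappa>" "e2 \<in> J' i' 2 ?R\<kappa> ?R\<kappa>"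
      "\<forall>x\<in>carrier ?\<kappa>. e1 x \<oplus>\<^bsub>?\<kappa>\<^esub> e2 x = x" using dec'[OF i'(1)] by blast
    have f: "bt_family k ?\<kappa> \<iota>' B' (J' i' 1)" "bt_family k ?\<kappa> \<iota>' B' (J' i' 2)" using J'F[OF i'(1)] by auto
    note fin = finite_ring_module[OF field_\<kappa>]
    have "e1 \<in> Hom_mod k (rest \<iota>' ?R\<kappa>) (rest \<iota>' ?R\<kappa>)" "e2 \<in> Hom_mod k (rest \<iota>' ?R\<kappa>) (rest \<iota>' ?R\<kappa>)"
      using bt_familyD(2)[OF f(1) fin fin bt_familyD(1)[OF f(1) fin fin e(1)]]
        bt_familyD(2)[OF f(2) fin fin bt_familyD(1)[OF f(2) fin fin e(2)]] by auto
    then have "\<forall>x\<in>carrier K. digitwise e1 x \<oplus>\<^bsub>K\<^esub> digitwise e2 x = x" using digitwise_decomposition e(3) by blast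
    moreover have "digitwise e1 \<in> ?J i 1 ?R ?R" "digitwise e2 \<in> ?J i 2 ?R ?R"
      using digitwise_lift[OF f(1) e(1)] digitwise_lift[OF f(2) e(2)] J[of i' 1, THEN fun_cong, THEN fun_cong] J[of i' 2, THEN fun_cong, THEN fun_cong] i' by (simp_all del: BT_ideal.simps)
    ultimately show ?thesis by blast
  qed
  show ?case using field_K \<iota> F JF potent dec by blast
qed

theorem theorem0p4:
  fixes k :: "'k ring" and K :: "'a ring" and \<iota> :: "'k \<Rightarrow> 'a"
    and Os :: "'a set list" and T :: "'a topology" and n :: nat
    and \<sigma>s :: "('a \<Rightarrow> 'a) list"
  assumes "perfect_field k"
    and "topological_local_field n k K \<iota> Os T"
    and "system_of_liftings k K \<iota> T Os \<sigma>s"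
  shows "cubically_decomposed_ring k K \<iota> n
    (BT k K \<iota> Os \<sigma>s (ring_module K) (ring_module K))
    (BT_ideal k K \<iota> Os \<sigma>s (ring_module K) (ring_module K))"
proof -
  let ?R = "ring_module K"
  let ?B = "\<lambda>(M :: ('a, 'a) module) (N :: ('a, 'a) module). BT k K \<iota> Os \<sigma>s M N"
  let ?J = "\<lambda>i j (M :: ('a, 'a) module) (N :: ('a, 'a) module). BT_ideal k K \<iota> Os \<sigma>s M N i j"
  have k: "field k" using assms(1) by (simp add: perfect_field_def)
  have n: "length Os = n" using assms(2) by (simp add: topological_local_field_def)
  note main = BT_properties[OF k _ _ _ assms(3), unfolded n]
  have tlf: "local_field Os K" "\<iota> \<in> ring_hom k (sub_ring K (ring_of_integers Os K))"
    "finite_module k (rest (last_residue_map Os K \<circ> \<iota>) (ring_module (last_residue_field Os K)))"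
    using assms(2) unfolding topological_local_field_def by blast+
  note main = BT_properties[OF k tlf assms(3), unfolded n]
  have K: "field K" and \<iota>: "\<iota> \<in> ring_hom k K" and F: "bt_family k K \<iota> ?B ?B"
    using main by blast+
  have dec: "\<forall>i\<in>{1..n}. \<exists>e1\<in>?J i 1 ?R ?R. \<exists>e2\<in>?J i 2 ?R ?R. \<forall>x\<in>carrier K. e1 x \<oplus>\<^bsub>K\<^esub> e2 x = x"
    by (rule main[THEN conjunct2, THEN conjunct2, THEN conjunct2, THEN conjunct2, THEN conjunct2])
  have potent: "\<forall>M \<phi>. finite_module K M \<longrightarrow> \<phi> \<in> ?B M M \<longrightarrow> (\<forall>i\<in>{1..n}. \<forall>j\<in>{1, 2}. \<phi> \<in> ?J i j M M) \<longrightarrow>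
      finite_potent k (rest \<iota> M) \<phi>"
    by (rule main[THEN conjunct2, THEN conjunct2, THEN conjunct2, THEN conjunct2, THEN conjunct1])
  have J: "bt_family k K \<iota> ?B (?J i j)" if "i \<in> {1..n}" "j \<in> {1, 2}" for i j using main that by blast
  interpret K: field K by (rule K)
  have ck: "cring k" using k by (simp add: field_def domain_def)
  have mR: "module K ?R" by (rule module_ring_module[OF K.cring_axioms])
  have fR: "finite_module K ?R" by (rule finite_ring_module[OF K])
  have mk: "module k (rest \<iota> ?R)" by (rule module_rest[OF mR ck \<iota>])
  let ?E = "BT k K \<iota> Os \<sigma>s ?R ?R" and ?End = "End_ring k (rest \<iota> ?R)"
  interpret End: ring ?End by (rule ring_End_ring[OF mk])
  note D = bt_familyD[OF F fR fR]
  have mult: "(\<lambda>x\<in>carrier K. a \<otimes>\<^bsub>K\<^esub> x) \<in> ?E" if "a \<in> carrier K" for a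
    using D(3)[OF Hom_mod_smult[OF mR that]] by simp
  have one: "\<one>\<^bsub>?End\<^esub> \<in> ?E" using D(3)[OF Hom_mod_id[OF mR]] by simp
  have sub: "?E \<subseteq> carrier ?End" using D(2) by auto
  have mult_E: "\<phi> \<otimes>\<^bsub>?End\<^esub> \<psi> \<in> ?E" if "\<phi> \<in> ?E" "\<psi> \<in> ?E" for \<phi> \<psi>
    using D(6)[OF fR that(2,1)] by simp
  have E: "subring ?E ?End"
  proof (rule End.subringI[OF sub one])
    \<comment> \<open>Closure under negation: -\<phi> is the composite of \<phi> with multiplication
      by -1, which is an operator in \<open>?E\<close>.\<close>
    let ?m = "\<lambda>x\<in>carrier K. (\<ominus>\<^bsub>K\<^esub> \<one>\<^bsub>K\<^esub>) \<otimes>\<^bsub>K\<^esub> x"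
    have m: "?m \<in> ?E" by (rule mult) simp
    have "?m \<oplus>\<^bsub>?End\<^esub> \<one>\<^bsub>?End\<^esub> = \<zero>\<^bsub>?End\<^esub>" by (auto simp: fun_eq_iff K.l_minus K.l_neg)
    then have neg: "\<ominus>\<^bsub>?End\<^esub> \<one>\<^bsub>?End\<^esub> = ?m"
      by (rule End.minus_equality[OF _ End.one_closed]) (use m sub in blast)
    fix \<phi> assume \<phi>: "\<phi> \<in> ?E"
    then have "\<phi> \<in> carrier ?End" using sub by blast
    then have "\<ominus>\<^bsub>?End\<^esub> \<phi> = (\<ominus>\<^bsub>?End\<^esub> \<one>\<^bsub>?End\<^esub>) \<otimes>\<^bsub>?End\<^esub> \<phi>"
      by (simp only: End.l_minus[OF End.one_closed] End.l_one)
    then show "\<ominus>\<^bsub>?End\<^esub> \<phi> \<in> ?E" using mult_E[OF m \<phi>] neg by (simp only:)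
  next
    show "\<phi> \<otimes>\<^bsub>?End\<^esub> \<psi> \<in> ?E" if "\<phi> \<in> ?E" "\<psi> \<in> ?E" for \<phi> \<psi> by (rule mult_E[OF that])
    show "\<phi> \<oplus>\<^bsub>?End\<^esub> \<psi> \<in> ?E" if "\<phi> \<in> ?E" "\<psi> \<in> ?E" for \<phi> \<psi> using D(5)[OF that] by simp
  qed
  have ring_E: "ring (?End\<lparr>carrier := ?E\<rparr>)" by (rule End.subring_is_ring[OF E])
  have ideal: "ideal (?J i j ?R ?R) (?End\<lparr>carrier := ?E\<rparr>)" if "i \<in> {1..n}" "j \<in> {1, 2}" for i j
  proof (rule idealI_mult[OF ring_E])
    note DJ = bt_familyD[OF J[OF that] fR fR]
    show "?J i j ?R ?R \<subseteq> carrier (?End\<lparr>carrier := ?E\<rparr>)" using DJ(1) by auto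
    show "\<zero>\<^bsub>?End\<lparr>carrier := ?E\<rparr>\<^esub> \<in> ?J i j ?R ?R" using DJ(4) by simp
    show "\<phi> \<oplus>\<^bsub>?End\<lparr>carrier := ?E\<rparr>\<^esub> \<psi> \<in> ?J i j ?R ?R" if "\<phi> \<in> ?J i j ?R ?R" "\<psi> \<in> ?J i j ?R ?R" for \<phi> \<psi>
      using DJ(5)[OF that] by simp
    show "\<phi> \<otimes>\<^bsub>?End\<lparr>carrier := ?E\<rparr>\<^esub> \<psi> \<in> ?J i j ?R ?R" if "\<phi> \<in> carrier (?End\<lparr>carrier := ?E\<rparr>)" "\<psi> \<in> ?J i j ?R ?R" for \<phi> \<psi>
      using DJ(6)[OF fR that(2)] that(1) by simp
    show "\<psi> \<otimes>\<^bsub>?End\<lparr>carrier := ?E\<rparr>\<^esub> \<phi> \<in> ?J i j ?R ?R" if "\<phi> \<in> carrier (?End\<lparr>carrier := ?E\<rparr>)" "\<psi> \<in> ?J i j ?R ?R" for \<phi> \<psi>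
      using DJ(7)[OF fR _ that(2)] that(1) by simp
  qed
  show ?thesis
  proof (rule cubically_decomposed_ring.intro)
    show "cring K" by (rule K.cring_axioms)
    show "\<iota> \<in> ring_hom k K" by (rule \<iota>)
    show "subring ?E ?End" by (rule E)
    show "(\<lambda>x\<in>carrier K. a \<otimes>\<^bsub>K\<^esub> x) \<in> ?E" if "a \<in> carrier K" for a by (rule mult[OF that])
    show "ideal (BT_ideal k K \<iota> Os \<sigma>s ?R ?R i j) (?End\<lparr>carrier := ?E\<rparr>)" if "i \<in> {1..n}" "j \<in> {1, 2}" for i j
      by (rule ideal[OF that])
    show "?E = BT_ideal k K \<iota> Os \<sigma>s ?R ?R i 1 <+>\<^bsub>?End\<^esub> BT_ideal k K \<iota> Os \<sigma>s ?R ?R i 2" if i: "i \<in> {1..n}" for i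
    proof
      have J12: "bt_family k K \<iota> ?B (?J i 1)" "bt_family k K \<iota> ?B (?J i 2)" using J[OF i] by auto
      obtain e1 e2 where e: "e1 \<in> ?J i 1 ?R ?R" "e2 \<in> ?J i 2 ?R ?R" "\<forall>x\<in>carrier K. e1 x \<oplus>\<^bsub>K\<^esub> e2 x = x"
        using dec[rule_format, OF i] by (elim bexE)
      show "?E \<subseteq> ?J i 1 ?R ?R <+>\<^bsub>?End\<^esub> ?J i 2 ?R ?R"
      proof
        fix \<phi> assume \<phi>: "\<phi> \<in> ?E"
        note h = Hom_modD[OF D(2)[OF \<phi>]]
        \<comment> \<open>The splitting of the identity is applied after \<phi>, and the ideals
          absorb \<phi> from the right.\<close>
        have "compose (carrier K) e1 \<phi> \<in> ?J i 1 ?R ?R" "compose (carrier K) e2 \<phi> \<in> ?J i 2 ?R ?R"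
          using bt_familyD(7)[OF J12(1) fR fR fR \<phi> e(1)] bt_familyD(7)[OF J12(2) fR fR fR \<phi> e(2)] by simp_all
        moreover have "\<phi> = compose (carrier K) e1 \<phi> \<oplus>\<^bsub>?End\<^esub> compose (carrier K) e2 \<phi>"
          using h(1,4) e(3) by (auto simp: fun_eq_iff compose_eq extensional_def)
        ultimately show "\<phi> \<in> ?J i 1 ?R ?R <+>\<^bsub>?End\<^esub> ?J i 2 ?R ?R"
          unfolding set_add_def set_mult_def by (intro UN_I[of "compose (carrier K) e1 \<phi>"] UN_I[of "compose (carrier K) e2 \<phi>"]) simp_all
      qed
      show "?J i 1 ?R ?R <+>\<^bsub>?End\<^esub> ?J i 2 ?R ?R \<subseteq> ?E"
      proof
        fix \<phi> assume "\<phi> \<in> ?J i 1 ?R ?R <+>\<^bsub>?End\<^esub> ?J i 2 ?R ?R"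
        then obtain a b where "a \<in> ?J i 1 ?R ?R" "b \<in> ?J i 2 ?R ?R" "\<phi> = a \<oplus>\<^bsub>?End\<^esub> b"
          unfolding set_add_defs by auto
        then show "\<phi> \<in> ?E"
          using D(5)[OF bt_familyD(1)[OF J12(1) fR fR] bt_familyD(1)[OF J12(2) fR fR], of a b] by simp
      qed
    qed
    show "finite_potent k (rest \<iota> ?R) \<phi>" if "\<phi> \<in> ?E \<inter> (\<Inter>i\<in>{1..n}. \<Inter>j\<in>{1, 2}. BT_ideal k K \<iota> Os \<sigma>s ?R ?R i j)" for \<phi>
    proof -
      have "\<phi> \<in> ?E" "\<forall>i\<in>{1..n}. \<forall>j\<in>{1, 2}. \<phi> \<in> ?J i j ?R ?R" using that by auto
      then show ?thesis using potent fR by blast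
    qed
  qed
qed

end
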